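(* For every integer $t\ge2$ and every rational $d\in(t/2,\infty)$ there exist balanced rooted graphs $F_1,\dots,F_k$, each of rooted density at least $d$, and an integer $L_d(t)$ such that for all $L\ge L_d(t)$, \[\mathrm{ex}\left(n,K_t,F_1^L\cup\dots\cup F_k^L\right)=\Theta\!\left(n^{t-\binom t2/d}\right),\] where the implied constants may depend on all parameters except $n$.
   Context: $\mathrm{ex}(n,H,\mathcal{F})$ is the maximum number of copies of $H$ in an $n$-vertex graph containing no member of $\mathcal{F}$ as a subgraph. A rooted graph $(F,R)$ is a graph $F$ with a set $R\subseteq V(F)$ of roots. For nonempty $S\subseteq V(F)\setminus R$, $d(S)=e(S)/|S|$ where $e(S)$ is the number of edges with at least one endpoint in $S$; the rooted density of $(F,R)$ is $d(V(F)\setminus R)$, and $(F,R)$ is balanced if $d(S)\ge d(V(F)\setminus R)$ for all nonempty $S\subseteq V(F)\setminus R$. The $L$-th power $(F,R)^L$ is the set of all graphs obtained as the union of $L$ distinct copies of $F$ which share $R$ and may intersect arbitrarily outside $R$. *)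

theory Defs
  imports Complex_Main "HOL-Library.Landau_Symbols"
begin

text \<open>Finite simple graphs, as pairs of a vertex set and a set of two-element edges.\<close>

type_synonym 'a ugraph = "'a set \<times> 'a set set"

abbreviation verts :: "'a ugraph \<Rightarrow> 'a set" where "verts G \<equiv> fst G"

abbreviation edges :: "'a ugraph \<Rightarrow> 'a set set" where "edges G \<equiv> snd G"

definition simple_graph :: "'a ugraph \<Rightarrow> bool" where
  "simple_graph G \<longleftrightarrow> finite (verts G) \<and> (\<forall>e\<in>edges G. e \<subseteq> verts G \<and> card e = 2)"

definition subgraph :: "'a ugraph \<Rightarrow> 'a ugraph \<Rightarrow> bool" where
  "subgraph K G \<longleftrightarrow> verts K \<subseteq> verts G \<and> edges K \<subseteq> edges G"

definition map_graph :: "('a \<Rightarrow> 'b) \<Rightarrow> 'a ugraph \<Rightarrow> 'b ugraph" where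
  "map_graph f G = (f ` verts G, (\<lambda>e. f ` e) ` edges G)"

definition isomorphic :: "'a ugraph \<Rightarrow> 'b ugraph \<Rightarrow> bool" where
  "isomorphic H K \<longleftrightarrow> (\<exists>f. inj_on f (verts H) \<and> K = map_graph f H)"

definition complete_graph :: "nat \<Rightarrow> nat ugraph" where
  "complete_graph t = ({..<t}, {e. e \<subseteq> {..<t} \<and> card e = 2})"

text \<open>Copies are unlabelled, that is, subgraphs (not necessarily induced) isomorphic to \<open>H\<close>.\<close>

definition copies :: "'a ugraph \<Rightarrow> 'b ugraph \<Rightarrow> 'b ugraph set" where
  "copies H G = {K. subgraph K G \<and> isomorphic H K}"

definition free_of :: "'a ugraph set \<Rightarrow> 'b ugraph \<Rightarrow> bool" where
  "free_of \<F> G \<longleftrightarrow> (\<forall>F\<in>\<F>. copies F G = {})"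

text \<open>Up to isomorphism, every graph on \<open>n\<close> vertices has vertex set \<open>{..<n}\<close>. The value is
  meaningful only if some graph on \<open>n\<close> vertices is \<open>\<F>\<close>-free, for instance if every
  member of \<open>\<F>\<close> has an edge.\<close>

definition ex_num :: "nat \<Rightarrow> 'a ugraph \<Rightarrow> 'b ugraph set \<Rightarrow> nat" where
  "ex_num n H \<F> = Max {card (copies H G) | G :: nat ugraph.
     simple_graph G \<and> verts G = {..<n} \<and> free_of \<F> G}"

definition rooted_graph :: "'a ugraph \<Rightarrow> 'a set \<Rightarrow> bool" where
  "rooted_graph F R \<longleftrightarrow> simple_graph F \<and> R \<subseteq> verts F"

definition set_density :: "'a ugraph \<Rightarrow> 'a set \<Rightarrow> rat" where
  "set_density F S = of_nat (card {e \<in> edges F. e \<inter> S \<noteq> {}}) / of_nat (card S)"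

text \<open>If every vertex is a root, the density is \<open>0\<close> by the convention for division by
  zero, so a positive lower bound on it entails that there is a non-root vertex.\<close>

definition rooted_density :: "'a ugraph \<Rightarrow> 'a set \<Rightarrow> rat" where
  "rooted_density F R = set_density F (verts F - R)"

definition balanced :: "'a ugraph \<Rightarrow> 'a set \<Rightarrow> bool" where
  "balanced F R \<longleftrightarrow>
     (\<forall>S. S \<noteq> {} \<and> S \<subseteq> verts F - R \<longrightarrow> set_density F S \<ge> rooted_density F R)"

text \<open>Copies sharing \<open>R\<close> agree on it pointwise; by injectivity their other vertices avoid
  \<open>R\<close>. New vertices are taken from the whole vertex type, which should thus be infinite.\<close>

definition rooted_copies :: "'a ugraph \<Rightarrow> 'a set \<Rightarrow> 'a ugraph set" where
  "rooted_copies F R = {map_graph f F | f. inj_on f (verts F) \<and> (\<forall>r\<in>R. f r = r)}"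

definition rooted_power :: "'a ugraph \<Rightarrow> 'a set \<Rightarrow> nat \<Rightarrow> 'a ugraph set" where
  "rooted_power F R L = {(\<Union>K\<in>C. verts K, \<Union>K\<in>C. edges K) | C.
     C \<subseteq> rooted_copies F R \<and> finite C \<and> card C = L}"

end

(*
  For the family take all balanced rooted graphs of rooted density at least d on a bounded number
  of vertices.

  Lower bound. Write d = b/a. The vertices are the points of A^b for a finite field A with q
  elements, and two vertices are adjacent iff f_1, ..., f_a all vanish at them, where the f_j are
  random symmetric functions. About
  q^(bt - a(t choose 2)) cliques survive. If some member of the family had very many copies on the
  same roots, then many of them would form a sunflower, and from its petals the random coefficients
  can be recovered by interpolation. This makes every sufficiently large set of coefficients
  algebraically dependent, with bounded degree, so such coefficients are too rare to matter;
  no estimate for the number of points of a variety is needed.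

  Upper bound. Induct on t. Let p < t be maximal with t + p - 1 < 2d. From a graph with too many
  t-cliques one deletes cliques until every vertex and every p-clique that is still covered lies in
  many of the remaining t-cliques, while (p+1)-cliques lie in boundedly many. Hence every
  tree of t-cliques glued along single vertices or p-cliques has many embeddings. Such a tree can be
  chosen such that, rooted at a suitable set of vertices, it has density exactly d, and every set of
  non-roots has density at least d. Pigeonholing over the images of the roots gives many embeddings
  with the same roots, which powers of balanced rooted graphs exclude.
*)
theory Submission
  imports Defs "HOL-Library.FuncSet" "HOL-Library.Z2" "HOL-Algebra.Algebraic_Closure_Type"
begin

section \<open>Bounded-degree algebraic dependence over a finite field\<close>

text \<open>Lower bound: a petal costs \<open>b\<close> parameters per vertex, and each of its edges
  determines \<open>a\<close> coefficients, so at density at least d = b/a it introduces no more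
  parameters than it determines coefficients. One coordinate from each of K petals is then an extra
  value without an extra parameter; as it runs over many values it can be eliminated, each time
  lowering the dimension by one. So the codimension grows with K, whereas placing the roots costs
  only a fixed power of q. Upper bound: p is the threshold for K_t. Rooted at p vertices it has
  fewer than d edges per non-root, so a p-clique is expected to lie in many t-cliques; rooted at p +
  1 vertices every set of non-roots has density at least d, which bounds the codegree. Exact density
  is what the pigeonhole needs: a tree with v vertices and e edges has about n^(v - e/d) embeddings,
  which is n^|R| precisely when e = d(v - |R|), and then a constant factor decides. As d is an
  arbitrary rational, a single clique does not suffice; edges are distributed as fractional loads
  along the tree.\<close>

definition expos :: "'i set \<Rightarrow> nat \<Rightarrow> ('i \<Rightarrow> nat) set" where
  "expos I m = PiE I (\<lambda>_. {..m})"

lemma finite_expos [simp]: "finite I \<Longrightarrow> finite (expos I m)"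
  by (simp add: expos_def finite_PiE)

lemma card_expos: "finite I \<Longrightarrow> card (expos I m) = (m + 1) ^ card I"
  by (simp add: expos_def card_PiE)

text \<open>The polynomial is nonzero formally: over a finite field it may still vanish at every
  point. Its degree is bounded in each variable separately, because the elimination of a variable
  preserves this bound.\<close>

definition alg_dependent :: "'i set \<Rightarrow> nat \<Rightarrow> ('i \<Rightarrow> 'a::field) set \<Rightarrow> bool" where
  "alg_dependent I \<rho> S \<longleftrightarrow> (\<exists>cf. (\<exists>\<alpha>\<in>expos I \<rho>. cf \<alpha> \<noteq> 0) \<and>
     (\<forall>x\<in>S. (\<Sum>\<alpha>\<in>expos I \<rho>. cf \<alpha> * (\<Prod>i\<in>I. x i ^ \<alpha> i)) = 0))"

text \<open>A bounded-degree substitute for having dimension less than \<open>k\<close>.\<close>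

definition all_dependent :: "'i set \<Rightarrow> nat \<Rightarrow> nat \<Rightarrow> ('i \<Rightarrow> 'a::field) set \<Rightarrow> bool" where
  "all_dependent J k \<rho> S \<longleftrightarrow> (\<forall>I\<subseteq>J. card I = k \<longrightarrow> alg_dependent I \<rho> S)"

text \<open>A finite field is a subset of a fixed ambient field, so that its order can vary within
  one theorem.\<close>

locale finite_subfield =
  fixes A :: "'a::field set"
  assumes finite_A: "finite A"
    and zero_A: "0 \<in> A" and one_A: "1 \<in> A"
    and add_A: "x \<in> A \<Longrightarrow> y \<in> A \<Longrightarrow> x + y \<in> A"
    and uminus_A: "x \<in> A \<Longrightarrow> - x \<in> A"
    and mult_A: "x \<in> A \<Longrightarrow> y \<in> A \<Longrightarrow> x * y \<in> A"
    and inverse_A: "x \<in> A \<Longrightarrow> inverse x \<in> A"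
begin

lemma diff_A: "x \<in> A \<Longrightarrow> y \<in> A \<Longrightarrow> x - y \<in> A"
  using add_A[of x "- y"] uminus_A by simp

lemma power_A: "x \<in> A \<Longrightarrow> x ^ n \<in> A"
  by (induction n) (auto simp: one_A mult_A)

lemma sum_A: "(\<And>i. i \<in> I \<Longrightarrow> f i \<in> A) \<Longrightarrow> sum f I \<in> A"
  by (induction I rule: infinite_finite_induct) (auto simp: zero_A add_A)

lemma card_A_ge: "card A \<ge> 2"
proof -
  have "card {0, 1::'a} \<le> card A"
    using finite_A zero_A one_A by (intro card_mono) auto
  then show ?thesis by simp
qed

text \<open>Functions rather than formal polynomials: the pigeonhole needs only an upper bound on
  their number, and closure under products needs no normal form.\<close>

inductive_set polyfuns :: "'i set \<Rightarrow> nat \<Rightarrow> (('i \<Rightarrow> 'a) \<Rightarrow> 'a) set" for I m where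
  zero: "(\<lambda>x. 0) \<in> polyfuns I m"
| step: "f \<in> polyfuns I m \<Longrightarrow> c \<in> A \<Longrightarrow> \<alpha> \<in> expos I m \<Longrightarrow>
    (\<lambda>x. c * (\<Prod>i\<in>I. x i ^ \<alpha> i) + f x) \<in> polyfuns I m"

lemma polyfuns_add:
  assumes "f \<in> polyfuns I m" "g \<in> polyfuns I m"
  shows "(\<lambda>x. f x + g x) \<in> polyfuns I m"
  using assms
proof (induction f rule: polyfuns.induct)
  case (step f c \<alpha>)
  then show ?case
    using polyfuns.step[of "\<lambda>x. f x + g x" I m c \<alpha>] by (simp add: add.assoc)
qed simp

lemma polyfuns_mono:
  assumes "f \<in> polyfuns I m" "m \<le> n"
  shows "f \<in> polyfuns I n"
  using assms
proof (induction f rule: polyfuns.induct)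
  case (step f c \<alpha>)
  then have "\<alpha> \<in> expos I n"
    by (fastforce simp: expos_def PiE_iff)
  then show ?case using step by (intro polyfuns.step) auto
qed (rule polyfuns.zero)

lemma polyfuns_monom:
  assumes "c \<in> A" "\<alpha> \<in> expos I m"
  shows "(\<lambda>x. c * (\<Prod>i\<in>I. x i ^ \<alpha> i)) \<in> polyfuns I m"
  using polyfuns.step[OF polyfuns.zero assms] by simp

lemma polyfuns_const:
  assumes "c \<in> A"
  shows "(\<lambda>x. c) \<in> polyfuns I m"
  using polyfuns_monom[OF assms, of "\<lambda>i\<in>I. 0" I m] by (simp add: expos_def)

lemma polyfuns_var:
  assumes "finite I" "i \<in> I" "m \<ge> 1"
  shows "(\<lambda>x. x i) \<in> polyfuns I m"
proof -
  let ?\<alpha> = "\<lambda>j\<in>I. if j = i then 1 else (0::nat)"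
  have "(\<Prod>j\<in>I. x j ^ ?\<alpha> j) = x i" for x :: "'b \<Rightarrow> 'a"
  proof -
    have "(\<Prod>j\<in>I. x j ^ ?\<alpha> j) = (\<Prod>j\<in>I. if j = i then x j else 1)"
      by (intro prod.cong) auto
    then show ?thesis using assms by (simp add: prod.delta)
  qed
  moreover have "?\<alpha> \<in> expos I m" using assms by (auto simp: expos_def)
  ultimately show ?thesis using polyfuns_monom[OF one_A, of ?\<alpha> I m] by simp
qed

lemma polyfuns_monom_mult:
  assumes "f \<in> polyfuns I n" "c \<in> A" "\<alpha> \<in> expos I m"
  shows "(\<lambda>x. c * (\<Prod>i\<in>I. x i ^ \<alpha> i) * f x) \<in> polyfuns I (m + n)"
  using assms(1)
proof (induction f rule: polyfuns.induct)
  case zero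
  then show ?case using polyfuns.zero by simp
next
  case (step f c' \<beta>)
  let ?\<gamma> = "\<lambda>i\<in>I. \<alpha> i + \<beta> i"
  have \<gamma>: "?\<gamma> \<in> expos I (m + n)"
    using assms(3) step(3) by (auto simp: expos_def PiE_iff intro: add_mono)
  have eq: "(\<lambda>x. c * (\<Prod>i\<in>I. x i ^ \<alpha> i) * (c' * (\<Prod>i\<in>I. x i ^ \<beta> i) + f x)) =
     (\<lambda>x. (c * c') * (\<Prod>i\<in>I. x i ^ ?\<gamma> i) + c * (\<Prod>i\<in>I. x i ^ \<alpha> i) * f x)"
  proof
    fix x :: "'b \<Rightarrow> 'a"
    have "(\<Prod>i\<in>I. x i ^ ?\<gamma> i) = (\<Prod>i\<in>I. x i ^ \<alpha> i) * (\<Prod>i\<in>I. x i ^ \<beta> i)"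
      by (subst prod.distrib[symmetric]) (auto intro!: prod.cong simp: power_add)
    then show "c * (\<Prod>i\<in>I. x i ^ \<alpha> i) * (c' * (\<Prod>i\<in>I. x i ^ \<beta> i) + f x) =
      (c * c') * (\<Prod>i\<in>I. x i ^ ?\<gamma> i) + c * (\<Prod>i\<in>I. x i ^ \<alpha> i) * f x"
      by (simp add: algebra_simps)
  qed
  show ?case unfolding eq
    by (rule polyfuns.step[OF step(4) mult_A[OF assms(2) step(2)] \<gamma>])
qed

lemma polyfuns_mult:
  assumes "f \<in> polyfuns I m" "g \<in> polyfuns I n"
  shows "(\<lambda>x. f x * g x) \<in> polyfuns I (m + n)"
  using assms(1)
proof (induction f rule: polyfuns.induct)
  case zero
  then show ?case using polyfuns.zero by simp
next
  case (step f c \<alpha>)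
  have "(\<lambda>x. c * (\<Prod>i\<in>I. x i ^ \<alpha> i) * g x + f x * g x) \<in> polyfuns I (m + n)"
    by (intro polyfuns_add polyfuns_monom_mult assms step)
  then show ?case by (simp add: distrib_right)
qed

lemma polyfuns_uminus:
  assumes "f \<in> polyfuns I m"
  shows "(\<lambda>x. - f x) \<in> polyfuns I m"
  using polyfuns_mult[OF polyfuns_const[OF uminus_A[OF one_A], of I 0] assms] by simp

lemma polyfuns_diff:
  assumes "f \<in> polyfuns I m" "g \<in> polyfuns I m"
  shows "(\<lambda>x. f x - g x) \<in> polyfuns I m"
  using polyfuns_add[OF assms(1) polyfuns_uminus[OF assms(2)]] by simp

lemma polyfuns_sum:
  assumes "\<And>t. t \<in> T \<Longrightarrow> f t \<in> polyfuns I m"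
  shows "(\<lambda>x. \<Sum>t\<in>T. f t x) \<in> polyfuns I m"
  using assms
  by (induction T rule: infinite_finite_induct) (auto intro: polyfuns.zero polyfuns_add)

lemma polyfuns_prod:
  assumes "\<And>t. t \<in> T \<Longrightarrow> f t \<in> polyfuns I m"
  shows "(\<lambda>x. \<Prod>t\<in>T. f t x) \<in> polyfuns I (card T * m)"
  using assms
proof (induction T rule: infinite_finite_induct)
  case (insert t T)
  then have "(\<lambda>x. f t x * (\<Prod>t\<in>T. f t x)) \<in> polyfuns I (m + card T * m)"
    by (intro polyfuns_mult) auto
  then show ?case using insert by simp
qed (auto intro: polyfuns_const one_A)

lemma polyfuns_power:
  assumes "f \<in> polyfuns I m"
  shows "(\<lambda>x. f x ^ n) \<in> polyfuns I (n * m)"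
  using polyfuns_prod[of "{..<n}" "\<lambda>_. f" I m] assms by simp

lemma polyfuns_rep:
  assumes "f \<in> polyfuns I m" "finite I"
  shows "\<exists>cf\<in>PiE (expos I m) (\<lambda>_. A). f = (\<lambda>x. \<Sum>\<alpha>\<in>expos I m. cf \<alpha> * (\<Prod>i\<in>I. x i ^ \<alpha> i))"
  using assms(1)
proof (induction f rule: polyfuns.induct)
  case zero
  show ?case by (rule bexI[of _ "\<lambda>\<alpha>\<in>expos I m. 0"]) (auto simp: zero_A)
next
  case (step f c \<alpha>)
  then obtain cf where cf: "cf \<in> PiE (expos I m) (\<lambda>_. A)"
    "f = (\<lambda>x. \<Sum>\<alpha>\<in>expos I m. cf \<alpha> * (\<Prod>i\<in>I. x i ^ \<alpha> i))" by blast
  let ?cf = "cf(\<alpha> := c + cf \<alpha>)"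
  have "?cf \<in> PiE (expos I m) (\<lambda>_. A)"
    using cf(1) step by (auto simp: PiE_iff extensional_def intro!: add_A)
  moreover have "(\<lambda>x. c * (\<Prod>i\<in>I. x i ^ \<alpha> i) + f x) =
      (\<lambda>x. \<Sum>\<alpha>\<in>expos I m. ?cf \<alpha> * (\<Prod>i\<in>I. x i ^ \<alpha> i))"
  proof
    fix x :: "'b \<Rightarrow> 'a"
    let ?M = "\<lambda>\<alpha>. \<Prod>i\<in>I. x i ^ \<alpha> i"
    have fin: "finite (expos I m)" using assms by simp
    have "(\<Sum>\<beta>\<in>expos I m. ?cf \<beta> * ?M \<beta>) = ?cf \<alpha> * ?M \<alpha> + (\<Sum>\<beta>\<in>expos I m - {\<alpha>}. ?cf \<beta> * ?M \<beta>)"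
      using step(3) fin by (simp add: sum.remove)
    also have "(\<Sum>\<beta>\<in>expos I m - {\<alpha>}. ?cf \<beta> * ?M \<beta>) = (\<Sum>\<beta>\<in>expos I m - {\<alpha>}. cf \<beta> * ?M \<beta>)"
      by (intro sum.cong) auto
    finally show "c * ?M \<alpha> + f x = (\<Sum>\<beta>\<in>expos I m. ?cf \<beta> * ?M \<beta>)"
      using cf(2) step(3) fin by (simp add: sum.remove[of _ \<alpha>] algebra_simps)
  qed
  ultimately show ?case by blast
qed

lemma card_polyfuns:
  assumes "finite I"
  shows "finite (polyfuns I m)" "card (polyfuns I m) \<le> card A ^ ((m + 1) ^ card I)"
proof -
  let ?F = "\<lambda>cf x. \<Sum>\<alpha>\<in>expos I m. cf \<alpha> * (\<Prod>i\<in>I. x i ^ \<alpha> i)"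
  let ?C = "PiE (expos I m) (\<lambda>_. A)"
  have sub: "polyfuns I m \<subseteq> ?F ` ?C"
    using polyfuns_rep[OF _ assms] by blast
  have finC: "finite ?C" using assms finite_A by (simp add: finite_PiE)
  show "finite (polyfuns I m)" using sub finC finite_subset by blast
  have "card (polyfuns I m) \<le> card ?C"
    using surj_card_le[OF finC sub] .
  also have "card ?C = card A ^ ((m + 1) ^ card I)"
    using assms by (simp add: card_PiE card_expos)
  finally show "card (polyfuns I m) \<le> card A ^ ((m + 1) ^ card I)" .
qed

text \<open>Fewer parameters than output functions: pigeonhole on the coefficient vectors.\<close>

lemma alg_dependent_image:
  assumes fin: "finite P" "finite I"
    and \<Phi>: "\<And>i. i \<in> I \<Longrightarrow> \<Phi> i \<in> polyfuns P \<delta>"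
    and \<rho>: "(card I * (\<rho> * \<delta>) + 1) ^ card P < (\<rho> + 1) ^ card I"
    and S: "\<And>x. x \<in> S \<Longrightarrow> \<exists>p. \<forall>i\<in>I. x i = \<Phi> i p"
  shows "alg_dependent I \<rho> S"
proof -
  let ?C = "PiE (expos I \<rho>) (\<lambda>_. A)"
  let ?F = "\<lambda>cf p. \<Sum>\<alpha>\<in>expos I \<rho>. cf \<alpha> * (\<Prod>i\<in>I. \<Phi> i p ^ \<alpha> i)"
  let ?m = "card I * (\<rho> * \<delta>)"
  have in_poly: "?F cf \<in> polyfuns P ?m" if cf: "cf \<in> ?C" for cf
  proof (intro polyfuns_sum)
    fix \<alpha> assume \<alpha>: "\<alpha> \<in> expos I \<rho>"
    have "(\<lambda>p. \<Prod>i\<in>I. \<Phi> i p ^ \<alpha> i) \<in> polyfuns P ?m"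
    proof (intro polyfuns_prod)
      fix i assume i: "i \<in> I"
      have "\<alpha> i * \<delta> \<le> \<rho> * \<delta>" using \<alpha> i by (auto simp: expos_def)
      then show "(\<lambda>x. \<Phi> i x ^ \<alpha> i) \<in> polyfuns P (\<rho> * \<delta>)"
        using polyfuns_mono[OF polyfuns_power[OF \<Phi>[OF i]]] by blast
    qed
    then have "(\<lambda>p. cf \<alpha> * (\<Prod>i\<in>I. \<Phi> i p ^ \<alpha> i)) \<in> polyfuns P (0 + ?m)"
      using cf \<alpha> by (intro polyfuns_mult polyfuns_const) auto
    then show "(\<lambda>p. cf \<alpha> * (\<Prod>i\<in>I. \<Phi> i p ^ \<alpha> i)) \<in> polyfuns P ?m" by simp
  qed
  have "card (?F ` ?C) \<le> card (polyfuns P ?m)"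
    using in_poly card_polyfuns(1)[OF fin(1)] by (intro card_mono) auto
  also have "\<dots> \<le> card A ^ ((?m + 1) ^ card P)"
    by (rule card_polyfuns(2)[OF fin(1)])
  \<comment> \<open>Both counts are powers of \<open>card A\<close>, so only exponents are compared
    and \<open>\<rho>\<close> does not depend on the field.\<close>
  also have "\<dots> < card A ^ ((\<rho> + 1) ^ card I)"
    using \<rho> card_A_ge by (intro power_strict_increasing) auto
  also have "\<dots> = card ?C"
    using fin by (simp add: card_PiE card_expos)
  finally have "\<not> inj_on ?F ?C" by (intro pigeonhole)
  then obtain c1 c2 where c: "c1 \<in> ?C" "c2 \<in> ?C" "c1 \<noteq> c2" "?F c1 = ?F c2"
    by (auto simp: inj_on_def)
  then obtain \<alpha> where \<alpha>: "\<alpha> \<in> expos I \<rho>" "c1 \<alpha> \<noteq> c2 \<alpha>"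
    using PiE_ext by blast
  show ?thesis
    unfolding alg_dependent_def
  proof (intro exI[of _ "\<lambda>\<alpha>. c1 \<alpha> - c2 \<alpha>"] conjI bexI[of _ \<alpha>] ballI)
    fix x assume "x \<in> S"
    then obtain p where p: "\<forall>i\<in>I. x i = \<Phi> i p" using S by blast
    have "(\<Sum>\<alpha>\<in>expos I \<rho>. (c1 \<alpha> - c2 \<alpha>) * (\<Prod>i\<in>I. x i ^ \<alpha> i)) = ?F c1 p - ?F c2 p"
      using p by (simp add: left_diff_distrib sum_subtractf)
    then show "(\<Sum>\<alpha>\<in>expos I \<rho>. (c1 \<alpha> - c2 \<alpha>) * (\<Prod>i\<in>I. x i ^ \<alpha> i)) = 0"
      using c(4) fun_cong[of "?F c1" "?F c2" p] by simp
  qed (use \<alpha> in auto)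
qed

end

section \<open>Eliminating coordinates and counting points\<close>

lemma sum_expos_insert:
  fixes f :: "('i \<Rightarrow> nat) \<Rightarrow> 'a::comm_monoid_add"
  assumes "finite I" "i \<notin> I"
  shows "(\<Sum>\<alpha>\<in>expos (insert i I) \<rho>. f \<alpha>) = (\<Sum>m\<le>\<rho>. \<Sum>\<beta>\<in>expos I \<rho>. f (\<beta>(i := m)))"
proof -
  have "(\<Sum>\<alpha>\<in>expos (insert i I) \<rho>. f \<alpha>) = (\<Sum>(m, \<beta>)\<in>{..\<rho>} \<times> expos I \<rho>. f (\<beta>(i := m)))"
    unfolding expos_def PiE_insert_eq using inj_combinator[OF assms(2), of "\<lambda>_. {..\<rho>}"]
    by (subst sum.reindex) (auto simp: case_prod_unfold)
  also have "\<dots> = (\<Sum>m\<le>\<rho>. \<Sum>\<beta>\<in>expos I \<rho>. f (\<beta>(i := m)))"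
    by (rule sum.cartesian_product[symmetric])
  finally show ?thesis .
qed

lemma all_zero_if_many_roots:
  fixes a :: "nat \<Rightarrow> 'a::field"
  assumes "\<rho> < card V" "\<And>s. s \<in> V \<Longrightarrow> (\<Sum>m\<le>\<rho>. a m * s ^ m) = 0" "m \<le> \<rho>"
  shows "a m = 0"
proof -
  define p where "p = (\<Sum>m\<le>\<rho>. Polynomial.monom (a m) m)"
  have deg: "degree p \<le> \<rho>" unfolding p_def
    by (intro degree_sum_le) (auto intro: order.trans[OF degree_monom_le])
  have "p = 0"
  proof (rule ccontr)
    assume "p \<noteq> 0"
    then have "finite {x. poly p x = 0}" "card {x. poly p x = 0} \<le> degree p"
      using poly_roots_finite card_poly_roots_bound by blast+
    moreover have "V \<subseteq> {x. poly p x = 0}"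
      using assms(2) by (auto simp: p_def poly_sum poly_monom)
    ultimately have "card V \<le> \<rho>" using deg card_mono by (metis le_trans)
    then show False using assms(1) by simp
  qed
  moreover have "Polynomial.coeff p m = a m"
    using assms(3) by (simp add: p_def coeff_sum if_distrib)
  ultimately show ?thesis by simp
qed

text \<open>Viewed as a polynomial in coordinate \<open>i\<close>, a relation has degree at most
  \<open>\<rho>\<close>; if it has more than \<open>\<rho>\<close> roots, all its coefficients
  vanish. One of these coefficients is a relation with one variable fewer and the same degree
  bound.\<close>

lemma all_dependent_heavy:
  fixes S S' :: "('i \<Rightarrow> 'a::field) set"
  assumes dep: "all_dependent (insert i J) (Suc k) \<rho> S" and J: "finite J" "i \<notin> J"
    and heavy: "\<And>x. x \<in> S' \<Longrightarrow> \<exists>V. \<rho> < card V \<and> (\<forall>s\<in>V. x(i := s) \<in> S)"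
  shows "all_dependent J k \<rho> S'"
  unfolding all_dependent_def
proof (intro allI impI)
  fix I assume I: "I \<subseteq> J" "card I = k"
  have finI: "finite I" and iI: "i \<notin> I" using I J finite_subset by auto
  have "insert i I \<subseteq> insert i J" "card (insert i I) = Suc k" using I finI iI by auto
  then have "alg_dependent (insert i I) \<rho> S"
    using dep unfolding all_dependent_def by blast
  then obtain cf \<alpha> where cf: "\<alpha> \<in> expos (insert i I) \<rho>" "cf \<alpha> \<noteq> 0"
    "\<And>x. x \<in> S \<Longrightarrow> (\<Sum>\<alpha>\<in>expos (insert i I) \<rho>. cf \<alpha> * (\<Prod>j\<in>insert i I. x j ^ \<alpha> j)) = 0"
    unfolding alg_dependent_def by blast
  \<comment> \<open>The coefficient of the \<open>m\<close>-th power of coordinate \<open>i\<close>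
    contains the nonzero coefficient at \<open>\<alpha>\<close>, so it is a nontrivial
    relation.\<close>
  define m where "m = \<alpha> i"
  have m: "m \<le> \<rho>" using cf(1) by (auto simp: m_def expos_def)
  let ?\<beta> = "restrict \<alpha> I"
  have \<beta>: "?\<beta> \<in> expos I \<rho>" "?\<beta>(i := m) = \<alpha>"
    using cf(1) iI by (auto simp: expos_def PiE_iff m_def extensional_def fun_eq_iff)
  show "alg_dependent I \<rho> S'"
    unfolding alg_dependent_def
  proof (intro exI[of _ "\<lambda>\<beta>. cf (\<beta>(i := m))"] conjI bexI[of _ ?\<beta>] ballI)
    fix x assume "x \<in> S'"
    then obtain V where V: "\<rho> < card V" "\<forall>s\<in>V. x(i := s) \<in> S" using heavy by blast
    let ?a = "\<lambda>m. \<Sum>\<beta>\<in>expos I \<rho>. cf (\<beta>(i := m)) * (\<Prod>j\<in>I. x j ^ \<beta> j)"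
    have "(\<Sum>m\<le>\<rho>. ?a m * s ^ m) = 0" if s: "s \<in> V" for s
    proof -
      have "0 = (\<Sum>\<alpha>\<in>expos (insert i I) \<rho>. cf \<alpha> * (\<Prod>j\<in>insert i I. (x(i := s)) j ^ \<alpha> j))"
        using cf(3)[of "x(i := s)"] V s by metis
      also have "\<dots> = (\<Sum>m\<le>\<rho>. \<Sum>\<beta>\<in>expos I \<rho>. cf (\<beta>(i := m)) *
          (\<Prod>j\<in>insert i I. (x(i := s)) j ^ (\<beta>(i := m)) j))"
        by (rule sum_expos_insert[OF finI iI])
      also have "\<dots> = (\<Sum>m\<le>\<rho>. ?a m * s ^ m)"
      proof (intro sum.cong refl)
        fix m
        have "(\<Prod>j\<in>insert i I. (x(i := s)) j ^ (\<beta>(i := m)) j) = s ^ m * (\<Prod>j\<in>I. x j ^ \<beta> j)" for \<beta>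
        proof -
          have "(\<Prod>j\<in>I. (x(i := s)) j ^ (\<beta>(i := m)) j) = (\<Prod>j\<in>I. x j ^ \<beta> j)"
            using iI by (intro prod.cong) auto
          then show ?thesis using finI iI by simp
        qed
        then show "(\<Sum>\<beta>\<in>expos I \<rho>. cf (\<beta>(i := m)) *
            (\<Prod>j\<in>insert i I. (x(i := s)) j ^ (\<beta>(i := m)) j)) = ?a m * s ^ m"
          by (simp add: sum_distrib_right sum_distrib_left mult_ac)
      qed
      finally show ?thesis by simp
    qed
    then show "?a m = 0" using all_zero_if_many_roots[OF V(1) _ m, of ?a] by blast
  qed (use \<beta> cf in auto)
qed

lemma alg_dependent_cong:
  assumes "\<And>x. x \<in> S' \<Longrightarrow> \<exists>y\<in>S. \<forall>i\<in>I. x i = y i" "alg_dependent I \<rho> S"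
  shows "alg_dependent I \<rho> S'"
proof -
  obtain cf where cf: "\<exists>\<alpha>\<in>expos I \<rho>. cf \<alpha> \<noteq> 0"
    "\<And>x. x\<in>S \<Longrightarrow> (\<Sum>\<alpha>\<in>expos I \<rho>. cf \<alpha> * (\<Prod>i\<in>I. x i ^ \<alpha> i)) = 0"
    using assms(2) unfolding alg_dependent_def by blast
  have "(\<Sum>\<alpha>\<in>expos I \<rho>. cf \<alpha> * (\<Prod>i\<in>I. x i ^ \<alpha> i)) = 0" if "x \<in> S'" for x
  proof -
    obtain y where y: "y \<in> S" "\<forall>i\<in>I. x i = y i" using assms(1) \<open>x \<in> S'\<close> by blast
    then show ?thesis using cf(2)[OF y(1)] by simp
  qed
  then show ?thesis using cf(1) unfolding alg_dependent_def by blast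
qed

lemma card_le_card_fibres:
  assumes "finite B" "f ` S \<subseteq> B" "\<And>y. y \<in> B \<Longrightarrow> finite {x\<in>S. f x = y} \<and> card {x\<in>S. f x = y} \<le> m"
  shows "finite S" "card S \<le> card B * m"
proof -
  have S: "S = (\<Union>y\<in>B. {x\<in>S. f x = y})" using assms(2) by auto
  show "finite S" using assms by (subst S) auto
  have "card S \<le> (\<Sum>y\<in>B. card {x\<in>S. f x = y})"
    by (subst S) (rule card_UN_le[OF assms(1)])
  also have "\<dots> \<le> card B * m" using assms(3) by (intro sum_bounded_above[THEN order_trans]) auto
  finally show "card S \<le> card B * m" .
qed

text \<open>Counting points: split each coordinate into light fibres (at most \<open>\<rho>\<close> values) and heavy
  ones, over which one coordinate of the dependency is eliminated.\<close>

lemma card_all_dependent: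
  fixes S :: "('i \<Rightarrow> 'a::field) set"
  assumes "finite J" "finite A" "A \<noteq> {}" "S \<subseteq> PiE J (\<lambda>_. A)" "all_dependent J k \<rho> S"
  shows "card S * card A \<le> (\<rho> + 2) ^ card J * card A ^ k"
  using assms(1,4,5)
proof (induction J arbitrary: S k rule: finite_induct)
  case empty
  have cA: "card A \<ge> 1" using assms by (simp add: Suc_leI card_gt_0_iff)
  show ?case
  proof (cases k)
    case 0
    \<comment> \<open>In no variables a relation is a nonzero constant, which vanishes at no
      point.\<close>
    have "alg_dependent {} \<rho> S" using empty(2) 0 by (simp add: all_dependent_def)
    then have "S = {}" unfolding alg_dependent_def by (auto simp: expos_def)
    then show ?thesis by simp
  next
    case (Suc k')
    have "card S \<le> card {\<lambda>_::'i. undefined::'a}" using empty(1) by (intro card_mono) auto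
    then have "card S \<le> 1" by simp
    then have "card S * card A \<le> 1 * card A" by (rule mult_le_mono1)
    also have "\<dots> \<le> card A * card A ^ k'" using cA by simp
    finally have "card S * card A \<le> card A * card A ^ k'" .
    then show ?thesis using Suc by simp
  qed
next
  case (insert i J)
  have cA: "card A \<ge> 1" using assms by (simp add: Suc_leI card_gt_0_iff)
  have finS: "finite S"
    using insert.prems(1) insert.hyps assms(2) by (meson finite.insertI finite_PiE finite_subset)
  define V where "V = (\<lambda>x. {s. x(i := s) \<in> S})"
  define B where "B = (\<lambda>x. restrict x J) ` S"
  have B: "B \<subseteq> PiE J (\<lambda>_. A)" using insert.prems(1) by (auto simp: B_def PiE_iff)
  have finB: "finite B" using finS by (simp add: B_def)
  define H where "H = {x \<in> B. \<rho> < card (V x)}"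
  have VA: "V x \<subseteq> A" for x using insert.prems(1) by (auto simp: V_def PiE_iff)
  have finV: "finite (V x)" for x using VA assms(2) finite_subset by blast
  have fib: "x = (restrict x J)(i := x i)" if "x \<in> S" for x
    using that insert.prems(1) insert.hyps by (auto simp: PiE_iff extensional_def fun_eq_iff)
  have inj: "finite {x\<in>S. restrict x J = y} \<and> card {x\<in>S. restrict x J = y} \<le> card (V y)" for y
  proof
    show "finite {x\<in>S. restrict x J = y}" using finS by auto
    show "card {x\<in>S. restrict x J = y} \<le> card (V y)"
    proof (rule card_inj_on_le[OF _ _ finV])
      show "inj_on (\<lambda>x. x i) {x\<in>S. restrict x J = y}"
        using fib by (intro inj_onI) (metis (mono_tags, lifting) mem_Collect_eq)
      show "(\<lambda>x. x i) ` {x\<in>S. restrict x J = y} \<subseteq> V y"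
        using fib by (auto simp: V_def)
    qed
  qed
  have "alg_dependent I \<rho> B" if "I \<subseteq> J" "card I = k" for I
  proof (rule alg_dependent_cong[of _ S])
    show "\<exists>y\<in>S. \<forall>i\<in>I. x i = y i" if xB: "x \<in> B" for x
    proof -
      obtain y where "y \<in> S" "x = restrict y J" using xB by (auto simp: B_def)
      then show ?thesis using \<open>I \<subseteq> J\<close> by (intro bexI[of _ y]) auto
    qed
    show "alg_dependent I \<rho> S" using insert.prems(2) that by (auto simp: all_dependent_def)
  qed
  then have IH1: "card B * card A \<le> (\<rho> + 2) ^ card J * card A ^ k"
    using insert.IH[OF B] by (auto simp: all_dependent_def)
  have sub: "finite {x\<in>S'. restrict x J = y} \<and> card {x\<in>S'. restrict x J = y} \<le> card (V y)"
    if "S' \<subseteq> S" for S' y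
  proof -
    have sub': "{x\<in>S'. restrict x J = y} \<subseteq> {x\<in>S. restrict x J = y}" using that by blast
    have "finite {x\<in>S. restrict x J = y}" using inj by blast
    then show ?thesis using card_mono[OF _ sub'] finite_subset[OF sub'] inj[of y] le_trans by blast
  qed
  have light: "card {x\<in>S. restrict x J \<in> B - H} \<le> card (B - H) * \<rho>"
  proof (rule card_le_card_fibres(2)[where f = "\<lambda>x. restrict x J"])
    fix y assume y: "y \<in> B - H"
    then have "card (V y) \<le> \<rho>" by (simp add: H_def not_less)
    then show "finite {x \<in> {x \<in> S. restrict x J \<in> B - H}. restrict x J = y} \<and>
       card {x \<in> {x \<in> S. restrict x J \<in> B - H}. restrict x J = y} \<le> \<rho>"
      using sub[of "{x \<in> S. restrict x J \<in> B - H}" y] le_trans by blast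
  qed (use finB in auto)
  have heavy: "card {x\<in>S. restrict x J \<in> H} \<le> card H * card A"
  proof (rule card_le_card_fibres(2)[where f = "\<lambda>x. restrict x J"])
    fix y assume y: "y \<in> H"
    have "card (V y) \<le> card A" using VA assms(2) by (simp add: card_mono)
    then show "finite {x \<in> {x \<in> S. restrict x J \<in> H}. restrict x J = y} \<and>
       card {x \<in> {x \<in> S. restrict x J \<in> H}. restrict x J = y} \<le> card A"
      using sub[of "{x \<in> S. restrict x J \<in> H}" y] le_trans by blast
  qed (use finB in \<open>auto simp: H_def\<close>)
  \<comment> \<open>The extra factor \<open>card A\<close> is paid for by the eliminated coordinate,
    which lowers \<open>k\<close> by one.\<close>
  have H_bound: "card H * card A * card A \<le> (\<rho> + 2) ^ card J * card A ^ k"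
  proof (cases k)
    case 0
    have "alg_dependent {} \<rho> S" using insert.prems(2) 0 by (simp add: all_dependent_def)
    then have "S = {}" unfolding alg_dependent_def by (auto simp: expos_def)
    then show ?thesis by (simp add: H_def B_def)
  next
    case (Suc k')
    have "all_dependent J k' \<rho> H"
      using insert.prems(2) insert.hyps unfolding Suc
      by (rule all_dependent_heavy) (auto simp: H_def V_def)
    then have "card H * card A \<le> (\<rho> + 2) ^ card J * card A ^ k'"
      using insert.IH[of H k'] B by (auto simp: H_def)
    then show ?thesis using Suc by (simp add: mult.assoc mult.commute)
  qed
  have "S = {x\<in>S. restrict x J \<in> B - H} \<union> {x\<in>S. restrict x J \<in> H}"
    by (auto simp: B_def)
  then have "card S \<le> card {x\<in>S. restrict x J \<in> B - H} + card {x\<in>S. restrict x J \<in> H}"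
    by (metis (no_types, lifting) card_Un_le)
  also have "\<dots> \<le> card B * \<rho> + card H * card A"
    using light heavy finB by (meson add_mono card_mono Diff_subset mult_le_mono1 order_trans)
  finally have "card S * card A \<le> (card B * \<rho> + card H * card A) * card A"
    by (rule mult_le_mono1)
  also have "\<dots> = \<rho> * (card B * card A) + card H * card A * card A"
    by (simp add: algebra_simps)
  also have "\<dots> \<le> \<rho> * ((\<rho> + 2) ^ card J * card A ^ k) + (\<rho> + 2) ^ card J * card A ^ k"
    by (rule add_mono[OF mult_le_mono2[OF IH1] H_bound])
  also have "\<dots> \<le> (\<rho> + 2) ^ card (insert i J) * card A ^ k"
    using insert.hyps by (simp add: algebra_simps)
  finally show ?case .
qed

section \<open>Finite fields of characteristic two\<close>

lemma two_eq_0_alg_closure_bit: "(2 :: bit alg_closure) = 0"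
proof -
  have "(2 :: bit alg_closure) = to_ac 2" by (simp only: to_ac_numeral)
  then show ?thesis by simp
qed

lemma uminus_alg_closure_bit: "- x = (x :: bit alg_closure)"
proof -
  have "x + x = 2 * x" by (rule mult_2[symmetric])
  then have "x + x = 0" by (simp only: two_eq_0_alg_closure_bit) simp
  then show ?thesis by (simp add: eq_neg_iff_add_eq_0 minus_unique)
qed

lemma frobenius_add: "(x + y :: bit alg_closure) ^ (2 ^ m) = x ^ (2 ^ m) + y ^ (2 ^ m)"
proof (induction m)
  case (Suc m)
  have sq: "(u + v)^2 = u^2 + v^2" for u v :: "bit alg_closure"
    by (simp only: power2_sum two_eq_0_alg_closure_bit) simp
  have "(x + y) ^ (2 ^ Suc m) = ((x + y) ^ (2 ^ m))^2"
    by (simp only: power_Suc power_mult[symmetric] mult.commute)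
  also have "\<dots> = (x ^ (2 ^ m))^2 + (y ^ (2 ^ m))^2"
    by (simp only: Suc sq)
  finally show ?case by (simp only: power_Suc power_mult[symmetric] mult.commute)
qed simp

text \<open>The field with \<open>2 ^ m\<close> elements (for \<open>m \<ge> 1\<close>), as the
  fixed points of an iterated Frobenius map. Powers of two are dense enough: consecutive orders
  differ by the factor 2, which costs only a constant in the lower bound.\<close>

definition pow2_field :: "nat \<Rightarrow> bit alg_closure set" where
  "pow2_field m = {x. x ^ (2 ^ m) = x}"

text \<open>The polynomial X^q - X splits over the algebraic closure, and its derivative is -1, so
  no root is repeated.\<close>

lemma card_pow2_field:
  assumes "m \<ge> 1"
  shows "card (pow2_field m) = 2 ^ m"
proof -
  define q :: nat where "q = 2 ^ m"
  have q: "q \<ge> 2" using assms unfolding q_def by (metis one_le_numeral power_increasing power_one_right)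
  define p :: "bit alg_closure poly" where "p = Polynomial.monom 1 q - Polynomial.monom 1 1"
  have deg: "degree p = q" using q
    unfolding p_def diff_conv_add_uminus by (subst degree_add_eq_left) (auto simp: degree_monom_eq)
  have poly_p: "poly p x = x ^ q - x" for x by (simp add: p_def poly_monom)
  have p0: "p \<noteq> 0" using deg q by auto
  have pd: "poly (pderiv p) x = - 1" for x
  proof -
    have "(of_nat q :: bit alg_closure) = 0"
      unfolding q_def using assms by (simp add: two_eq_0_alg_closure_bit power_0_left)
    then show ?thesis by (simp add: p_def pderiv_diff pderiv_monom poly_monom)
  qed
  obtain M where M: "size M = degree p" "p = smult (lead_coeff p) (\<Prod>x\<in>#M. [:-x, 1:])"
    using alg_closed_imp_factorization[OF p0] by blast
  have cnt: "count M x \<le> 1" for x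
  proof (rule ccontr)
    assume "\<not> ?thesis"
    then have "{#x, x#} \<subseteq># M" by (auto simp: subseteq_mset_def)
    then obtain M' where "M = {#x, x#} + M'" by (auto simp: subset_mset.le_iff_add)
    then have "p = [:-x, 1:] * ([:-x, 1:] * smult (lead_coeff p) (\<Prod>x\<in>#M'. [:-x, 1:]))"
      using M(2) by (simp add: mult_ac)
    then obtain r where "p = [:-x, 1:] * ([:-x, 1:] * r)" by blast
    then have "poly (pderiv p) x = 0"
      by (simp only: pderiv_mult) simp
    then show False using pd[of x] by simp
  qed
  have "set_mset M = pow2_field m"
  proof -
    have "poly p x = lead_coeff p * (\<Prod>y\<in>#M. x - y)" for x
      by (subst M(2)) (simp add: poly_prod_mset o_def)
    then have "poly p x = 0 \<longleftrightarrow> x \<in># M" for x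
      using p0 by (auto simp: prod_mset_zero_iff)
    then show ?thesis by (auto simp: poly_p pow2_field_def q_def)
  qed
  moreover have "size M = card (set_mset M)"
  proof -
    have "count M x = 1" if "x \<in># M" for x
      using cnt[of x] that by (metis One_nat_def Suc_leI antisym count_greater_zero_iff)
    then show ?thesis by (simp add: size_multiset_overloaded_eq)
  qed
  ultimately show ?thesis using M(1) deg by (simp add: q_def)
qed

lemma finite_subfield_pow2_field:
  assumes "m \<ge> 1"
  shows "finite_subfield (pow2_field m)"
proof
  have "card (pow2_field m) \<noteq> 0" using card_pow2_field[OF assms] by simp
  then show "finite (pow2_field m)" by (intro card_ge_0_finite) linarith
  fix x y assume xy: "x \<in> pow2_field m" "y \<in> pow2_field m"
  then show "x + y \<in> pow2_field m" "x * y \<in> pow2_field m"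
    by (simp_all add: pow2_field_def frobenius_add power_mult_distrib)
next
  fix x assume x: "x \<in> pow2_field m"
  then show "- x \<in> pow2_field m" by (simp only: uminus_alg_closure_bit)
  show "inverse x \<in> pow2_field m"
    using x power_inverse[of x "2 ^ m"] unfolding pow2_field_def by simp
next
  show "0 \<in> pow2_field m" unfolding pow2_field_def by simp
  show "1 \<in> pow2_field m" unfolding pow2_field_def by simp
qed

section \<open>Sunflowers of maps\<close>

text \<open>The factor in the step counts pairs of one of \<open>Suc n\<close> arguments and one of
  at most \<open>m * Suc n\<close> values taken by a maximal disjoint family.\<close>

primrec sunflower_bound :: "nat \<Rightarrow> nat \<Rightarrow> nat" where
  "sunflower_bound m 0 = 1"
| "sunflower_bound m (Suc n) = Suc n * (m * Suc n) * sunflower_bound m n"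

definition disjoint_outside :: "'u set \<Rightarrow> ('u \<Rightarrow> 'v) set \<Rightarrow> bool" where
  "disjoint_outside U Y \<longleftrightarrow> (\<forall>y\<in>Y. \<forall>y'\<in>Y. y \<noteq> y' \<longrightarrow> (\<forall>u\<in>U. \<forall>u'\<in>U. y u \<noteq> y' u'))"

lemma disjoint_outside_subset: "disjoint_outside U Y \<Longrightarrow> Y' \<subseteq> Y \<Longrightarrow> disjoint_outside U Y'"
  unfolding disjoint_outside_def by (meson subsetD)

text \<open>The sunflower lemma for maps. The kernel is a set \<open>Z\<close> of arguments rather
  than of values, and \<open>Z \<noteq> U\<close> makes the petals nonempty. A petal may still hit a
  value of the kernel; the application excludes this by injectivity.\<close>

lemma sunflower_maps:
  assumes "finite U" "finite W" "W \<subseteq> extensional U" "card W > sunflower_bound m (card U)"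
  shows "\<exists>Z \<zeta> Y. Z \<subseteq> U \<and> Z \<noteq> U \<and> Y \<subseteq> W \<and> card Y = m \<and> (\<forall>y\<in>Y. \<forall>u\<in>Z. y u = \<zeta> u) \<and>
    disjoint_outside (U - Z) Y"
  using assms
proof (induction "card U" arbitrary: U W)
  case 0
  then have W: "W \<subseteq> {\<lambda>_. undefined}" by (auto simp: extensional_def)
  have "card W \<le> 1" using card_mono[OF _ W] by simp
  then show ?case using 0 by simp
next
  case (Suc n)
  show ?case
  proof (cases "\<exists>Y\<subseteq>W. disjoint_outside U Y \<and> card Y = m")
    case True
    then obtain Y where "Y \<subseteq> W" "disjoint_outside U Y" "card Y = m" by blast
    moreover have "{} \<noteq> U" using Suc.hyps(2) by auto
    ultimately show ?thesis by (intro exI[of _ "{}"] exI[of _ undefined] exI[of _ Y]) auto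
  next
    case False
    let ?\<D> = "{Y. Y \<subseteq> W \<and> disjoint_outside U Y}"
    have fin\<D>: "finite ?\<D>" using Suc.prems by simp
    have "{} \<in> ?\<D>" by (simp add: disjoint_outside_def)
    then have "?\<D> \<noteq> {}" by (metis empty_iff)
    from finite_has_maximal[OF fin\<D> this]
    obtain Y where Y: "Y \<in> ?\<D>" "\<forall>Y'\<in>?\<D>. Y \<subseteq> Y' \<longrightarrow> Y = Y'" by (elim bexE)
    have finY: "finite Y" using Y Suc.prems finite_subset by auto
    have cardY: "card Y \<le> m"
    proof (rule ccontr)
      assume "\<not> ?thesis"
      then obtain Y' where Y': "Y' \<subseteq> Y" "card Y' = m" by (metis nat_le_linear obtain_subset_with_card_n)
      have "Y \<subseteq> W" "disjoint_outside U Y" using Y(1) by simp_all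
      then have "Y' \<subseteq> W \<and> disjoint_outside U Y' \<and> card Y' = m"
        using Y' disjoint_outside_subset[of U Y Y'] by simp
      then show False using False by (elim notE) (rule exI)
    qed
    define V where "V = (\<Union>y\<in>Y. y ` U)"
    have finV: "finite V" using finY Suc.prems by (simp add: V_def)
    have "card V \<le> (\<Sum>y\<in>Y. card (y ` U))" unfolding V_def by (rule card_UN_le[OF finY])
    also have "\<dots> \<le> (\<Sum>y\<in>Y. Suc n)" using Suc.prems Suc.hyps(2)
      by (intro sum_mono) (simp add: card_image_le)
    also have "\<dots> \<le> m * Suc n" using cardY by (simp del: mult_Suc_right)
    finally have cardV: "card V \<le> m * Suc n" .
    \<comment> \<open>Otherwise \<open>x\<close> could be added to the maximal family
      \<open>Y\<close>.\<close>
    have ex: "\<exists>u\<in>U. x u \<in> V" if x: "x \<in> W" for x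
    proof (cases "x \<in> Y")
      case True
      moreover have "U \<noteq> {}" using Suc.hyps(2) by auto
      ultimately show ?thesis by (auto simp: V_def)
    next
      case nY: False
      have "\<not> disjoint_outside U (insert x Y)"
      proof
        assume "disjoint_outside U (insert x Y)"
        then have "insert x Y \<in> ?\<D>" using Y(1) x by simp
        then have "Y = insert x Y" using Y(2) by (simp only: subset_insertI)
        then show False using nY by (metis insertI1)
      qed
      then obtain y y' u u' where "y \<in> insert x Y" "y' \<in> insert x Y" "y \<noteq> y'" "u \<in> U" "u' \<in> U" "y u = y' u'"
        unfolding disjoint_outside_def by metis
      moreover have "disjoint_outside U Y" using Y(1) by simp
      then have "\<not> (y \<in> Y \<and> y' \<in> Y)"
        using calculation unfolding disjoint_outside_def by metis
      ultimately have "y = x \<and> y' \<in> Y \<or> y' = x \<and> y \<in> Y" by (metis insertE)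
      then show ?thesis
      proof
        assume "y = x \<and> y' \<in> Y"
        then show ?thesis using \<open>u \<in> U\<close> \<open>u' \<in> U\<close> \<open>y u = y' u'\<close>
          by (intro bexI[of _ u]) (auto simp: V_def)
      next
        assume "y' = x \<and> y \<in> Y"
        then show ?thesis using \<open>u \<in> U\<close> \<open>u' \<in> U\<close> \<open>y u = y' u'\<close>[symmetric]
          by (intro bexI[of _ u']) (auto simp: V_def)
      qed
    qed
    have "\<exists>p\<in>U \<times> V. sunflower_bound m n < card {x\<in>W. x (fst p) = snd p}"
    proof (rule ccontr)
      assume neg: "\<not> ?thesis"
      have "W \<subseteq> (\<Union>p\<in>U \<times> V. {x\<in>W. x (fst p) = snd p})"
      proof
        fix x assume x: "x \<in> W"
        then obtain u where "u \<in> U" "x u \<in> V" using ex by blast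
        then show "x \<in> (\<Union>p\<in>U \<times> V. {x\<in>W. x (fst p) = snd p})"
          using x by (intro UN_I[of "(u, x u)"]) simp_all
      qed
      then have "card W \<le> card (\<Union>p\<in>U \<times> V. {x\<in>W. x (fst p) = snd p})"
        by (intro card_mono) (simp_all add: finV Suc.prems(1,2))
      also have "\<dots> \<le> (\<Sum>p\<in>U \<times> V. card {x\<in>W. x (fst p) = snd p})"
        by (intro card_UN_le) (simp add: finV Suc.prems(1))
      also have "\<dots> \<le> (\<Sum>p\<in>U \<times> V. sunflower_bound m n)"
        using neg by (intro sum_mono) (auto simp: not_less)
      also have "\<dots> = card U * card V * sunflower_bound m n"
        by (simp add: card_cartesian_product)
      also have "\<dots> \<le> Suc n * (m * Suc n) * sunflower_bound m n"
        using cardV Suc.hyps(2) by (intro mult_le_mono) auto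
      finally show False using Suc.prems(4) Suc.hyps(2)[symmetric] by simp
    qed
    then obtain u v where uv: "u \<in> U" "sunflower_bound m n < card {x\<in>W. x u = v}" by auto
    define W' where "W' = {x\<in>W. x u = v}"
    define r where "r = (\<lambda>x::'a\<Rightarrow>'b. restrict x (U - {u}))"
    have inj: "inj_on r W'"
    proof (rule inj_onI)
      fix x x' assume x: "x \<in> W'" "x' \<in> W'" "r x = r x'"
      show "x = x'"
      proof
        fix w
        have e: "restrict x (U - {u}) w = restrict x' (U - {u}) w"
          using x(3) unfolding r_def by (rule fun_cong)
        have exts: "x \<in> extensional U" "x' \<in> extensional U" and xu: "x u = x' u"
          using x(1,2) Suc.prems(3) unfolding W'_def by auto
        show "x w = x' w"
        proof (cases "w \<in> U")
          case True
          then show ?thesis using e xu by (cases "w = u") simp_all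
        next
          case False
          then show ?thesis using extensional_arb[OF exts(1) False] extensional_arb[OF exts(2) False] by simp
        qed
      qed
    qed
    have n: "n = card (U - {u})" using Suc.hyps(2) uv(1) by simp
    have "card (r ` W') > sunflower_bound m (card (U - {u}))"
      using uv n card_image[OF inj] by (simp add: W'_def)
    moreover have "finite U" "finite (r ` W')" using Suc.prems(1,2) by (simp_all add: W'_def)
    moreover have "r ` W' \<subseteq> extensional (U - {u})" unfolding r_def by auto
    ultimately obtain Z \<zeta> Y' where Z: "Z \<subseteq> U - {u}" "Z \<noteq> U - {u}" "Y' \<subseteq> r ` W'" "card Y' = m"
      "\<forall>y\<in>Y'. \<forall>u\<in>Z. y u = \<zeta> u" "disjoint_outside (U - {u} - Z) Y'"
      using Suc.hyps(1)[OF n, of "r ` W'"] by (metis finite_Diff)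
    obtain Y where Y: "Y \<subseteq> W'" "Y' = r ` Y" using Z(3) by (rule subset_imageE)
    have "insert u Z \<subseteq> U \<and> insert u Z \<noteq> U" using Z(1,2) uv(1) by blast
    moreover have "Y \<subseteq> W" using Y(1) unfolding W'_def by blast
    moreover have "card Y = m" using Z(4) Y(2) card_image[OF inj_on_subset[OF inj Y(1)]] by simp
    moreover have "\<forall>y\<in>Y. \<forall>w\<in>insert u Z. y w = (\<zeta>(u := v)) w"
    proof (intro ballI)
      fix y w assume y: "y \<in> Y" "w \<in> insert u Z"
      show "y w = (\<zeta>(u := v)) w"
      proof (cases "w = u")
        case True
        then show ?thesis using y(1) Y(1) unfolding W'_def by auto
      next
        case False
        then have w: "w \<in> Z" "w \<in> U - {u}" using y(2) Z(1) by auto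
        have "r y \<in> Y'" using y(1) Y(2) by simp
        then have "r y w = \<zeta> w" using Z(5) w(1) by simp
        then show ?thesis using False w(2) unfolding r_def by simp
      qed
    qed
    moreover have "disjoint_outside (U - insert u Z) Y"
      unfolding disjoint_outside_def
    proof (intro ballI impI)
      fix y y' w w' assume y: "y \<in> Y" "y' \<in> Y" "y \<noteq> y'" "w \<in> U - insert u Z" "w' \<in> U - insert u Z"
      then have ne: "r y \<noteq> r y'" using inj_onD[OF inj, of y y'] Y(1) by auto
      have "r y \<in> Y'" "r y' \<in> Y'" using y Y(2) by simp_all
      moreover have "w \<in> U - {u} - Z" "w' \<in> U - {u} - Z" using y(4,5) by auto
      ultimately have "r y w \<noteq> r y' w'" using Z(6) ne unfolding disjoint_outside_def by simp
      then show "y w \<noteq> y' w'" using y(4,5) unfolding r_def by simp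
    qed
    ultimately show ?thesis
      by - (intro exI[of _ "insert u Z"] exI[of _ "\<zeta>(u := v)"] exI[of _ Y] conjI; (elim conjE)?; assumption)
  qed
qed

section \<open>Explicit interpolation\<close>

text \<open>Lagrange interpolation for the first \<open>card E\<close> coefficients, the higher ones
  being known. The explicit formula is wanted because it exhibits each coefficient as a polynomial
  in the data, up to inverses of products of differences of nodes.\<close>

lemma vandermonde_solve:
  fixes c :: "nat \<Rightarrow> 'a::field"
  assumes fin: "finite E" and inj: "inj_on \<kappa> E" and le: "card E \<le> \<Lambda>"
    and eqs: "\<And>e. e \<in> E \<Longrightarrow> (\<Sum>l<\<Lambda>. c l * \<kappa> e ^ l) = y e" and l: "l < card E"
  shows "c l = (\<Sum>e\<in>E. (y e - (\<Sum>l'\<in>{card E..<\<Lambda>}. c l' * \<kappa> e ^ l')) *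
     Polynomial.coeff (\<Prod>e'\<in>E - {e}. [:- \<kappa> e', 1:]) l * inverse (\<Prod>e'\<in>E - {e}. \<kappa> e - \<kappa> e'))"
proof -
  define z where "z e = y e - (\<Sum>l'\<in>{card E..<\<Lambda>}. c l' * \<kappa> e ^ l')" for e
  define L where "L e = (\<Prod>e'\<in>E - {e}. [:- \<kappa> e', 1:])" for e
  define d where "d e = inverse (\<Prod>e'\<in>E - {e}. \<kappa> e - \<kappa> e')" for e
  define p where "p = (\<Sum>l<card E. Polynomial.monom (c l) l)"
  define r where "r = (\<Sum>e\<in>E. Polynomial.smult (z e * d e) (L e))"
  have "E \<noteq> {}" using l by auto
  then have pos: "card E > 0" using fin by (simp add: card_gt_0_iff)
  have dp: "degree p \<le> card E - 1" unfolding p_def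
    by (intro degree_sum_le) (auto intro: order.trans[OF degree_monom_le])
  have dL: "degree (L e) \<le> card E - 1" if "e \<in> E" for e
  proof -
    have "degree (L e) \<le> sum (degree \<circ> (\<lambda>e'. [:- \<kappa> e', 1:])) (E - {e})"
      unfolding L_def using fin by (intro degree_prod_sum_le) auto
    also have "\<dots> = card (E - {e})" by simp
    finally show ?thesis using that fin by simp
  qed
  have dr: "degree r \<le> card E - 1" unfolding r_def
    using dL fin by (intro degree_sum_le) (auto intro: order.trans[OF degree_smult_le])
  have poly_p: "poly p (\<kappa> e) = z e" if "e \<in> E" for e
  proof -
    have "{..<\<Lambda>} = {..<card E} \<union> {card E..<\<Lambda>}" using le by auto
    then have "(\<Sum>l<\<Lambda>. c l * \<kappa> e ^ l) = (\<Sum>l<card E. c l * \<kappa> e ^ l) + (\<Sum>l'\<in>{card E..<\<Lambda>}. c l' * \<kappa> e ^ l')"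
      by (metis (no_types, lifting) finite_atLeastLessThan finite_lessThan ivl_disj_int_one(2) sum.union_disjoint)
    then show ?thesis using eqs[OF that] by (simp add: p_def z_def poly_sum poly_monom algebra_simps)
  qed
  have poly_L: "poly (L e) (\<kappa> f) = (if e = f then inverse (d e) else 0)" if "e \<in> E" "f \<in> E" for e f
  proof (cases "e = f")
    case True
    then show ?thesis by (simp add: L_def d_def poly_prod)
  next
    case False
    then have "\<exists>e'\<in>E - {e}. \<kappa> f - \<kappa> e' = 0" using that by (intro bexI[of _ f]) auto
    then show ?thesis using False fin by (simp add: L_def poly_prod prod_zero)
  qed
  have d0: "d e \<noteq> 0" if "e \<in> E" for e
    using fin inj that by (auto simp: d_def inj_on_def)
  have poly_r: "poly r (\<kappa> f) = z f" if "f \<in> E" for f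
  proof -
    have "poly r (\<kappa> f) = (\<Sum>e\<in>E. if e = f then z e else 0)"
      unfolding r_def poly_sum using that d0 by (intro sum.cong) (auto simp: poly_L)
    then show ?thesis using fin that by simp
  qed
  have "p = r"
  proof (rule ccontr)
    assume "p \<noteq> r"
    then have nz: "p - r \<noteq> 0" by simp
    have "\<kappa> ` E \<subseteq> {x. poly (p - r) x = 0}" using poly_p poly_r by auto
    then have "card (\<kappa> ` E) \<le> card {x. poly (p - r) x = 0}"
      using nz by (intro card_mono poly_roots_finite)
    also have "\<dots> \<le> degree (p - r)" using nz by (rule card_poly_roots_bound)
    also have "\<dots> \<le> card E - 1" using dp dr by (rule degree_diff_le)
    finally show False using card_image[OF inj] pos by simp
  qed
  moreover have "Polynomial.coeff p l = c l"
    using l by (simp add: p_def coeff_sum if_distrib)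
  ultimately have "c l = Polynomial.coeff r l" by simp
  also have "\<dots> = (\<Sum>e\<in>E. z e * Polynomial.coeff (L e) l * d e)"
    by (simp add: r_def coeff_sum mult_ac)
  finally show ?thesis by (simp add: z_def L_def d_def)
qed

context finite_subfield
begin

text \<open>Up to sign these are the elementary symmetric functions of the nodes; multiplying in one
  linear factor at a time bounds their degree.\<close>

lemma polyfuns_coeff_prod:
  assumes "finite E" "\<And>e. e \<in> E \<Longrightarrow> \<kappa> e \<in> polyfuns I \<delta>"
  shows "(\<lambda>x. Polynomial.coeff (\<Prod>e\<in>E. [:- \<kappa> e x, 1:]) l) \<in> polyfuns I (card E * \<delta>)"
  using assms
proof (induction E arbitrary: l rule: finite_induct)
  case empty
  have "Polynomial.coeff (1 :: 'a poly) l \<in> A" using zero_A one_A by (simp add: coeff_1)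
  from polyfuns_const[OF this, of I 0] show ?case by simp
next
  case (insert e E)
  let ?q = "\<lambda>x. \<Prod>e\<in>E. [:- \<kappa> e x, 1:]"
  have eq: "Polynomial.coeff (\<Prod>e\<in>insert e E. [:- \<kappa> e x, 1:]) l =
      (- \<kappa> e x) * Polynomial.coeff (?q x) l + (if l = 0 then 0 else Polynomial.coeff (?q x) (l - 1))" for x
    using insert.hyps by (cases l) (simp_all add: coeff_pCons)
  have 1: "(\<lambda>x. Polynomial.coeff (?q x) l) \<in> polyfuns I (card E * \<delta>)" for l
    using insert.IH insert.prems by simp
  have "(\<lambda>x. (- \<kappa> e x) * Polynomial.coeff (?q x) l) \<in> polyfuns I (\<delta> + card E * \<delta>)"
    using insert.prems 1 by (intro polyfuns_mult polyfuns_uminus) auto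
  moreover have "(\<lambda>x. if l = 0 then 0 else Polynomial.coeff (?q x) (l - 1)) \<in> polyfuns I (\<delta> + card E * \<delta>)"
    using polyfuns_mono[OF 1[of "l - 1"], of "\<delta> + card E * \<delta>"] polyfuns.zero by (cases "l = 0") simp_all
  ultimately have "(\<lambda>x. (- \<kappa> e x) * Polynomial.coeff (?q x) l +
      (if l = 0 then 0 else Polynomial.coeff (?q x) (l - 1))) \<in> polyfuns I (\<delta> + card E * \<delta>)"
    by (rule polyfuns_add)
  then show ?case using insert.hyps unfolding eq by simp
qed

end

section \<open>Random algebraic graphs\<close>

text \<open>A vertex \<open>u\<close> is identified with the polynomial \<open>ev u\<close>. For \<open>w = (l, \<mu>)\<close>, \<open>key w u v\<close> is
  the value at \<open>\<mu>\<close> of the polynomial with roots \<open>ev u l\<close> and \<open>ev v l\<close>: it is symmetric in \<open>u\<close> and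
  \<open>v\<close>, and for a suitable \<open>w\<close> it separates any bounded number of unordered pairs. Powers of keys
  then make the values of \<open>fval\<close> at these pairs independent.\<close>

locale random_algebraic = finite_subfield A for A :: "'a::field set" +
  fixes a b \<Lambda> :: nat and D :: "'a set"
  assumes D_sub: "D \<subseteq> A"
begin

lemma finite_D: "finite D"
  using D_sub finite_A finite_subset by blast

definition VS :: "(nat \<Rightarrow> 'a) set" where
  "VS = PiE {..<b} (\<lambda>_. A)"

definition ev :: "(nat \<Rightarrow> 'a) \<Rightarrow> 'a \<Rightarrow> 'a" where
  "ev u l = (\<Sum>i<b. u i * l ^ i)"

definition key :: "'a \<times> 'a \<Rightarrow> (nat \<Rightarrow> 'a) \<Rightarrow> (nat \<Rightarrow> 'a) \<Rightarrow> 'a" where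
  "key w u v = (snd w - ev u (fst w)) * (snd w - ev v (fst w))"

lemma key_commute: "key w u v = key w v u"
  by (simp add: key_def mult.commute)

lemma key_A: "w \<in> D \<times> D \<Longrightarrow> u \<in> VS \<Longrightarrow> v \<in> VS \<Longrightarrow> key w u v \<in> A"
  unfolding key_def ev_def VS_def using D_sub
  by (intro mult_A diff_A sum_A power_A) auto

text \<open>No single key separates all pairs, so the keys for all of \<open>D \<times> D\<close>, a
  set whose size will be bounded, are summed. For a given bounded configuration one separating row
  is exposed and the other rows are held fixed.\<close>

definition fval :: "(nat \<times> ('a \<times> 'a) \<times> nat \<Rightarrow> 'a) \<Rightarrow> nat \<Rightarrow> (nat \<Rightarrow> 'a) \<Rightarrow> (nat \<Rightarrow> 'a) \<Rightarrow> 'a" where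
  "fval c j u v = (\<Sum>w\<in>D \<times> D. \<Sum>l<\<Lambda>. c (j, w, l) * key w u v ^ l)"

definition adj :: "(nat \<times> ('a \<times> 'a) \<times> nat \<Rightarrow> 'a) \<Rightarrow> (nat \<Rightarrow> 'a) \<Rightarrow> (nat \<Rightarrow> 'a) \<Rightarrow> bool" where
  "adj c u v \<longleftrightarrow> u \<noteq> v \<and> (\<forall>j<a. fval c j u v = 0)"

lemma fval_commute: "fval c j u v = fval c j v u"
  by (simp add: fval_def key_commute)

lemma adj_commute: "adj c u v \<longleftrightarrow> adj c v u"
  by (auto simp: adj_def fval_commute)

lemma card_ev_collision:
  assumes "u \<in> VS" "v \<in> VS" "u \<noteq> v"
  shows "card {l\<in>D. ev u l = ev v l} \<le> b"
proof (rule ccontr)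
  assume neg: "\<not> ?thesis"
  define f where "f m = (if m < b then u m - v m else 0)" for m
  have "(\<Sum>m\<le>b. f m * s ^ m) = 0" if "s \<in> {l\<in>D. ev u l = ev v l}" for s
  proof -
    have "(\<Sum>m\<le>b. f m * s ^ m) = (\<Sum>m<b. f m * s ^ m)"
      by (simp add: f_def lessThan_Suc_atMost[symmetric])
    also have "\<dots> = ev u s - ev v s"
      by (simp add: f_def ev_def left_diff_distrib sum_subtractf)
    finally show ?thesis using that by simp
  qed
  then have "f m = 0" if "m \<le> b" for m
    using all_zero_if_many_roots[of b "{l\<in>D. ev u l = ev v l}" f] neg that by simp
  then have eq: "u m = v m" if "m < b" for m using that unfolding f_def by (metis less_imp_le right_minus_eq)
  have "u = v" using assms(1,2) eq unfolding VS_def by (intro PiE_ext[of u _ _ v]) auto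
  then show False using assms(3) by simp
qed

text \<open>Both pairs are the roots of the same monic quadratic.\<close>

lemma pair_eq_of_sum_prod:
  fixes \<alpha> \<beta> \<alpha>' \<beta>' :: 'a
  assumes "\<alpha> + \<beta> = \<alpha>' + \<beta>'" "\<alpha> * \<beta> = \<alpha>' * \<beta>'"
  shows "(\<alpha> = \<alpha>' \<and> \<beta> = \<beta>') \<or> (\<alpha> = \<beta>' \<and> \<beta> = \<alpha>')"
proof -
  have "(\<alpha> - \<alpha>') * (\<alpha> - \<beta>') = \<alpha> * \<alpha> - \<alpha> * (\<alpha>' + \<beta>') + \<alpha>' * \<beta>'" by (simp add: algebra_simps)
  also have "\<dots> = 0" unfolding assms[symmetric] by (simp add: algebra_simps)
  finally have "\<alpha> = \<alpha>' \<or> \<alpha> = \<beta>'" by simp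
  then show ?thesis using assms(1) by (auto simp: add.commute)
qed

text \<open>Choose the first component \<open>l\<close> so that evaluation at \<open>l\<close> is
  injective on \<open>P\<close>; each pair of vertices excludes at most \<open>b\<close> points.
  Different vertex pairs then have different monic quadratics, whose difference is nonzero of degree
  at most one, so each of at most \<open>card P ^ 4\<close> comparisons excludes at most one value
  of the second component.\<close>

lemma ex_separating_key:
  assumes P: "finite P" "P \<subseteq> VS" and D: "card P ^ 2 * b + card P ^ 4 < card D"
  shows "\<exists>w\<in>D \<times> D. \<forall>u\<in>P. \<forall>v\<in>P. \<forall>u'\<in>P. \<forall>v'\<in>P. u \<noteq> v \<longrightarrow> u' \<noteq> v' \<longrightarrow>
     key w u v = key w u' v' \<longrightarrow> {u, v} = {u', v'}"
proof -
  let ?Q = "{p\<in>P \<times> P. fst p \<noteq> snd p}"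
  define B1 where "B1 = (\<Union>p\<in>?Q. {l\<in>D. ev (fst p) l = ev (snd p) l})"
  have "card B1 \<le> (\<Sum>p\<in>?Q. card {l\<in>D. ev (fst p) l = ev (snd p) l})"
    unfolding B1_def using P by (intro card_UN_le) auto
  also have "\<dots> \<le> (\<Sum>p\<in>?Q. b)"
    using P(2) by (intro sum_mono card_ev_collision) auto
  also have "\<dots> = card ?Q * b" by simp
  also have "\<dots> \<le> card (P \<times> P) * b" using P(1) by (intro mult_le_mono1 card_mono) auto
  also have "\<dots> = card P ^ 2 * b" by (simp add: card_cartesian_product power2_eq_square)
  finally have "card B1 < card D" using D by linarith
  then have "\<not> D \<subseteq> B1"
    using card_mono[of B1 D] finite_D P by (auto simp: B1_def)
  then obtain l where l: "l \<in> D" "l \<notin> B1" by blast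
  have inj: "ev u l \<noteq> ev v l" if "u \<in> P" "v \<in> P" "u \<noteq> v" for u v
    using l that by (force simp: B1_def)
  let ?QQ = "{(p, p'). p \<in> ?Q \<and> p' \<in> ?Q \<and> {fst p, snd p} \<noteq> {fst p', snd p'}}"
  let ?C = "\<lambda>r. {m\<in>D. key (l, m) (fst (fst r)) (snd (fst r)) = key (l, m) (fst (snd r)) (snd (snd r))}"
  define B2 where "B2 = (\<Union>r\<in>?QQ. ?C r)"
  have QQ: "?QQ \<subseteq> (P \<times> P) \<times> (P \<times> P)" by auto
  have finQQ: "finite ?QQ" using QQ P(1) by (meson finite_SigmaI finite_subset)
  have one: "card (?C r) \<le> 1" if "r \<in> ?QQ" for r
  proof -
    obtain u v u' v' where r: "r = ((u, v), (u', v'))" by (metis prod.exhaust_sel)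
    have uv: "u \<in> P" "v \<in> P" "u' \<in> P" "v' \<in> P" "u \<noteq> v" "u' \<noteq> v'" "{u, v} \<noteq> {u', v'}"
      using that by (auto simp: r)
    have "m = m'" if m: "m \<in> ?C r" "m' \<in> ?C r" for m m'
    proof (rule ccontr)
      assume ne: "m \<noteq> m'"
      let ?s = "ev u l + ev v l - ev u' l - ev v' l"
      let ?p = "ev u l * ev v l - ev u' l * ev v' l"
      have 1: "?s * m = ?p" "?s * m' = ?p" using m by (auto simp: r key_def algebra_simps)
      then have "?s * (m - m') = 0" by (simp add: right_diff_distrib)
      then have "?s = 0" using ne by simp
      then have s: "ev u l + ev v l = ev u' l + ev v' l" by (simp add: algebra_simps)
      have "ev u l * ev v l = ev u' l * ev v' l" using 1 \<open>?s = 0\<close> by simp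
      from pair_eq_of_sum_prod[OF s this] have "(u = u' \<and> v = v') \<or> (u = v' \<and> v = u')"
        using inj uv by metis
      then show False using uv(7) by auto
    qed
    moreover have "finite (?C r)" using finite_D by simp
    ultimately show ?thesis using card_le_Suc0_iff_eq[of "?C r"] by simp
  qed
  have "card B2 \<le> (\<Sum>r\<in>?QQ. card (?C r))" unfolding B2_def by (rule card_UN_le[OF finQQ])
  also have "\<dots> \<le> (\<Sum>r\<in>?QQ. 1)" by (rule sum_mono[OF one])
  also have "\<dots> = card ?QQ" by simp
  also have "\<dots> \<le> card ((P \<times> P) \<times> (P \<times> P))" using P(1) by (intro card_mono QQ) auto
  also have "\<dots> = card P ^ 4" by (simp add: card_cartesian_product power4_eq_xxxx)
  finally have "card B2 < card D" using D by linarith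
  then have "\<not> D \<subseteq> B2"
    using card_mono[of B2 D] finite_D finQQ by (auto simp: B2_def)
  then obtain m where m: "m \<in> D" "m \<notin> B2" by blast
  show ?thesis
  proof (intro bexI[of _ "(l, m)"] ballI impI)
    fix u v u' v' assume uv: "u \<in> P" "v \<in> P" "u' \<in> P" "v' \<in> P" "u \<noteq> v" "u' \<noteq> v'"
      "key (l, m) u v = key (l, m) u' v'"
    show "{u, v} = {u', v'}"
    proof (rule ccontr)
      assume "{u, v} \<noteq> {u', v'}"
      then have "((u, v), (u', v')) \<in> ?QQ" using uv by simp
      moreover have "m \<in> ?C ((u, v), (u', v'))" using m(1) uv(7) by simp
      ultimately show False using m(2) unfolding B2_def by blast
    qed
  qed (use l m in simp)
qed

end

section \<open>Recovering coefficients from petals\<close>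

lemma all_dependent_mono:
  assumes "all_dependent J k \<rho> S" "S' \<subseteq> S"
  shows "all_dependent J k \<rho> S'"
  unfolding all_dependent_def
proof (intro allI impI)
  fix I assume "I \<subseteq> J" "card I = k"
  then have "alg_dependent I \<rho> S" using assms(1) by (simp add: all_dependent_def)
  moreover have "\<exists>y\<in>S. \<forall>i\<in>I. x i = y i" if "x \<in> S'" for x
    using assms(2) that by (intro bexI[of _ x]) auto
  ultimately show "alg_dependent I \<rho> S'" by (rule alg_dependent_cong[rotated])
qed

text \<open>Bounds the degree of \<open>\<Phi>\<close> in \<open>card_many_petals\<close>:
  \<open>1 + 2 * \<Lambda>\<close> for a residual value, \<open>2 * \<Lambda>\<close> for a
  coefficient of a product of linear factors, 1 for the common inverse, and twice the square of
  \<open>\<Lambda>\<close> for the remaining key differences.\<close>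

definition param_degree :: "nat \<Rightarrow> nat" where
  "param_degree \<Lambda> = 2 * \<Lambda>\<^sup>2 + 4 * \<Lambda> + 2"

text \<open>Large enough to force relations between \<open>N + 2\<close> values that are polynomials
  of degree \<open>\<delta>\<close> in at most \<open>N + 1\<close> parameters: one further factor
  \<open>\<rho> + 1\<close> outweighs a constant to the power \<open>N + 1\<close>.\<close>

definition dep_degree :: "nat \<Rightarrow> nat \<Rightarrow> nat" where
  "dep_degree N \<delta> = ((N + 2) * \<delta>) ^ (N + 1)"

lemma dep_degree_bound:
  assumes "n \<le> N + 1" "\<delta> \<ge> 1"
  shows "((N + 2) * (dep_degree N \<delta> * \<delta>) + 1) ^ n < (dep_degree N \<delta> + 1) ^ (N + 2)"
proof -
  let ?\<rho> = "dep_degree N \<delta>"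
  have "(N + 2) * (?\<rho> * \<delta>) + 1 \<le> ((N + 2) * \<delta>) * (?\<rho> + 1)"
    using assms(2) by (simp add: algebra_simps)
  then have "((N + 2) * (?\<rho> * \<delta>) + 1) ^ n \<le> (((N + 2) * \<delta>) * (?\<rho> + 1)) ^ n"
    by (rule power_mono) simp
  also have "\<dots> \<le> (((N + 2) * \<delta>) * (?\<rho> + 1)) ^ (N + 1)"
    using assms by (intro power_increasing) auto
  also have "\<dots> = ?\<rho> * (?\<rho> + 1) ^ (N + 1)"
    by (simp only: power_mult_distrib dep_degree_def)
  also have "\<dots> < (?\<rho> + 1) * (?\<rho> + 1) ^ (N + 1)" by (intro mult_strict_right_mono) auto
  also have "\<dots> = (?\<rho> + 1) ^ (N + 2)" by simp
  finally show ?thesis .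
qed

context random_algebraic
begin

lemma ev_poly:
  assumes "finite I" "l \<in> A" "\<And>i. i < b \<Longrightarrow> f i \<in> polyfuns I 1"
  shows "(\<lambda>p. ev (\<lambda>i. f i p) l) \<in> polyfuns I 1"
  unfolding ev_def
proof (intro polyfuns_sum)
  fix i assume "i \<in> {..<b}"
  then have "(\<lambda>p. f i p * l ^ i) \<in> polyfuns I (1 + 0)"
    using assms by (intro polyfuns_mult polyfuns_const power_A) auto
  then show "(\<lambda>p. f i p * l ^ i) \<in> polyfuns I 1" by simp
qed

lemma key_poly:
  assumes "finite I" "w \<in> D \<times> D" "\<And>i. i < b \<Longrightarrow> f i \<in> polyfuns I 1" "\<And>i. i < b \<Longrightarrow> g i \<in> polyfuns I 1"
  shows "(\<lambda>p. key w (\<lambda>i. f i p) (\<lambda>i. g i p)) \<in> polyfuns I 2"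
proof -
  have w: "fst w \<in> A" "snd w \<in> A" using assms(2) D_sub by auto
  have "(\<lambda>p. (snd w - ev (\<lambda>i. f i p) (fst w)) * (snd w - ev (\<lambda>i. g i p) (fst w))) \<in> polyfuns I (1 + 1)"
    using assms w by (intro polyfuns_mult polyfuns_diff polyfuns_const ev_poly) auto
  then show ?thesis by (simp add: key_def numeral_2_eq_2)
qed

definition with_row :: "'a \<times> 'a \<Rightarrow> (nat \<times> nat \<Rightarrow> 'a) \<Rightarrow> (nat \<times> ('a \<times> 'a) \<times> nat \<Rightarrow> 'a)
    \<Rightarrow> (nat \<times> ('a \<times> 'a) \<times> nat \<Rightarrow> 'a)" where
  "with_row w c1 c0 = (\<lambda>(j, w', l). if w' = w then c1 (j, l) else c0 (j, w', l))"

lemma fval_with_row: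
  assumes "w \<in> D \<times> D"
  shows "fval (with_row w c1 c0) j u v = (\<Sum>l<\<Lambda>. c1 (j, l) * key w u v ^ l) +
    (\<Sum>w'\<in>D \<times> D - {w}. \<Sum>l<\<Lambda>. c0 (j, w', l) * key w' u v ^ l)"
proof -
  have "finite (D \<times> D)" using finite_D by simp
  then have "fval (with_row w c1 c0) j u v = (\<Sum>l<\<Lambda>. with_row w c1 c0 (j, w, l) * key w u v ^ l) +
    (\<Sum>w'\<in>D \<times> D - {w}. \<Sum>l<\<Lambda>. with_row w c1 c0 (j, w', l) * key w' u v ^ l)"
    unfolding fval_def using assms by (rule sum.remove)
  also have "(\<Sum>w'\<in>D \<times> D - {w}. \<Sum>l<\<Lambda>. with_row w c1 c0 (j, w', l) * key w' u v ^ l) =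
     (\<Sum>w'\<in>D \<times> D - {w}. \<Sum>l<\<Lambda>. c0 (j, w', l) * key w' u v ^ l)"
    by (intro sum.cong refl) (auto simp: with_row_def)
  finally show ?thesis by (simp add: with_row_def)
qed

text \<open>\<open>U\<close> holds the vertices that move with a petal; \<open>\<psi>\<close> places
  the roots and the kernel, which all petals share.\<close>

definition place :: "nat set \<Rightarrow> (nat \<Rightarrow> nat \<Rightarrow> 'a) \<Rightarrow> (nat \<Rightarrow> nat \<Rightarrow> 'a) \<Rightarrow> nat \<Rightarrow> nat \<Rightarrow> 'a" where
  "place U \<psi> y x = (if x \<in> U then y x else \<psi> x)"

text \<open>Coordinate \<open>i0\<close> of vertex \<open>u0\<close> differs from petal to petal; it
  is the marked coordinate that will be eliminated. The keys are distinct across all petals and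
  edges, so that they can serve as interpolation nodes.\<close>

definition many_petals :: "'a \<times> 'a \<Rightarrow> nat set \<Rightarrow> (nat \<times> nat) set \<Rightarrow> (nat \<Rightarrow> nat \<Rightarrow> 'a) \<Rightarrow> nat \<Rightarrow> nat \<Rightarrow> nat \<Rightarrow>
    (nat \<times> ('a \<times> 'a) \<times> nat \<Rightarrow> 'a) \<Rightarrow> (nat \<Rightarrow> nat \<Rightarrow> nat \<Rightarrow> 'a) \<Rightarrow> bool" where
  "many_petals w U Es \<psi> u0 i0 m c Y \<longleftrightarrow>
     (\<forall>s<m. \<forall>u\<in>U. Y s u \<in> VS) \<and>
     inj_on (\<lambda>s. Y s u0 i0) {..<m} \<and>
     inj_on (\<lambda>(s, e). key w (place U \<psi> (Y s) (fst e)) (place U \<psi> (Y s) (snd e))) ({..<m} \<times> Es) \<and>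
     (\<forall>s<m. \<forall>e\<in>Es. \<forall>j<a. fval c j (place U \<psi> (Y s) (fst e)) (place U \<psi> (Y s) (snd e)) = 0)"

text \<open>Take one petal from each of \<open>K\<close> blocks. The row \<open>c1\<close> and the marked coordinates of these
  petals are polynomial functions of the coordinates of the petals, of the coefficients of high
  degree, and of the inverse of the product of all differences of keys.\<close>

lemma card_many_petals:
  fixes K :: nat and Es :: "(nat \<times> nat) set"
  defines "N \<equiv> a * \<Lambda>" and "\<rho> \<equiv> dep_degree (a * \<Lambda>) (param_degree \<Lambda>)"
  assumes w: "w \<in> D \<times> D" and fin: "finite U" "finite Es"
    and \<psi>: "\<And>e. e \<in> Es \<Longrightarrow> \<forall>x\<in>{fst e, snd e}. x \<in> U \<or> \<psi> x \<in> VS"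
    and dens: "b * card U \<le> a * card Es" and \<Lambda>: "K * card Es \<le> \<Lambda>" and K: "K \<le> N + 2"
    and u0: "u0 \<in> U" "i0 < b"
    and c0: "\<And>j w' l. j < a \<Longrightarrow> w' \<in> D \<times> D \<Longrightarrow> l < \<Lambda> \<Longrightarrow> c0 (j, w', l) \<in> A"
  shows "card {c1 \<in> PiE ({..<a} \<times> {..<\<Lambda>}) (\<lambda>_. A).
       \<exists>Y. many_petals w U Es \<psi> u0 i0 (K * (\<rho> + 1)) (with_row w c1 c0) Y} * card A
     \<le> (\<rho> + 2) ^ N * card A ^ (N + 2 - K)"
proof -
  define J where "J = {..<a} \<times> {..<\<Lambda>}"
  define m where "m = K * (\<rho> + 1)"
  define Bad where "Bad = {c1 \<in> PiE J (\<lambda>_. A). \<exists>Y. many_petals w U Es \<psi> u0 i0 m (with_row w c1 c0) Y}"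
  define pet where "pet c1 = (SOME Y. many_petals w U Es \<psi> u0 i0 m (with_row w c1 c0) Y)" for c1
  have pet: "many_petals w U Es \<psi> u0 i0 m (with_row w c1 c0) (pet c1)" if "c1 \<in> Bad" for c1
  proof -
    have "\<exists>Y. many_petals w U Es \<psi> u0 i0 m (with_row w c1 c0) Y" using that by (simp add: Bad_def)
    then show ?thesis unfolding pet_def by (rule someI_ex)
  qed
  \<comment> \<open>A block has one petal more than a relation of degree \<open>\<rho>\<close> can
    have roots. Disjoint blocks keep the \<open>K\<close> chosen petals distinct.\<close>
  define block where "block i = {i * (\<rho> + 1)..<i * (\<rho> + 1) + (\<rho> + 1)}" for i
  \<comment> \<open>Points are coefficient rows extended by \<open>k\<close> marked coordinates,
    stored at the indices \<open>(a + i, 0)\<close>, which lie outside \<open>J\<close>.\<close>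
  define S where "S k = {x. \<exists>c1\<in>Bad. (\<forall>p\<in>J. x p = c1 p) \<and>
      (\<forall>i<k. x (a + i, 0) \<in> (\<lambda>s. pet c1 s u0 i0) ` block i)}" for k
  define J' where "J' k = J \<union> (\<lambda>i. (a + i, 0::nat)) ` {..<k}" for k
  have block_sub: "block i \<subseteq> {..<m}" if "i < K" for i
  proof -
    have "i * (\<rho> + 1) + (\<rho> + 1) = Suc i * (\<rho> + 1)" by simp
    also have "\<dots> \<le> m" unfolding m_def using that by (intro mult_le_mono1) simp
    finally show ?thesis by (auto simp: block_def)
  qed
  have block_inj: "i = i'" if "s \<in> block i" "s \<in> block i'" for s i i'
  proof -
    have "s div (\<rho> + 1) = i" if "s \<in> block i" for i
      using that unfolding block_def
      by (intro div_nat_eqI) (auto simp: algebra_simps)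
    then show ?thesis using that by metis
  qed

  define Par where "Par = (Inl ` ({..<K} \<times> U \<times> {..<b}) \<union>
     Inr ` (insert None (Some ` ({..<a} \<times> {K * card Es..<\<Lambda>}))) :: (nat \<times> nat \<times> nat + (nat \<times> nat) option) set)"
  have finPar: "finite Par" using fin by (simp add: Par_def)
  have cardPar: "card Par \<le> N + 1"
  proof -
    have "card (Inl ` ({..<K} \<times> U \<times> {..<b}) :: (nat \<times> nat \<times> nat + (nat \<times> nat) option) set) = K * (card U * b)"
      by (subst card_image) (auto simp: card_cartesian_product)
    moreover have "card (Inr ` (insert None (Some ` ({..<a} \<times> {K * card Es..<\<Lambda>}))) :: (nat \<times> nat \<times> nat + (nat \<times> nat) option) set) = 1 + a * (\<Lambda> - K * card Es)"
      by (subst card_image) (auto simp: card_cartesian_product card_image)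
    ultimately have "card Par \<le> K * (card U * b) + (1 + a * (\<Lambda> - K * card Es))"
      unfolding Par_def using card_Un_le by (metis (no_types, lifting))
    \<comment> \<open>Here the density enters: the petals have at most as many coordinates as the
      \<open>K * (a * card Es)\<close> coefficients that they determine. The one parameter in excess
      of \<open>N\<close> is the inverse.\<close>
    also have "K * (card U * b) \<le> K * (a * card Es)" using dens by (simp add: mult.commute)
    finally have "card Par \<le> K * (a * card Es) + (1 + a * (\<Lambda> - K * card Es))" by simp
    also have "\<dots> = a * (K * card Es + (\<Lambda> - K * card Es)) + 1" by (simp add: algebra_simps)
    also have "\<dots> = N + 1" using \<Lambda> by (simp add: N_def)
    finally show ?thesis .
  qed

  define E where "E = {..<K} \<times> Es"
  have finE: "finite E" and cardE: "card E = K * card Es" using fin by (auto simp: E_def card_cartesian_product)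
  define cv where "cv k x p = (if x \<in> U then (\<lambda>i. p (Inl (k, x, i))) else \<psi> x)"
    for k x and p :: "nat \<times> nat \<times> nat + (nat \<times> nat) option \<Rightarrow> 'a"
  define kp where "kp w' e p = key w' (cv (fst e) (fst (snd e)) p) (cv (fst e) (snd (snd e)) p)" for w' e p
  define yv where "yv j e p = - (\<Sum>w'\<in>D \<times> D - {w}. \<Sum>l<\<Lambda>. c0 (j, w', l) * kp w' e p ^ l)" for j e p
  \<comment> \<open>For low degrees this is the formula of \<open>vandermonde_solve\<close>, where
    each individual inverse is written as the common inverse times the remaining factors. The last
    case returns a marked coordinate.\<close>
  define \<Phi> where "\<Phi> q p = (if q \<in> J then
       (if snd q \<ge> card E then p (Inr (Some q)) else
         (\<Sum>e\<in>E. (yv (fst q) e p - (\<Sum>l'\<in>{card E..<\<Lambda>}. p (Inr (Some (fst q, l'))) * kp w e p ^ l')) *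
           (Polynomial.coeff (\<Prod>e'\<in>E - {e}. [:- kp w e' p, 1:]) (snd q) *
             (p (Inr None) * (\<Prod>e1\<in>E - {e}. \<Prod>e'\<in>E - {e1}. kp w e1 p - kp w e' p)))))
       else p (Inl (fst q - a, u0, i0)))" for q p
  let ?\<delta> = "param_degree \<Lambda>"
  have kp_poly: "kp w' e \<in> polyfuns Par 2" if wD: "w' \<in> D \<times> D" and eE: "e \<in> E" for w' e
  proof -
    obtain k e1 e2 where e: "e = (k, e1, e2)" "k < K" "(e1, e2) \<in> Es" using eE by (auto simp: E_def)
    have "(\<lambda>p. cv k x p i) \<in> polyfuns Par 1" if x: "x \<in> {e1, e2}" and i: "i < b" for x i
    proof (cases "x \<in> U")
      case True
      then show ?thesis using e i finPar unfolding cv_def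
        by (simp, intro polyfuns_var) (auto simp: Par_def)
    next
      case False
      then have "\<psi> x \<in> VS" using \<psi>[OF e(3)] x by auto
      then have "\<psi> x i \<in> A" using i by (auto simp: VS_def)
      then show ?thesis using False unfolding cv_def by (simp add: polyfuns_const)
    qed
    then show ?thesis
      unfolding kp_def e using key_poly[OF finPar wD, of "\<lambda>i p. cv k e1 p i" "\<lambda>i p. cv k e2 p i"] by simp
  qed
  have yv_poly: "yv j e \<in> polyfuns Par (2 * \<Lambda>)" if "j < a" "e \<in> E" for j e
  proof -
    have "(\<lambda>p. c0 (j, w', l) * kp w' e p ^ l) \<in> polyfuns Par (2 * \<Lambda>)"
      if "w' \<in> D \<times> D - {w}" "l < \<Lambda>" for w' l
    proof -
      have "(\<lambda>p. c0 (j, w', l) * kp w' e p ^ l) \<in> polyfuns Par (0 + l * 2)"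
        using that \<open>j < a\<close> \<open>e \<in> E\<close> c0[of j w' l]
        by (intro polyfuns_mult polyfuns_const polyfuns_power kp_poly) auto
      then show ?thesis by (rule polyfuns_mono) (use that in simp)
    qed
    then show ?thesis unfolding yv_def by (intro polyfuns_uminus polyfuns_sum) auto
  qed
  have \<Phi>_poly: "\<Phi> q \<in> polyfuns Par ?\<delta>" if q: "q \<in> J' K" for q
  proof (cases "q \<in> J")
    case True
    show ?thesis
    proof (cases "snd q \<ge> card E")
      case ge: True
      then have "(\<lambda>p. p (Inr (Some q))) \<in> polyfuns Par ?\<delta>"
        using True finPar cardE by (intro polyfuns_var) (auto simp: Par_def J_def param_degree_def)
      then show ?thesis using True ge by (simp add: \<Phi>_def[abs_def])
    next
      case lt: False
      have j: "fst q < a" using True by (auto simp: J_def)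
      have "(\<lambda>p. (yv (fst q) e p - (\<Sum>l'\<in>{card E..<\<Lambda>}. p (Inr (Some (fst q, l'))) * kp w e p ^ l')) *
           (Polynomial.coeff (\<Prod>e'\<in>E - {e}. [:- kp w e' p, 1:]) (snd q) *
             (p (Inr None) * (\<Prod>e1\<in>E - {e}. \<Prod>e'\<in>E - {e1}. kp w e1 p - kp w e' p)))) \<in> polyfuns Par ?\<delta>"
        if e: "e \<in> E" for e
      proof -
        have 1: "(\<lambda>p. p (Inr (Some (fst q, l'))) * kp w e p ^ l') \<in> polyfuns Par (1 + 2 * \<Lambda>)"
          if "l' \<in> {card E..<\<Lambda>}" for l'
        proof -
          have "(\<lambda>p. p (Inr (Some (fst q, l'))) * kp w e p ^ l') \<in> polyfuns Par (1 + l' * 2)"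
            using that j finPar cardE
            by (intro polyfuns_mult polyfuns_power kp_poly w e polyfuns_var) (auto simp: Par_def)
          then show ?thesis by (rule polyfuns_mono) (use that in simp)
        qed
        have 2: "(\<lambda>p. yv (fst q) e p - (\<Sum>l'\<in>{card E..<\<Lambda>}. p (Inr (Some (fst q, l'))) * kp w e p ^ l'))
            \<in> polyfuns Par (1 + 2 * \<Lambda>)"
          by (intro polyfuns_diff polyfuns_sum 1 polyfuns_mono[OF yv_poly[OF j e]]) auto
        have 3: "(\<lambda>p. Polynomial.coeff (\<Prod>e'\<in>E - {e}. [:- kp w e' p, 1:]) (snd q)) \<in> polyfuns Par (card (E - {e}) * 2)"
          using finE w by (intro polyfuns_coeff_prod kp_poly) auto
        have 4: "(\<lambda>p. \<Prod>e1\<in>E - {e}. \<Prod>e'\<in>E - {e1}. kp w e1 p - kp w e' p) \<in> polyfuns Par (card (E - {e}) * (card E * 2))"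
        proof (intro polyfuns_prod)
          fix e1 assume e1: "e1 \<in> E - {e}"
          have "(\<lambda>p. \<Prod>e'\<in>E - {e1}. kp w e1 p - kp w e' p) \<in> polyfuns Par (card (E - {e1}) * 2)"
            using e1 w by (intro polyfuns_prod polyfuns_diff kp_poly) auto
          then show "(\<lambda>p. \<Prod>e'\<in>E - {e1}. kp w e1 p - kp w e' p) \<in> polyfuns Par (card E * 2)"
            by (rule polyfuns_mono) (use e1 finE in \<open>simp add: card_Diff_singleton_if\<close>)
        qed
        have 5: "(\<lambda>p. p (Inr None)) \<in> polyfuns Par 1"
          using finPar by (intro polyfuns_var) (auto simp: Par_def)
        have E\<Lambda>: "card (E - {e}) \<le> \<Lambda>" "card E \<le> \<Lambda>" using cardE \<Lambda> finE e by (auto simp: card_Diff_singleton_if)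
        have "(1 + 2 * \<Lambda>) + (card (E - {e}) * 2 + (1 + card (E - {e}) * (card E * 2))) \<le>
            (1 + 2 * \<Lambda>) + (\<Lambda> * 2 + (1 + \<Lambda> * (\<Lambda> * 2)))"
          using E\<Lambda> by (intro add_mono mult_le_mono) auto
        also have "\<dots> = ?\<delta>" by (simp add: param_degree_def power2_eq_square algebra_simps)
        finally show ?thesis
          using polyfuns_mult[OF 2 polyfuns_mult[OF 3 polyfuns_mult[OF 5 4]]] polyfuns_mono by blast
      qed
      then have "(\<lambda>p. \<Sum>e\<in>E. (yv (fst q) e p - (\<Sum>l'\<in>{card E..<\<Lambda>}. p (Inr (Some (fst q, l'))) * kp w e p ^ l')) *
           (Polynomial.coeff (\<Prod>e'\<in>E - {e}. [:- kp w e' p, 1:]) (snd q) *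
             (p (Inr None) * (\<Prod>e1\<in>E - {e}. \<Prod>e'\<in>E - {e1}. kp w e1 p - kp w e' p)))) \<in> polyfuns Par ?\<delta>"
        by (rule polyfuns_sum)
      then show ?thesis using True lt by (simp add: \<Phi>_def[abs_def])
    qed
  next
    case False
    then obtain i where i: "q = (a + i, 0)" "i < K" using q by (auto simp: J'_def)
    have "(\<lambda>p. p (Inl (i, u0, i0))) \<in> polyfuns Par ?\<delta>"
      using i u0 finPar by (intro polyfuns_var) (auto simp: Par_def param_degree_def)
    then show ?thesis using False i by (simp add: \<Phi>_def[abs_def])
  qed

  have S_image: "\<exists>p. \<forall>q\<in>J' K. x q = \<Phi> q p" if x: "x \<in> S K" for x
  proof -
    obtain c1 where c1: "c1 \<in> Bad" "\<forall>p\<in>J. x p = c1 p"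
      "\<forall>i<K. x (a + i, 0) \<in> (\<lambda>s. pet c1 s u0 i0) ` block i"
      using x unfolding S_def by blast
    define Y where "Y = pet c1"
    have Y: "many_petals w U Es \<psi> u0 i0 m (with_row w c1 c0) Y" unfolding Y_def by (rule pet[OF c1(1)])
    have "\<forall>i. \<exists>s. i < K \<longrightarrow> s \<in> block i \<and> x (a + i, 0) = Y s u0 i0"
      using c1(3) unfolding Y_def by auto
    then obtain s where s: "\<And>i. i < K \<Longrightarrow> s i \<in> block i" "\<And>i. i < K \<Longrightarrow> x (a + i, 0) = Y (s i) u0 i0"
      by metis
    define \<kappa> where "\<kappa> e = key w (place U \<psi> (Y (s (fst e))) (fst (snd e))) (place U \<psi> (Y (s (fst e))) (snd (snd e)))" for e
    define p where "p = (\<lambda>r. case r of Inl (k, u, i) \<Rightarrow> Y (s k) u i | Inr None \<Rightarrow> inverse (\<Prod>e1\<in>E. \<Prod>e'\<in>E - {e1}. \<kappa> e1 - \<kappa> e')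
       | Inr (Some q) \<Rightarrow> c1 q)"
    have p_simps: "p (Inl (k, u, i)) = Y (s k) u i" "p (Inr (Some q)) = c1 q"
      "p (Inr None) = inverse (\<Prod>e1\<in>E. \<Prod>e'\<in>E - {e1}. \<kappa> e1 - \<kappa> e')" for k u i q
      by (simp_all add: p_def)
    have cv: "cv k x p = place U \<psi> (Y (s k)) x" for k x
      by (simp add: cv_def place_def p_simps)
    have kp_w: "kp w e p = \<kappa> e" for e by (simp add: kp_def cv \<kappa>_def)
    have sm: "s i < m" if "i < K" for i using s(1)[OF that] block_sub[OF that] by auto
    have \<kappa>_inj: "inj_on \<kappa> E"
    proof (rule inj_onI)
      fix e e' assume e: "e \<in> E" "e' \<in> E" "\<kappa> e = \<kappa> e'"
      have inj: "inj_on (\<lambda>(s, e). key w (place U \<psi> (Y s) (fst e)) (place U \<psi> (Y s) (snd e))) ({..<m} \<times> Es)"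
        using Y by (simp add: many_petals_def)
      have "(s (fst e), snd e) = (s (fst e'), snd e')"
        by (rule inj_onD[OF inj]) (use e sm in \<open>auto simp: \<kappa>_def E_def\<close>)
      then have "s (fst e) = s (fst e')" "snd e = snd e'" by auto
      moreover have "fst e = fst e'"
      proof (rule block_inj)
        show "s (fst e) \<in> block (fst e)" using s(1) e(1) by (auto simp: E_def)
        show "s (fst e) \<in> block (fst e')" using s(1) e(2) calculation(1) by (auto simp: E_def)
      qed
      ultimately show "e = e'" by (simp add: prod_eq_iff)
    qed
    have zero: "(\<Sum>l<\<Lambda>. c1 (j, l) * \<kappa> e ^ l) = yv j e p" if "j < a" "e \<in> E" for j e
    proof -
      have "fval (with_row w c1 c0) j (place U \<psi> (Y (s (fst e))) (fst (snd e))) (place U \<psi> (Y (s (fst e))) (snd (snd e))) = 0"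
      proof -
        have "fst e < K" "snd e \<in> Es" using that by (auto simp: E_def)
        moreover have "\<forall>s<m. \<forall>e\<in>Es. \<forall>j<a. fval (with_row w c1 c0) j (place U \<psi> (Y s) (fst e)) (place U \<psi> (Y s) (snd e)) = 0"
          using Y unfolding many_petals_def by (elim conjE)
        ultimately show ?thesis using sm that(1) by simp
      qed
      then show ?thesis
        unfolding fval_with_row[OF w] by (simp add: yv_def kp_def cv \<kappa>_def eq_neg_iff_add_eq_0)
    qed
    have "x q = \<Phi> q p" if q: "q \<in> J' K" for q
    proof (cases "q \<in> J")
      case True
      obtain j l where jl: "q = (j, l)" "j < a" "l < \<Lambda>" using True by (auto simp: J_def)
      show ?thesis
      proof (cases "l \<ge> card E")
        case True
        then show ?thesis using \<open>q \<in> J\<close> c1(2) jl by (simp add: \<Phi>_def p_simps)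
      next
        case False
        have prod0: "(\<Prod>e'\<in>E - {e}. \<kappa> e - \<kappa> e') \<noteq> 0" if "e \<in> E" for e
          using finE \<kappa>_inj that by (auto simp: inj_on_def)
        have inv: "inverse (\<Prod>e'\<in>E - {e}. \<kappa> e - \<kappa> e') =
            inverse (\<Prod>e1\<in>E. \<Prod>e'\<in>E - {e1}. \<kappa> e1 - \<kappa> e') * (\<Prod>e1\<in>E - {e}. \<Prod>e'\<in>E - {e1}. \<kappa> e1 - \<kappa> e')"
          if e: "e \<in> E" for e
        proof -
          have "(\<Prod>e1\<in>E. \<Prod>e'\<in>E - {e1}. \<kappa> e1 - \<kappa> e') =
             (\<Prod>e'\<in>E - {e}. \<kappa> e - \<kappa> e') * (\<Prod>e1\<in>E - {e}. \<Prod>e'\<in>E - {e1}. \<kappa> e1 - \<kappa> e')"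
            by (rule prod.remove[OF finE e])
          moreover have "(\<Prod>e1\<in>E - {e}. \<Prod>e'\<in>E - {e1}. \<kappa> e1 - \<kappa> e') \<noteq> 0"
            using prod0 finE by simp
          ultimately show ?thesis using prod0[OF e] by (simp add: field_simps)
        qed
        have "c1 (j, l) = (\<Sum>e\<in>E. (yv j e p - (\<Sum>l'\<in>{card E..<\<Lambda>}. c1 (j, l') * \<kappa> e ^ l')) *
            Polynomial.coeff (\<Prod>e'\<in>E - {e}. [:- \<kappa> e', 1:]) l * inverse (\<Prod>e'\<in>E - {e}. \<kappa> e - \<kappa> e'))"
          using False \<Lambda> cardE zero[OF jl(2)]
          by (intro vandermonde_solve[OF finE \<kappa>_inj, where c = "\<lambda>l. c1 (j, l)"]) auto
        also have "\<dots> = \<Phi> q p"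
          using \<open>q \<in> J\<close> jl False by (auto simp: \<Phi>_def p_simps kp_w inv mult_ac intro!: sum.cong)
        finally show ?thesis using c1(2) \<open>q \<in> J\<close> jl by simp
      qed
    next
      case False
      then obtain i where i: "q = (a + i, 0)" "i < K" using q by (auto simp: J'_def)
      then show ?thesis using False s(2)[OF i(2)] by (simp add: \<Phi>_def p_simps)
    qed
    then show ?thesis by blast
  qed

  have "all_dependent (J' K) (N + 2) \<rho> (S K)"
    unfolding all_dependent_def
  proof (intro allI impI)
    fix I assume I: "I \<subseteq> J' K" "card I = N + 2"
    have finI: "finite I" using I(1) by (rule finite_subset) (simp add: J'_def J_def)
    have "(card I * (\<rho> * ?\<delta>) + 1) ^ card Par < (\<rho> + 1) ^ card I"
      unfolding I(2) \<rho>_def N_def using cardPar N_def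
      by (intro dep_degree_bound) (auto simp: param_degree_def)
    then show "alg_dependent I \<rho> (S K)"
      using I(1) S_image \<Phi>_poly by (intro alg_dependent_image[OF finPar finI, of \<Phi> ?\<delta>]) blast+
  qed
  \<comment> \<open>The marked coordinates are eliminated one at a time; each takes
    \<open>\<rho> + 1\<close> values in its block. What remains are relations between any
    \<open>N + 2 - K\<close> of the coefficients.\<close>
  then have "all_dependent (J' (K - n)) (N + 2 - n) \<rho> (S (K - n))" if "n \<le> K" for n
    using that
  proof (induction n)
    case (Suc n)
    define k where "k = K - Suc n"
    have k: "K - n = Suc k" "k < K" "N + 2 - n = Suc (N + 2 - Suc n)"
      using Suc.prems K by (auto simp: k_def)
    have ins: "J' (Suc k) = insert (a + k, 0) (J' k)" by (auto simp: J'_def lessThan_Suc)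
    have "all_dependent (J' k) (N + 2 - Suc n) \<rho> (S k)"
    proof (rule all_dependent_heavy[where i = "(a + k, 0)" and S = "S (Suc k)"])
      show "all_dependent (insert (a + k, 0) (J' k)) (Suc (N + 2 - Suc n)) \<rho> (S (Suc k))"
        using Suc unfolding k ins by simp
      show "finite (J' k)" by (simp add: J'_def J_def)
      show "(a + k, 0) \<notin> J' k" by (auto simp: J'_def J_def)
      fix x assume "x \<in> S k"
      then obtain c1 where c1: "c1 \<in> Bad" "\<forall>p\<in>J. x p = c1 p"
        "\<forall>i<k. x (a + i, 0) \<in> (\<lambda>s. pet c1 s u0 i0) ` block i" unfolding S_def by blast
      let ?V = "(\<lambda>s. pet c1 s u0 i0) ` block k"
      have "inj_on (\<lambda>s. pet c1 s u0 i0) (block k)"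
        using pet[OF c1(1)] block_sub[OF k(2)] inj_on_subset unfolding many_petals_def by blast
      then have "card ?V = \<rho> + 1" by (simp add: card_image block_def)
      moreover have "x((a + k, 0) := t) \<in> S (Suc k)" if t: "t \<in> ?V" for t
        unfolding S_def
      proof (intro CollectI bexI[of _ c1] conjI ballI allI impI)
        fix p assume "p \<in> J"
        then show "(x((a + k, 0) := t)) p = c1 p" using c1(2) by (auto simp: J_def)
      next
        fix i assume "i < Suc k"
        then show "(x((a + k, 0) := t)) (a + i, 0) \<in> (\<lambda>s. pet c1 s u0 i0) ` block i"
          using t c1(3) by (cases "i = k") auto
      qed (rule c1(1))
      ultimately show "\<exists>V. \<rho> < card V \<and> (\<forall>s\<in>V. x((a + k, 0) := s) \<in> S (Suc k))"
        by (intro exI[of _ ?V]) auto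
    qed
    then show ?case by (simp add: k_def)
  qed simp
  from this[of K] have "all_dependent J (N + 2 - K) \<rho> (S 0)"
    by (simp add: J'_def)
  moreover have "Bad \<subseteq> S 0" unfolding S_def by auto
  ultimately have "all_dependent J (N + 2 - K) \<rho> Bad" by (rule all_dependent_mono)
  then have "card Bad * card A \<le> (\<rho> + 2) ^ card J * card A ^ (N + 2 - K)"
    using finite_A zero_A by (intro card_all_dependent) (auto simp: J_def Bad_def)
  then show ?thesis by (simp add: Bad_def J_def N_def m_def card_cartesian_product)
qed

end

section \<open>Embeddings and cliques\<close>

definition embeddings :: "'a ugraph \<Rightarrow> 'b ugraph \<Rightarrow> ('a \<Rightarrow> 'b) set" where
  "embeddings F G = {\<phi> \<in> extensional (verts F). \<phi> ` verts F \<subseteq> verts G \<and> inj_on \<phi> (verts F) \<and>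
     (\<forall>e\<in>edges F. \<phi> ` e \<in> edges G)}"

definition rooted_embeddings :: "'a ugraph \<Rightarrow> 'a set \<Rightarrow> 'b ugraph \<Rightarrow> ('a \<Rightarrow> 'b) \<Rightarrow> ('a \<Rightarrow> 'b) set" where
  "rooted_embeddings F R G \<psi> = {\<phi> \<in> embeddings F G. \<forall>r\<in>R. \<phi> r = \<psi> r}"

text \<open>What counting needs from a balanced graph of density at least \<open>d\<close>, without
  reference to the density of the whole set of non-roots. \<open>power_free_bound\<close> recovers
  balanced pieces from it.\<close>

definition dense_over :: "rat \<Rightarrow> 'a ugraph \<Rightarrow> 'a set \<Rightarrow> bool" where
  "dense_over d F R \<longleftrightarrow> (\<forall>S\<subseteq>verts F - R. d * of_nat (card S) \<le> of_nat (card {e \<in> edges F. e \<inter> S \<noteq> {}}))"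

definition cliques :: "nat \<Rightarrow> 'a ugraph \<Rightarrow> 'a set set" where
  "cliques t G = {T. T \<subseteq> verts G \<and> card T = t \<and> (\<forall>u\<in>T. \<forall>v\<in>T. u \<noteq> v \<longrightarrow> {u, v} \<in> edges G)}"

section \<open>Counting cliques and bad coefficients\<close>

context random_algebraic
begin

definition Idx :: "(nat \<times> ('a \<times> 'a) \<times> nat) set" where
  "Idx = {..<a} \<times> (D \<times> D) \<times> {..<\<Lambda>}"

definition coeffs :: "(nat \<times> ('a \<times> 'a) \<times> nat \<Rightarrow> 'a) set" where
  "coeffs = PiE Idx (\<lambda>_. A)"

definition host :: "(nat \<times> ('a \<times> 'a) \<times> nat \<Rightarrow> 'a) \<Rightarrow> (nat \<Rightarrow> 'a) ugraph" where
  "host c = (VS, {{u, v} | u v. u \<in> VS \<and> v \<in> VS \<and> adj c u v})"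

lemma finite_Idx: "finite Idx"
  using finite_D by (simp add: Idx_def)

lemma finite_coeffs: "finite coeffs"
  using finite_Idx finite_A by (simp add: coeffs_def finite_PiE)

lemma card_coeffs: "card coeffs = card A ^ card Idx"
  using finite_Idx by (simp add: coeffs_def card_PiE)

lemma finite_VS: "finite VS"
  using finite_A by (simp add: VS_def finite_PiE)

lemma card_VS: "card VS = card A ^ b"
  by (simp add: VS_def card_PiE)

lemma simple_graph_host: "simple_graph (host c)"
  unfolding simple_graph_def host_def using finite_VS by (auto simp: adj_def)

lemma edge_host:
  assumes "{u, v} \<in> edges (host c)"
  shows "adj c u v"
proof -
  obtain u' v' where "{u, v} = {u', v'}" "adj c u' v'" using assms unfolding host_def by auto
  then have "(u = u' \<and> v = v') \<or> (u = v' \<and> v = u')" by (simp add: doubleton_eq_iff)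
  then show ?thesis using \<open>adj c u' v'\<close> adj_commute[of c u' v'] by auto
qed

text \<open>A count keeps the solution inside \<open>A\<close>: evaluation at distinct nodes is
  injective on coefficient vectors, and both sides have \<open>card A ^ card E\<close>
  elements.\<close>

lemma interpolation:
  assumes E: "finite E" and \<kappa>: "inj_on \<kappa> E" "\<And>e. e \<in> E \<Longrightarrow> \<kappa> e \<in> A"
    and z: "\<And>e. e \<in> E \<Longrightarrow> z e \<in> A"
  shows "\<exists>x. (\<forall>l<card E. x l \<in> A) \<and> (\<forall>e\<in>E. (\<Sum>l<card E. x l * \<kappa> e ^ l) = z e)"
proof -
  define n where "n = card E"
  let ?P = "PiE {..<n} (\<lambda>_. A)" and ?Q = "PiE E (\<lambda>_. A)"
  define f where "f x = (\<lambda>e\<in>E. \<Sum>l<n. x l * \<kappa> e ^ l)" for x :: "nat \<Rightarrow> 'a"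
  have sub: "f ` ?P \<subseteq> ?Q"
  proof (intro image_subsetI)
    fix x assume x: "x \<in> ?P"
    have "(\<Sum>l<n. x l * \<kappa> e ^ l) \<in> A" if "e \<in> E" for e
      using x \<kappa>(2)[OF that] by (intro sum_A mult_A power_A) auto
    then show "f x \<in> ?Q" by (simp add: f_def)
  qed
  have inj: "inj_on f ?P"
  proof (rule inj_onI)
    fix x x' assume x: "x \<in> ?P" "x' \<in> ?P" "f x = f x'"
    define g where "g m = (if m < n then x m - x' m else 0)" for m
    have "(\<Sum>m\<le>n - 1. g m * s ^ m) = 0" if s: "s \<in> \<kappa> ` E" for s
    proof -
      obtain e where e: "e \<in> E" "s = \<kappa> e" using s by blast
      have "n > 0" using e(1) E by (auto simp: n_def card_gt_0_iff)
      then have "{..n - 1} = {..<n}" by auto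
      then have "(\<Sum>m\<le>n - 1. g m * s ^ m) = (\<Sum>m<n. x m * s ^ m) - (\<Sum>m<n. x' m * s ^ m)"
        by (simp add: g_def left_diff_distrib sum_subtractf)
      also have "\<dots> = 0" using fun_cong[OF x(3), of e] e by (simp add: f_def)
      finally show ?thesis .
    qed
    then have "g m = 0" if "m < n" for m
      using all_zero_if_many_roots[of "n - 1" "\<kappa> ` E" g m] that card_image[OF \<kappa>(1)] by (simp add: n_def)
    then have eq: "x m = x' m" if "m < n" for m using that unfolding g_def by (metis right_minus_eq)
    show "x = x'" using x(1,2) eq by (intro PiE_ext[of x _ _ x']) auto
  qed
  have "card ?P = card ?Q" using E by (simp add: card_PiE n_def)
  then have "f ` ?P = ?Q"
    using sub inj finite_A E by (intro card_subset_eq) (auto simp: finite_PiE card_image)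
  moreover have "(\<lambda>e\<in>E. z e) \<in> ?Q" using z by simp
  ultimately obtain x where x: "x \<in> ?P" "(\<lambda>e\<in>E. z e) = f x" by (metis imageE)
  show ?thesis
  proof (intro exI[of _ x] conjI ballI allI impI)
    fix l assume "l < card E" then show "x l \<in> A" using x(1) by (auto simp: n_def)
  next
    fix e assume "e \<in> E"
    then show "(\<Sum>l<card E. x l * \<kappa> e ^ l) = z e" using fun_cong[OF x(2), of e] by (simp add: f_def n_def)
  qed
qed

text \<open>Fix all coefficients except those of the first \<open>card E\<close> powers in row
  \<open>w\<close>. For each \<open>j\<close> the exposed ones can be chosen to cancel the
  contribution of the others, so every fixed choice extends to a solution.\<close>

lemma card_coeffs_vanishing:
  assumes w: "w \<in> D \<times> D" and E: "finite E" "card E \<le> \<Lambda>"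
    and e: "\<And>e. e \<in> E \<Longrightarrow> e1 e \<in> VS \<and> e2 e \<in> VS" and inj: "inj_on (\<lambda>e. key w (e1 e) (e2 e)) E"
  shows "card A ^ card Idx \<le> card {c\<in>coeffs. \<forall>e\<in>E. \<forall>j<a. fval c j (e1 e) (e2 e) = 0} * card A ^ (a * card E)"
proof -
  define I1 where "I1 = (\<lambda>(j, l). (j, w, l)) ` ({..<a} \<times> {..<card E})"
  define Sol where "Sol = {c\<in>coeffs. \<forall>e\<in>E. \<forall>j<a. fval c j (e1 e) (e2 e) = 0}"
  let ?\<kappa> = "\<lambda>e. key w (e1 e) (e2 e)"
  have I1: "I1 \<subseteq> Idx" using w E by (auto simp: I1_def Idx_def)
  have cI1: "card I1 = a * card E"
    unfolding I1_def by (subst card_image) (auto simp: inj_on_def)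
  have "PiE (Idx - I1) (\<lambda>_. A) \<subseteq> (\<lambda>c. restrict c (Idx - I1)) ` Sol"
  proof
    fix c' assume c': "c' \<in> PiE (Idx - I1) (\<lambda>_. A)"
    define c0 where "c0 = (\<lambda>i. if i \<in> Idx - I1 then c' i else 0)"
    have c0A: "c0 i \<in> A" for i using c' zero_A by (auto simp: c0_def)
    have "\<forall>j. \<exists>x. (\<forall>l<card E. x l \<in> A) \<and> (\<forall>e\<in>E. (\<Sum>l<card E. x l * ?\<kappa> e ^ l) = - fval c0 j (e1 e) (e2 e))"
    proof (intro allI interpolation E inj)
      fix j e0 assume "e0 \<in> E"
      then have VS: "e1 e0 \<in> VS" "e2 e0 \<in> VS" using e by blast+
      show "key w (e1 e0) (e2 e0) \<in> A" by (rule key_A[OF w VS])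
      show "- fval c0 j (e1 e0) (e2 e0) \<in> A"
        unfolding fval_def by (intro uminus_A sum_A mult_A power_A key_A c0A VS)
    qed
    then obtain x where x: "\<And>j l. l < card E \<Longrightarrow> x j l \<in> A"
      "\<And>j e. e \<in> E \<Longrightarrow> (\<Sum>l<card E. x j l * ?\<kappa> e ^ l) = - fval c0 j (e1 e) (e2 e)" by metis
    define c where "c = (\<lambda>i\<in>Idx. if i \<in> I1 then x (fst i) (snd (snd i)) else c' i)"
    have cin: "c \<in> coeffs" unfolding coeffs_def
    proof (rule PiE_I)
      fix i assume "i \<in> Idx"
      then show "c i \<in> A" using c' x(1) by (auto simp: c_def I1_def)
    qed (simp add: c_def)
    have val: "fval c j (e1 e) (e2 e) = 0" if eE: "e \<in> E" and j: "j < a" for e j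
    proof -
      have "fval c j (e1 e) (e2 e) - fval c0 j (e1 e) (e2 e) =
          (\<Sum>w'\<in>D \<times> D. \<Sum>l<\<Lambda>. (c (j, w', l) - c0 (j, w', l)) * key w' (e1 e) (e2 e) ^ l)"
        by (simp add: fval_def left_diff_distrib sum_subtractf)
      also have "\<dots> = (\<Sum>w'\<in>D \<times> D. if w' = w then \<Sum>l<card E. x j l * ?\<kappa> e ^ l else 0)"
      proof (intro sum.cong refl)
        fix w' assume w': "w' \<in> D \<times> D"
        show "(\<Sum>l<\<Lambda>. (c (j, w', l) - c0 (j, w', l)) * key w' (e1 e) (e2 e) ^ l) =
            (if w' = w then \<Sum>l<card E. x j l * ?\<kappa> e ^ l else 0)"
        proof (cases "w' = w")
          case True
          have "(\<Sum>l<\<Lambda>. (c (j, w', l) - c0 (j, w', l)) * key w' (e1 e) (e2 e) ^ l) =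
              (\<Sum>l<\<Lambda>. if l < card E then x j l * ?\<kappa> e ^ l else 0)"
            using True j w by (intro sum.cong refl) (auto simp: c_def c0_def I1_def Idx_def)
          also have "\<dots> = (\<Sum>l<card E. x j l * ?\<kappa> e ^ l)"
          proof (rule sum.mono_neutral_cong_right)
            show "{..<card E} \<subseteq> {..<\<Lambda>}" using E(2) by auto
          qed auto
          finally show ?thesis using True by simp
        next
          case False
          then show ?thesis using j w' by (auto simp: c_def c0_def I1_def Idx_def intro!: sum.neutral)
        qed
      qed
      also have "\<dots> = (\<Sum>l<card E. x j l * ?\<kappa> e ^ l)" using w finite_D by (simp add: sum.delta)
      also have "\<dots> = - fval c0 j (e1 e) (e2 e)" using x(2)[OF eE] by simp
      finally show ?thesis by simp
    qed
    have "c \<in> Sol" using cin val by (simp add: Sol_def)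
    moreover have "restrict c (Idx - I1) = c'"
      using c' by (auto simp: c_def fun_eq_iff restrict_def PiE_iff extensional_def)
    ultimately show "c' \<in> (\<lambda>c. restrict c (Idx - I1)) ` Sol" by (metis image_eqI)
  qed
  then have "card (PiE (Idx - I1) (\<lambda>_. A)) \<le> card Sol"
    using finite_coeffs by (intro surj_card_le) (auto simp: Sol_def)
  then have le: "card A ^ card (Idx - I1) \<le> card Sol"
    using finite_Idx by (simp add: card_PiE)
  have "card Idx = card (Idx - I1) + a * card E"
    using card_Diff_subset[of I1 Idx] I1 finite_Idx card_mono[OF finite_Idx I1] cI1 finite_subset by fastforce
  then have "card A ^ card Idx = card A ^ card (Idx - I1) * card A ^ (a * card E)"
    by (simp add: power_add)
  also have "\<dots> \<le> card Sol * card A ^ (a * card E)" using le by (rule mult_le_mono1)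
  finally show ?thesis by (simp add: Sol_def)
qed

text \<open>With q = \<open>card A\<close>, a given \<open>t\<close>-set is a clique with
  probability at least q to the power -a(t choose 2), since one row separates all its pairs.\<close>

lemma card_coeffs_clique:
  assumes T: "T \<subseteq> VS" "card T = t" "t \<ge> 1" and \<Lambda>: "t choose 2 \<le> \<Lambda>" and D: "t ^ 2 * b + t ^ 4 < card D"
  shows "card A ^ card Idx \<le> card {c\<in>coeffs. T \<in> cliques t (host c)} * card A ^ (a * (t choose 2))"
proof -
  have finT: "finite T" using T card.infinite by fastforce
  obtain w where w: "w \<in> D \<times> D" "\<forall>u\<in>T. \<forall>v\<in>T. \<forall>u'\<in>T. \<forall>v'\<in>T. u \<noteq> v \<longrightarrow> u' \<noteq> v' \<longrightarrow>
     key w u v = key w u' v' \<longrightarrow> {u, v} = {u', v'}"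
    using ex_separating_key[OF finT T(1)] D T(2) by blast
  define E where "E = {e. e \<subseteq> T \<and> card e = 2}"
  have "\<forall>e\<in>E. \<exists>p. e = {fst p, snd p} \<and> fst p \<noteq> snd p"
    by (auto simp: E_def card_2_iff)
  then obtain p where p: "\<And>e. e \<in> E \<Longrightarrow> e = {fst (p e), snd (p e)} \<and> fst (p e) \<noteq> snd (p e)" by metis
  have pT: "fst (p e) \<in> T" "snd (p e) \<in> T" if "e \<in> E" for e
    using p[OF that] that unfolding E_def by blast+
  have cE: "card E = t choose 2" unfolding E_def using n_subsets[OF finT] T(2) by simp
  have finE: "finite E" using finT by (simp add: E_def)
  have inj: "inj_on (\<lambda>e. key w (fst (p e)) (snd (p e))) E"
  proof (rule inj_onI)
    fix e e' assume ee: "e \<in> E" "e' \<in> E" "key w (fst (p e)) (snd (p e)) = key w (fst (p e')) (snd (p e'))"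
    then have "{fst (p e), snd (p e)} = {fst (p e'), snd (p e')}"
      using w(2) pT p by meson
    then show "e = e'" using p ee(1,2) by metis
  qed
  have "{c\<in>coeffs. \<forall>e\<in>E. \<forall>j<a. fval c j (fst (p e)) (snd (p e)) = 0} \<subseteq> {c\<in>coeffs. T \<in> cliques t (host c)}"
  proof (intro subsetI CollectI conjI)
    fix c assume c: "c \<in> {c\<in>coeffs. \<forall>e\<in>E. \<forall>j<a. fval c j (fst (p e)) (snd (p e)) = 0}"
    then show "c \<in> coeffs" by simp
    have "{u, v} \<in> edges (host c)" if uv: "u \<in> T" "v \<in> T" "u \<noteq> v" for u v
    proof -
      have e: "{u, v} \<in> E" using uv by (simp add: E_def)
      then have "adj c (fst (p {u, v})) (snd (p {u, v}))" using c p[OF e] by (simp add: adj_def)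
      then have "{fst (p {u, v}), snd (p {u, v})} \<in> edges (host c)"
        using pT[OF e] T(1) unfolding host_def by auto
      then show ?thesis using p[OF e] by simp
    qed
    then show "T \<in> cliques t (host c)" using T by (simp add: cliques_def host_def)
  qed
  then have "card {c\<in>coeffs. \<forall>e\<in>E. \<forall>j<a. fval c j (fst (p e)) (snd (p e)) = 0} \<le> card {c\<in>coeffs. T \<in> cliques t (host c)}"
    using finite_coeffs by (intro card_mono) auto
  moreover have "card A ^ card Idx \<le> card {c\<in>coeffs. \<forall>e\<in>E. \<forall>j<a. fval c j (fst (p e)) (snd (p e)) = 0} * card A ^ (a * card E)"
    by (rule card_coeffs_vanishing[OF w(1) finE _ _ inj]) (use cE \<Lambda> pT T(1) in auto)
  ultimately show ?thesis unfolding cE by (meson le_trans mult_le_mono1)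
qed

lemma sum_card_cliques:
  assumes "t \<ge> 1" "t choose 2 \<le> \<Lambda>" "t ^ 2 * b + t ^ 4 < card D"
  shows "(card A ^ b choose t) * card A ^ card Idx \<le> (\<Sum>c\<in>coeffs. card (cliques t (host c))) * card A ^ (a * (t choose 2))"
proof -
  define \<T> where "\<T> = {T. T \<subseteq> VS \<and> card T = t}"
  have fin: "finite \<T>" using finite_VS by (simp add: \<T>_def)
  have "(card A ^ b choose t) * card A ^ card Idx = (\<Sum>T\<in>\<T>. card A ^ card Idx)"
    using n_subsets[OF finite_VS] by (simp add: \<T>_def card_VS)
  also have "\<dots> \<le> (\<Sum>T\<in>\<T>. card {c\<in>coeffs. T \<in> cliques t (host c)} * card A ^ (a * (t choose 2)))"
    using assms by (intro sum_mono card_coeffs_clique) (auto simp: \<T>_def)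
  also have "\<dots> = (\<Sum>T\<in>\<T>. card {c\<in>coeffs. T \<in> cliques t (host c)}) * card A ^ (a * (t choose 2))"
    by (simp add: sum_distrib_right)
  also have "(\<Sum>T\<in>\<T>. card {c\<in>coeffs. T \<in> cliques t (host c)}) = (\<Sum>c\<in>coeffs. card {T\<in>\<T>. T \<in> cliques t (host c)})"
    by (rule sum_multicount_gen[OF fin finite_coeffs]) simp
  also have "\<dots> = (\<Sum>c\<in>coeffs. card (cliques t (host c)))"
    by (intro sum.cong refl arg_cong[of _ _ card]) (auto simp: \<T>_def cliques_def host_def)
  finally show ?thesis .
qed

text \<open>\<open>\<psi>\<close> is defined on all of \<open>{..<M}\<close>, so whatever the shape
  there are \<open>card A ^ (b * M)\<close> placements. This is the loss that \<open>K\<close> has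
  to make up for.\<close>

definition bad_index :: "nat \<Rightarrow> (nat set \<times> (nat \<times> nat) set \<times> (nat \<Rightarrow> nat \<Rightarrow> 'a) \<times> nat \<times> nat \<times> ('a \<times> 'a)) set" where
  "bad_index M = {(U, Es, \<psi>, u0, i0, w). U \<subseteq> {..<M} \<and> Es \<subseteq> {..<M} \<times> {..<M} \<and> \<psi> \<in> PiE {..<M} (\<lambda>_. VS) \<and>
     u0 \<in> U \<and> i0 < b \<and> w \<in> D \<times> D \<and> b * card U \<le> a * card Es}"

definition bad_coeffs :: "nat \<Rightarrow> nat \<Rightarrow> (nat \<times> ('a \<times> 'a) \<times> nat \<Rightarrow> 'a) set" where
  "bad_coeffs M m = {c\<in>coeffs. \<exists>(U, Es, \<psi>, u0, i0, w)\<in>bad_index M. \<exists>Y. many_petals w U Es \<psi> u0 i0 m c Y}"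

lemma card_bad_index:
  "finite (bad_index M)" "card (bad_index M) \<le> 2 ^ M * (2 ^ (M * M) * (card A ^ (b * M) * (M * (b * card D ^ 2))))"
proof -
  let ?B = "Pow {..<M} \<times> Pow ({..<M} \<times> {..<M}) \<times> PiE {..<M} (\<lambda>_. VS) \<times> {..<M} \<times> {..<b} \<times> (D \<times> D)"
  have sub: "bad_index M \<subseteq> ?B" unfolding bad_index_def by auto
  have fin: "finite ?B" using finite_VS finite_D by (simp add: finite_PiE)
  show "finite (bad_index M)" using sub fin by (rule finite_subset)
  have "card (bad_index M) \<le> card ?B" by (rule card_mono[OF fin sub])
  also have "\<dots> = 2 ^ M * (2 ^ (M * M) * (card A ^ (b * M) * (M * (b * card D ^ 2))))"
    by (simp add: card_cartesian_product card_Pow card_PiE card_VS power_mult power2_eq_square)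
  finally show "card (bad_index M) \<le> 2 ^ M * (2 ^ (M * M) * (card A ^ (b * M) * (M * (b * card D ^ 2))))" .
qed

text \<open>Condition on all rows but \<open>w\<close> and apply \<open>card_many_petals\<close> to
  the remaining one. Up to a constant, the proportion of bad vectors is at most
  \<open>card A\<close> to the power 1 - K.\<close>

lemma card_bad_single:
  fixes K M :: nat
  defines "\<rho> \<equiv> dep_degree (a * \<Lambda>) (param_degree \<Lambda>)"
  assumes ix: "(U, Es, \<psi>, u0, i0, w) \<in> bad_index M" and \<Lambda>: "K * (M * M) \<le> \<Lambda>" and K: "K \<le> a * \<Lambda> + 2"
  shows "card {c\<in>coeffs. \<exists>Y. many_petals w U Es \<psi> u0 i0 (K * (\<rho> + 1)) c Y} * card A ^ K
     \<le> (\<rho> + 2) ^ (a * \<Lambda>) * card A ^ (card Idx + 1)"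
proof -
  let ?P = "\<lambda>c. \<exists>Y. many_petals w U Es \<psi> u0 i0 (K * (\<rho> + 1)) c Y"
  define J where "J = {..<a} \<times> {..<\<Lambda>}"
  define I1 where "I1 = (\<lambda>(j, l). (j, w, l)) ` J"
  define N where "N = a * \<Lambda>"
  have U: "U \<subseteq> {..<M}" and Es: "Es \<subseteq> {..<M} \<times> {..<M}" and \<psi>: "\<psi> \<in> PiE {..<M} (\<lambda>_. VS)"
    and u0: "u0 \<in> U" "i0 < b" and w: "w \<in> D \<times> D" and dens: "b * card U \<le> a * card Es"
    using ix unfolding bad_index_def by auto
  have finU: "finite U" and finEs: "finite Es" using finite_subset[OF U] finite_subset[OF Es] by auto
  have "card Es \<le> M * M" using card_mono[OF _ Es] by (simp add: card_cartesian_product)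
  then have KE: "K * card Es \<le> \<Lambda>" using \<Lambda> by (meson le_trans mult_le_mono2)
  have I1: "I1 \<subseteq> Idx" using w by (auto simp: I1_def Idx_def J_def)
  have cI1: "card I1 = N"
    unfolding I1_def J_def N_def by (subst card_image) (auto simp: inj_on_def)
  let ?R = "PiE (Idx - I1) (\<lambda>_. A)"
  let ?Q = "\<lambda>r. {c\<in>coeffs. ?P c \<and> restrict c (Idx - I1) = r}"
  have Q: "card (?Q r) * card A \<le> (\<rho> + 2) ^ N * card A ^ (N + 2 - K)" if r: "r \<in> ?R" for r
  proof -
    define r' where "r' = (\<lambda>i. if i \<in> Idx - I1 then r i else 0)"
    have r'A: "r' i \<in> A" for i using r zero_A by (auto simp: r'_def)
    let ?C = "{c1 \<in> PiE J (\<lambda>_. A). ?P (with_row w c1 r')}"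
    let ?g = "\<lambda>c. (\<lambda>(j, l)\<in>J. c (j, w, l))"
    have inj: "inj_on ?g (?Q r)"
    proof (rule inj_onI)
      fix c c' assume c: "c \<in> ?Q r" "c' \<in> ?Q r" "?g c = ?g c'"
      show "c = c'"
      proof (rule PiE_ext[of c Idx "\<lambda>_. A" c'])
        show "c \<in> PiE Idx (\<lambda>_. A)" "c' \<in> PiE Idx (\<lambda>_. A)" using c by (simp_all add: coeffs_def)
        fix i assume i: "i \<in> Idx"
        show "c i = c' i"
        proof (cases "i \<in> I1")
          case True
          then obtain j l where jl: "i = (j, w, l)" "(j, l) \<in> J" by (auto simp: I1_def)
          then show ?thesis using fun_cong[OF c(3), of "(j, l)"] by simp
        next
          case False
          have "restrict c (Idx - I1) = restrict c' (Idx - I1)" using c by simp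
          from fun_cong[OF this, of i] show ?thesis using False i by simp
        qed
      qed
    qed
    have im: "?g ` ?Q r \<subseteq> ?C"
    proof (rule image_subsetI)
      fix c assume c: "c \<in> ?Q r"
      have cA: "c \<in> PiE Idx (\<lambda>_. A)" using c by (simp add: coeffs_def)
      have "c (j, w, l) \<in> A" if "(j, l) \<in> J" for j l
        using cA that w by (intro PiE_mem[OF cA]) (auto simp: Idx_def J_def)
      then have g: "?g c \<in> PiE J (\<lambda>_. A)" by auto
      have rc: "r' i = c i" if "i \<in> Idx - I1" for i
      proof -
        have "restrict c (Idx - I1) = r" using c by simp
        from fun_cong[OF this, of i] show ?thesis using that by (simp add: r'_def)
      qed
      have fv: "fval (with_row w (?g c) r') j u v = fval c j u v" if j: "j < a" for j u v
        unfolding fval_def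
      proof (intro sum.cong refl)
        fix w' l assume wl: "w' \<in> D \<times> D" "l \<in> {..<\<Lambda>}"
        have "with_row w (?g c) r' (j, w', l) = c (j, w', l)"
        proof (cases "w' = w")
          case True
          then show ?thesis using j wl by (simp add: with_row_def J_def)
        next
          case False
          then have "(j, w', l) \<in> Idx - I1" using j wl by (auto simp: Idx_def I1_def)
          then show ?thesis using False rc by (simp add: with_row_def)
        qed
        then show "with_row w (?g c) r' (j, w', l) * key w' u v ^ l = c (j, w', l) * key w' u v ^ l" by simp
      qed
      have "?P c" using c by simp
      then obtain Y where "many_petals w U Es \<psi> u0 i0 (K * (\<rho> + 1)) c Y" by blast
      then have "many_petals w U Es \<psi> u0 i0 (K * (\<rho> + 1)) (with_row w (?g c) r') Y"
        unfolding many_petals_def using fv by simp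
      then have "?P (with_row w (?g c) r')" by blast
      then show "?g c \<in> ?C" using g by simp
    qed
    have finC: "finite ?C" using finite_A by (simp add: J_def finite_PiE)
    have "card (?Q r) \<le> card ?C" by (rule card_inj_on_le[OF inj im finC])
    moreover have "card ?C * card A \<le> (\<rho> + 2) ^ N * card A ^ (N + 2 - K)"
      unfolding J_def N_def \<rho>_def
    proof (rule card_many_petals[OF w finU finEs _ dens KE _ u0])
      show "K \<le> a * \<Lambda> + 2" by (rule K)
      show "\<forall>x\<in>{fst e, snd e}. x \<in> U \<or> \<psi> x \<in> VS" if "e \<in> Es" for e
        using that Es \<psi> by (auto simp: PiE_iff)
      show "r' (j, w', l) \<in> A" for j w' l by (rule r'A)
    qed
    ultimately show ?thesis by (meson le_trans mult_le_mono1)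
  qed
  let ?S = "{c\<in>coeffs. ?P c}"
  have q: "card A > 0" using card_A_ge by simp
  have finR: "finite ?R" using finite_Idx finite_A by (simp add: finite_PiE)
  have "?S \<subseteq> (\<Union>r\<in>?R. ?Q r)"
  proof
    fix c assume c: "c \<in> ?S"
    then have "restrict c (Idx - I1) \<in> ?R" by (auto simp: coeffs_def)
    then show "c \<in> (\<Union>r\<in>?R. ?Q r)" using c by (intro UN_I[of "restrict c (Idx - I1)"]) simp_all
  qed
  moreover have "finite (\<Union>r\<in>?R. ?Q r)" using finR finite_coeffs by simp
  ultimately have "card ?S \<le> card (\<Union>r\<in>?R. ?Q r)" by (intro card_mono)
  also have "\<dots> \<le> (\<Sum>r\<in>?R. card (?Q r))" by (rule card_UN_le[OF finR])
  finally have "card ?S * card A \<le> (\<Sum>r\<in>?R. card (?Q r)) * card A" by (rule mult_le_mono1)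
  also have "\<dots> = (\<Sum>r\<in>?R. card (?Q r) * card A)" by (rule sum_distrib_right)
  also have "\<dots> \<le> (\<Sum>r\<in>?R. (\<rho> + 2) ^ N * card A ^ (N + 2 - K))" by (rule sum_mono[OF Q])
  also have "\<dots> = card A ^ card (Idx - I1) * ((\<rho> + 2) ^ N * card A ^ (N + 2 - K))"
    using finite_Idx by (simp add: card_PiE)
  finally have "card ?S * card A * card A ^ K \<le> card A ^ card (Idx - I1) * ((\<rho> + 2) ^ N * card A ^ (N + 2 - K)) * card A ^ K"
    by (rule mult_le_mono1)
  also have "\<dots> = (\<rho> + 2) ^ N * (card A ^ card (Idx - I1) * (card A ^ (N + 2 - K) * card A ^ K))"
    by (simp only: mult_ac)
  also have "card A ^ (N + 2 - K) * card A ^ K = card A ^ (N + 2)"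
    using K by (simp add: power_add[symmetric] N_def)
  also have "card A ^ card (Idx - I1) * card A ^ (N + 2) = card A ^ (card Idx + 2)"
  proof -
    have "finite I1" using I1 finite_Idx finite_subset by blast
    then have "card Idx = card (Idx - I1) + N"
      using card_Diff_subset[of I1 Idx] I1 card_mono[OF finite_Idx I1] cI1 by simp
    then show ?thesis by (simp add: power_add[symmetric])
  qed
  finally have "card A * (card ?S * card A ^ K) \<le> card A * ((\<rho> + 2) ^ N * card A ^ (card Idx + 1))"
    by (simp add: mult_ac)
  then show ?thesis using q by (simp add: N_def)
qed

lemma card_bad_coeffs:
  fixes K M :: nat
  defines "\<rho> \<equiv> dep_degree (a * \<Lambda>) (param_degree \<Lambda>)"
  assumes \<Lambda>: "K * (M * M) \<le> \<Lambda>" and K: "K \<le> a * \<Lambda> + 2"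
  shows "card (bad_coeffs M (K * (\<rho> + 1))) * card A ^ K
     \<le> 2 ^ M * (2 ^ (M * M) * (card A ^ (b * M) * (M * (b * card D ^ 2)))) * ((\<rho> + 2) ^ (a * \<Lambda>) * card A ^ (card Idx + 1))"
proof -
  define Q where "Q = (\<lambda>(U, Es, \<psi>, u0, i0, w). {c\<in>coeffs. \<exists>Y. many_petals w U Es \<psi> u0 i0 (K * (\<rho> + 1)) c Y})"
  let ?m = "(\<rho> + 2) ^ (a * \<Lambda>) * card A ^ (card Idx + 1)"
  have Qb: "card (Q x) * card A ^ K \<le> ?m" if x: "x \<in> bad_index M" for x
  proof -
    obtain U Es \<psi> u0 i0 w where eq: "x = (U, Es, \<psi>, u0, i0, w)" by (metis prod.exhaust_sel)
    show ?thesis using card_bad_single[OF x[unfolded eq] \<Lambda> K] by (simp add: eq Q_def \<rho>_def)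
  qed
  have "bad_coeffs M (K * (\<rho> + 1)) \<subseteq> (\<Union>x\<in>bad_index M. Q x)"
    unfolding bad_coeffs_def Q_def by fastforce
  moreover have "finite (\<Union>x\<in>bad_index M. Q x)"
    using card_bad_index(1) finite_coeffs by (auto simp: Q_def)
  ultimately have "card (bad_coeffs M (K * (\<rho> + 1))) \<le> card (\<Union>x\<in>bad_index M. Q x)" by (intro card_mono)
  also have "\<dots> \<le> (\<Sum>x\<in>bad_index M. card (Q x))" by (rule card_UN_le[OF card_bad_index(1)])
  finally have "card (bad_coeffs M (K * (\<rho> + 1))) * card A ^ K \<le> (\<Sum>x\<in>bad_index M. card (Q x)) * card A ^ K"
    by (rule mult_le_mono1)
  also have "\<dots> = (\<Sum>x\<in>bad_index M. card (Q x) * card A ^ K)" by (rule sum_distrib_right)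
  also have "\<dots> \<le> (\<Sum>x\<in>bad_index M. ?m)" by (rule sum_mono[OF Qb])
  also have "\<dots> = card (bad_index M) * ?m" by simp
  also have "\<dots> \<le> 2 ^ M * (2 ^ (M * M) * (card A ^ (b * M) * (M * (b * card D ^ 2)))) * ?m"
    by (rule mult_le_mono1[OF card_bad_index(2)])
  finally show ?thesis .
qed

text \<open>Many rooted embeddings contain a sunflower, whose kernel joins the roots; among its petals,
  many differ in a fixed coordinate of a fixed vertex.\<close>

lemma card_rooted_embeddings_host:
  fixes M m :: nat
  assumes c: "c \<in> coeffs" "c \<notin> bad_coeffs M m" and D: "(m * M) ^ 2 * b + (m * M) ^ 4 < card D"
    and ab: "a > 0" "b > 0"
    and F: "simple_graph F" "verts F \<subseteq> {..<M}" "R \<subseteq> verts F" and dense: "dense_over (of_nat b / of_nat a) F R"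
  shows "card (rooted_embeddings F R (host c) \<psi>) \<le> (\<Sum>n\<le>M. sunflower_bound (m ^ b + 1) n)"
proof (rule ccontr)
  assume neg: "\<not> ?thesis"
  define U where "U = verts F - R"
  define \<Phi> where "\<Phi> = rooted_embeddings F R (host c) \<psi>"
  have finF: "finite (verts F)" using F(1) by (simp add: simple_graph_def)
  have finU: "finite U" using finF by (simp add: U_def)
  have emb: "\<phi> \<in> extensional (verts F)" "\<phi> ` verts F \<subseteq> VS" "inj_on \<phi> (verts F)" "\<forall>e\<in>edges F. \<phi> ` e \<in> edges (host c)"
    "\<forall>r\<in>R. \<phi> r = \<psi> r" if "\<phi> \<in> \<Phi>" for \<phi>
    using that by (simp_all add: \<Phi>_def rooted_embeddings_def embeddings_def host_def)
  have fin\<Phi>: "finite \<Phi>"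
  proof (rule finite_subset)
    show "\<Phi> \<subseteq> PiE (verts F) (\<lambda>_. VS)"
    proof
      fix \<phi> assume "\<phi> \<in> \<Phi>"
      from emb(1,2)[OF this] show "\<phi> \<in> PiE (verts F) (\<lambda>_. VS)" by (auto simp: PiE_iff)
    qed
    show "finite (PiE (verts F) (\<lambda>_. VS))" using finF finite_VS by (simp add: finite_PiE)
  qed
  define r where "r = (\<lambda>\<phi> :: nat \<Rightarrow> nat \<Rightarrow> 'a. restrict \<phi> U)"
  have inj_r: "inj_on r \<Phi>"
  proof (rule inj_onI)
    fix \<phi> \<phi>' assume ph: "\<phi> \<in> \<Phi>" "\<phi>' \<in> \<Phi>" "r \<phi> = r \<phi>'"
    show "\<phi> = \<phi>'"
    proof (rule extensionalityI[OF emb(1)[OF ph(1)] emb(1)[OF ph(2)]])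
      fix x assume x: "x \<in> verts F"
      show "\<phi> x = \<phi>' x"
      proof (cases "x \<in> R")
        case True
        then show ?thesis using emb(5)[OF ph(1)] emb(5)[OF ph(2)] by simp
      next
        case False
        then show ?thesis using fun_cong[OF ph(3), of x] x by (simp add: r_def U_def)
      qed
    qed
  qed
  have "card U \<le> M"
    using card_mono[of "{..<M}" U] F(2) by (auto simp: U_def)
  then have "sunflower_bound (m ^ b + 1) (card U) \<le> (\<Sum>n\<le>M. sunflower_bound (m ^ b + 1) n)"
    by (intro member_le_sum) auto
  also have "\<dots> < card (r ` \<Phi>)" using neg card_image[OF inj_r] by (simp add: \<Phi>_def)
  finally have "card (r ` \<Phi>) > sunflower_bound (m ^ b + 1) (card U)" .
  moreover have "r ` \<Phi> \<subseteq> extensional U" by (auto simp: r_def)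
  ultimately obtain Z \<zeta> Y where Z: "Z \<subseteq> U" "Z \<noteq> U" "Y \<subseteq> r ` \<Phi>" "card Y = m ^ b + 1"
    "\<forall>y\<in>Y. \<forall>u\<in>Z. y u = \<zeta> u" "disjoint_outside (U - Z) Y"
    using sunflower_maps[OF finU, of "r ` \<Phi>" "m ^ b + 1"] fin\<Phi> by (metis finite_imageI)
  define U' where "U' = U - Z"
  obtain u0 where u0: "u0 \<in> U'" using Z(1,2) unfolding U'_def by blast
  have finY: "finite Y" using Z(3) fin\<Phi> finite_subset by blast
  \<comment> \<open>The images of \<open>u0\<close> are pairwise distinct; if every coordinate took
    at most \<open>m\<close> values, there would be at most \<open>m ^ b\<close> petals.\<close>
  have "\<exists>i0<b. m < card ((\<lambda>y. y u0 i0) ` Y)"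
  proof (rule ccontr)
    assume no: "\<not> ?thesis"
    have inj: "inj_on (\<lambda>y. y u0) Y"
    proof (rule inj_onI, rule ccontr)
      fix y y' assume "y \<in> Y" "y' \<in> Y" "y u0 = y' u0" "y \<noteq> y'"
      then show False using Z(6) u0 unfolding disjoint_outside_def U'_def by metis
    qed
    have "(\<lambda>y. y u0) ` Y \<subseteq> PiE {..<b} (\<lambda>i. (\<lambda>y. y u0 i) ` Y)"
    proof (rule image_subsetI)
      fix y assume y: "y \<in> Y"
      obtain \<phi> where \<phi>: "\<phi> \<in> \<Phi>" "y = r \<phi>" using Z(3) y by blast
      have "y u0 = \<phi> u0" using u0 by (simp add: \<phi>(2) r_def U'_def)
      also have "\<phi> u0 \<in> VS" using emb(2)[OF \<phi>(1)] u0 by (auto simp: U'_def U_def)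
      finally have "y u0 \<in> extensional {..<b}" by (simp add: VS_def PiE_iff)
      then show "y u0 \<in> PiE {..<b} (\<lambda>i. (\<lambda>y. y u0 i) ` Y)" using y by (simp add: PiE_iff)
    qed
    then have "card ((\<lambda>y. y u0) ` Y) \<le> card (PiE {..<b} (\<lambda>i. (\<lambda>y. y u0 i) ` Y))"
      using finY by (intro card_mono finite_PiE) auto
    also have "\<dots> = (\<Prod>i<b. card ((\<lambda>y. y u0 i) ` Y))" by (simp add: card_PiE)
    also have "\<dots> \<le> (\<Prod>i<b. m)" 
    proof (intro prod_mono conjI)
      fix i assume "i \<in> {..<b}"
      then show "card ((\<lambda>y. y u0 i) ` Y) \<le> m" using no not_less by blast
    qed simp
    also have "\<dots> = m ^ b" by simp
    finally show False using card_image[OF inj] Z(4) by simp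
  qed
  then obtain i0 where i0: "i0 < b" "m < card ((\<lambda>y. y u0 i0) ` Y)" by blast
  obtain V where V: "V \<subseteq> (\<lambda>y. y u0 i0) ` Y" "card V = m"
    using i0(2) obtain_subset_with_card_n by (metis less_imp_le)
  have finV: "finite V" using V(1) finY finite_subset by blast
  obtain vs where vs: "bij_betw vs {..<m} V"
    using ex_bij_betw_nat_finite[OF finV] V(2) by (auto simp: atLeast0LessThan)
  have "\<forall>s. \<exists>\<phi>. s < m \<longrightarrow> \<phi> \<in> \<Phi> \<and> r \<phi> \<in> Y \<and> \<phi> u0 i0 = vs s"
  proof
    fix s
    show "\<exists>\<phi>. s < m \<longrightarrow> \<phi> \<in> \<Phi> \<and> r \<phi> \<in> Y \<and> \<phi> u0 i0 = vs s"
    proof (cases "s < m")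
      case True
      then have "vs s \<in> V" using vs by (auto simp: bij_betw_def)
      then obtain y where y: "y \<in> Y" "vs s = y u0 i0" using V(1) by blast
      obtain \<phi> where \<phi>: "\<phi> \<in> \<Phi>" "y = r \<phi>" using Z(3) y(1) by blast
      have "y u0 = \<phi> u0" using u0 by (simp add: \<phi>(2) r_def U'_def)
      then show ?thesis using y \<phi> by (intro exI[of _ \<phi>]) simp
    qed simp
  qed
  then obtain \<phi> where \<phi>: "\<And>s. s < m \<Longrightarrow> \<phi> s \<in> \<Phi>" "\<And>s. s < m \<Longrightarrow> r (\<phi> s) \<in> Y" "\<And>s. s < m \<Longrightarrow> \<phi> s u0 i0 = vs s"
    by metis
  obtain y0 where "y0 \<in> Y" using Z(4) by fastforce
  then obtain \<phi>0 where \<phi>0: "\<phi>0 \<in> \<Phi>" "r \<phi>0 \<in> Y" using Z(3) by blast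
  have u0F: "u0 \<in> verts F" using u0 by (simp add: U'_def U_def)
  \<comment> \<open>Roots and kernel are placed by \<open>\<phi>0\<close>. Off the vertices of
    \<open>F\<close> any vertex of the host serves as a default, because \<open>bad_index\<close>
    expects a total placement.\<close>
  define \<psi>' where "\<psi>' = (\<lambda>x\<in>{..<M}. if x \<in> verts F then \<phi>0 x else \<phi>0 u0)"
  have \<psi>': "\<psi>' \<in> PiE {..<M} (\<lambda>_. VS)"
    using emb(2)[OF \<phi>0(1)] u0F by (auto simp: \<psi>'_def)
  have agree: "\<phi> s x = \<phi>0 x" if s: "s < m" and x: "x \<in> verts F" "x \<notin> U'" for s x
  proof (cases "x \<in> R")
    case True
    then show ?thesis using emb(5)[OF \<phi>0(1)] emb(5)[OF \<phi>(1)[OF s]] by simp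
  next
    case False
    then have "x \<in> Z" "x \<in> U" using x by (auto simp: U'_def U_def)
    then have "r (\<phi> s) x = r \<phi>0 x" using Z(5) \<phi>0(2) \<phi>(2)[OF s] by simp
    then show ?thesis using \<open>x \<in> U\<close> by (simp add: r_def)
  qed
  have place: "place U' \<psi>' (\<phi> s) x = \<phi> s x" if "s < m" "x \<in> verts F" for s x
    using agree[OF that] that F(2) by (auto simp: place_def \<psi>'_def)
  \<comment> \<open>Ordered endpoints list each edge once, so \<open>card Es\<close> is the count to
    which density applies. Edges between roots and kernel vertices are left out, since their images
    coincide for all petals.\<close>
  define Es where "Es = {(x, y). x < y \<and> {x, y} \<in> edges F \<and> (x \<in> U' \<or> y \<in> U')}"
  have EsF: "x \<in> verts F" "y \<in> verts F" "x < y" "{x, y} \<in> edges F" "x \<in> U' \<or> y \<in> U'" if "(x, y) \<in> Es" for x y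
    using that F(1) by (auto simp: Es_def simple_graph_def)
  have Es_sub: "Es \<subseteq> {..<M} \<times> {..<M}"
  proof (rule subrelI)
    fix x y assume "(x, y) \<in> Es"
    then show "(x, y) \<in> {..<M} \<times> {..<M}" using EsF(1,2) F(2) by blast
  qed
  have cE: "card {e\<in>edges F. e \<inter> U' \<noteq> {}} = card Es"
  proof -
    have "bij_betw (\<lambda>(x, y). {x, y}) Es {e\<in>edges F. e \<inter> U' \<noteq> {}}"
      unfolding bij_betw_def
    proof
      show "inj_on (\<lambda>(x, y). {x, y}) Es"
        by (rule inj_onI) (auto simp: Es_def doubleton_eq_iff)
      show "(\<lambda>(x, y). {x, y}) ` Es = {e\<in>edges F. e \<inter> U' \<noteq> {}}"
      proof
        show "{e\<in>edges F. e \<inter> U' \<noteq> {}} \<subseteq> (\<lambda>(x, y). {x, y}) ` Es"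
        proof
          fix e assume e: "e \<in> {e\<in>edges F. e \<inter> U' \<noteq> {}}"
          then have "card e = 2" using F(1) by (simp add: simple_graph_def)
          then obtain x y where xy: "e = {x, y}" "x < y"
            by (metis card_2_iff insert_commute linorder_less_linear)
          then have "(x, y) \<in> Es" using e by (auto simp: Es_def)
          then show "e \<in> (\<lambda>(x, y). {x, y}) ` Es" using xy(1) by (intro image_eqI[of _ _ "(x, y)"]) auto
        qed
      qed (auto simp: Es_def)
    qed
    then show ?thesis by (simp add: bij_betw_same_card)
  qed
  have "U' \<subseteq> verts F - R" by (auto simp: U'_def U_def)
  from dense[unfolded dense_over_def, rule_format, OF this]
  have "(of_nat b / of_nat a :: rat) * of_nat (card U') \<le> of_nat (card Es)"
    by (simp only: cE)
  then have "(of_nat (b * card U') :: rat) \<le> of_nat (a * card Es)"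
    using ab by (simp add: field_simps)
  then have dens: "b * card U' \<le> a * card Es" by (simp only: of_nat_le_iff)
  define P where "P = (\<Union>s<m. \<phi> s ` verts F)"
  have P: "finite P" "P \<subseteq> VS"
    using finF emb(2)[OF \<phi>(1)] by (auto simp: P_def)
  have "card P \<le> (\<Sum>s<m. card (\<phi> s ` verts F))" unfolding P_def by (rule card_UN_le) simp
  also have "\<dots> \<le> (\<Sum>s<m. M)"
  proof (rule sum_mono)
    fix s
    have "card (verts F) \<le> M" using card_mono[OF _ F(2)] by simp
    then show "card (\<phi> s ` verts F) \<le> M" using card_image_le[OF finF, of "\<phi> s"] by linarith
  qed
  finally have "card P \<le> m * M" by simp
  then have "card P ^ 2 * b + card P ^ 4 \<le> (m * M) ^ 2 * b + (m * M) ^ 4"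
    by (intro add_mono mult_le_mono1 power_mono) auto
  then have "card P ^ 2 * b + card P ^ 4 < card D" using D by (rule le_less_trans)
  from ex_separating_key[OF P this] obtain w where w: "w \<in> D \<times> D"
    "\<forall>u\<in>P. \<forall>v\<in>P. \<forall>u'\<in>P. \<forall>v'\<in>P. u \<noteq> v \<longrightarrow> u' \<noteq> v' \<longrightarrow>
     key w u v = key w u' v' \<longrightarrow> {u, v} = {u', v'}" by (elim bexE)
  have inP: "\<phi> s x \<in> P" if "s < m" "x \<in> verts F" for s x using that by (auto simp: P_def)
  have "many_petals w U' Es \<psi>' u0 i0 m c \<phi>"
    unfolding many_petals_def
  proof (intro conjI allI impI ballI)
    fix s u assume "s < m" "u \<in> U'"
    then show "\<phi> s u \<in> VS" using emb(2)[OF \<phi>(1)] by (auto simp: U'_def U_def)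
  next
    show "inj_on (\<lambda>s. \<phi> s u0 i0) {..<m}"
      using vs \<phi>(3) by (auto simp: bij_betw_def inj_on_def)
  next
    show "inj_on (\<lambda>(s, e). key w (place U' \<psi>' (\<phi> s) (fst e)) (place U' \<psi>' (\<phi> s) (snd e))) ({..<m} \<times> Es)"
    proof (rule inj_onI)
      fix p p'
      assume pp: "p \<in> {..<m} \<times> Es" "p' \<in> {..<m} \<times> Es"
        "(\<lambda>(s, e). key w (place U' \<psi>' (\<phi> s) (fst e)) (place U' \<psi>' (\<phi> s) (snd e))) p =
         (\<lambda>(s, e). key w (place U' \<psi>' (\<phi> s) (fst e)) (place U' \<psi>' (\<phi> s) (snd e))) p'"
      obtain s x y where p: "p = (s, x, y)" by (metis prod.exhaust_sel)
      obtain s' x' y' where p': "p' = (s', x', y')" by (metis prod.exhaust_sel)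
      have st: "s \<in> {..<m}" "s' \<in> {..<m}" and E: "(x, y) \<in> Es" "(x', y') \<in> Es"
        using pp(1,2) by (simp_all add: p p')
      have k: "key w (place U' \<psi>' (\<phi> s) x) (place U' \<psi>' (\<phi> s) y) =
          key w (place U' \<psi>' (\<phi> s') x') (place U' \<psi>' (\<phi> s') y')"
        using pp(3) by (simp add: p p')
      have s: "s < m" "s' < m" using st by auto
      note xF = EsF[OF E(1)] and yF = EsF[OF E(2)]
      have inj: "inj_on (\<phi> s) (verts F)" "inj_on (\<phi> s') (verts F)"
        using emb(3)[OF \<phi>(1)] s by blast+
      have ne: "\<phi> s x \<noteq> \<phi> s y" "\<phi> s' x' \<noteq> \<phi> s' y'"
        using inj_onD[OF inj(1), of x y] inj_onD[OF inj(2), of x' y'] xF yF by auto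
      have "key w (\<phi> s x) (\<phi> s y) = key w (\<phi> s' x') (\<phi> s' y')"
        using k place s xF yF by simp
      then have eq: "{\<phi> s x, \<phi> s y} = {\<phi> s' x', \<phi> s' y'}"
        using w(2)[rule_format, OF inP[OF s(1) xF(1)] inP[OF s(1) xF(2)] inP[OF s(2) yF(1)] inP[OF s(2) yF(2)] ne]
        by blast
      \<comment> \<open>A listed edge has an endpoint in its petal. If two petals had the same image
        of an edge, this endpoint would land in the other petal, against disjointness, or on a
        common root or kernel vertex, against injectivity.\<close>
      have ss: "s = s'"
      proof (rule ccontr)
        assume "s \<noteq> s'"
        then have "\<phi> s u0 i0 \<noteq> \<phi> s' u0 i0" using vs \<phi>(3) s by (auto simp: bij_betw_def inj_on_def)
        then have "r (\<phi> s) u0 \<noteq> r (\<phi> s') u0" using u0 by (auto simp: r_def U'_def)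
        then have rne: "r (\<phi> s) \<noteq> r (\<phi> s')" by metis
        obtain z where z: "z \<in> U'" "z = x \<or> z = y" using xF(5) by blast
        then have "\<phi> s z \<in> {\<phi> s' x', \<phi> s' y'}" using eq by blast
        then obtain z' where z': "z' \<in> verts F" "\<phi> s z = \<phi> s' z'" using yF by blast
        have zF: "z \<in> verts F" using z xF by blast
        show False
        proof (cases "z' \<in> U'")
          case True
          have "r (\<phi> s) z \<noteq> r (\<phi> s') z'"
            using Z(6) \<phi>(2) s rne z(1) True unfolding disjoint_outside_def U'_def by blast
          then show False using z(1) True z'(2) by (simp add: r_def U'_def)
        next
          case False
          have "\<phi> s z' = \<phi> s' z'" using agree[OF s(1) z'(1) False] agree[OF s(2) z'(1) False] by simp
          then have "\<phi> s z = \<phi> s z'" using z'(2) by simp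
          then have "z = z'" using inj_onD[OF inj(1)] zF z'(1) by blast
          then show False using z(1) False by simp
        qed
      qed
      have "\<phi> s ` {x, y} = \<phi> s ` {x', y'}" using eq ss by simp
      then have "{x, y} = {x', y'}"
        using inj_on_image_eq_iff[OF inj(1), of "{x, y}" "{x', y'}"] xF yF by simp
      then have "x = x' \<and> y = y'" using xF(3) yF(3) by (auto simp: doubleton_eq_iff)
      then show "p = p'" using ss by (simp add: p p')
    qed
  next
    fix s e j assume s: "s < m" and e: "e \<in> Es" and j: "j < a"
    obtain x y where xy: "e = (x, y)" by (metis prod.exhaust_sel)
    note xF = EsF[OF e[unfolded xy]]
    have "\<phi> s ` {x, y} \<in> edges (host c)" using emb(4)[OF \<phi>(1)[OF s]] xF(4) by blast
    then have "adj c (\<phi> s x) (\<phi> s y)" using edge_host[of "\<phi> s x" "\<phi> s y" c] by simp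
    then show "fval c j (place U' \<psi>' (\<phi> s) (fst e)) (place U' \<psi>' (\<phi> s) (snd e)) = 0"
      using j place s xF by (simp add: xy adj_def)
  qed
  moreover have "(U', Es, \<psi>', u0, i0, w) \<in> bad_index M"
    unfolding bad_index_def using F(2) Es_sub \<psi>' u0 i0(1) w(1) dens by (auto simp: U'_def U_def)
  ultimately have "c \<in> bad_coeffs M m"
    unfolding bad_coeffs_def using c(1)
    by (intro CollectI conjI bexI[of _ "(U', Es, \<psi>', u0, i0, w)"]) auto
  then show False using c(2) by simp
qed

end

text \<open>Average over all coefficient vectors. The bad ones are so rare that even if every
  \<open>t\<close>-set were a clique there, they would carry less than half of the total; so some
  good vector has at least half of the guaranteed average.\<close>

lemma algebraic_host_graphs:
  fixes t M a b :: nat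
  assumes t: "t \<ge> 1" and M: "M \<ge> 1" and ab: "a > 0" "b > 0"
  shows "\<exists>L0 q0. \<forall>A::'a::field set. finite_subfield A \<longrightarrow> q0 \<le> card A \<longrightarrow>
     (\<exists>G::(nat \<Rightarrow> 'a) ugraph. simple_graph G \<and> card (verts G) = card A ^ b \<and>
        (card A ^ b choose t) \<le> 2 * card A ^ (a * (t choose 2)) * card (cliques t G) \<and>
        (\<forall>F R \<psi>. simple_graph F \<longrightarrow> verts F \<subseteq> {..<M} \<longrightarrow> R \<subseteq> verts F \<longrightarrow>
           dense_over (of_nat b / of_nat a) F R \<longrightarrow> card (rooted_embeddings F R G \<psi>) \<le> L0))"
proof -
  define C where "C = t choose 2"
  \<comment> \<open>\<open>b * M\<close> pays for the placements, \<open>a * C\<close> for the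
    clique probability, one unit for the loss in \<open>card_bad_single\<close>, and one unit leaves
    a factor \<open>card A\<close> that beats the constants.\<close>
  define K where "K = b * M + a * C + 2"
  \<comment> \<open>Room for up to \<open>M * M\<close> edges in each of \<open>K\<close> petals,
    and for the \<open>C\<close> pairs of a clique.\<close>
  define \<Lambda> where "\<Lambda> = K * (M * M) + C"
  define \<rho> where "\<rho> = dep_degree (a * \<Lambda>) (param_degree \<Lambda>)"
  define m where "m = K * (\<rho> + 1)"
  \<comment> \<open>Enough evaluation points to separate pairs among the vertices of
    \<open>m\<close> embeddings and among those of a clique; the number does not depend on the
    field.\<close>
  define \<delta> where "\<delta> = (m * M) ^ 2 * b + (m * M) ^ 4 + (t ^ 2 * b + t ^ 4) + 1"
  define I0 where "I0 = 2 ^ M * (2 ^ (M * M) * (M * (b * \<delta> ^ 2))) * (\<rho> + 2) ^ (a * \<Lambda>)"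
  define L0 where "L0 = (\<Sum>n\<le>M. sunflower_bound (m ^ b + 1) n)"
  \<comment> \<open>\<open>\<delta>\<close> for the choice of \<open>D\<close>, \<open>t\<close> for
    the existence of a \<open>t\<close>-set, and \<open>2 * I0 + 1\<close> for the contradiction in
    the averaging.\<close>
  define q0 where "q0 = \<delta> + t + (2 * I0 + 1)"
  have main: "\<exists>G::(nat \<Rightarrow> 'a) ugraph. simple_graph G \<and> card (verts G) = card A ^ b \<and>
        (card A ^ b choose t) \<le> 2 * card A ^ (a * (t choose 2)) * card (cliques t G) \<and>
        (\<forall>F R \<psi>. simple_graph F \<longrightarrow> verts F \<subseteq> {..<M} \<longrightarrow> R \<subseteq> verts F \<longrightarrow>
           dense_over (of_nat b / of_nat a) F R \<longrightarrow> card (rooted_embeddings F R G \<psi>) \<le> L0)"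
    if A: "finite_subfield A" and q: "q0 \<le> card A" for A :: "'a set"
  proof -
    interpret FA: finite_subfield A by (rule A)
    have "\<delta> \<le> card A" using q by (simp add: q0_def)
    then obtain D where D: "D \<subseteq> A" "card D = \<delta>" by (metis obtain_subset_with_card_n)
    interpret random_algebraic A a b \<Lambda> D by unfold_locales (rule D(1))
    let ?q = "card A"
    have q2: "?q \<ge> 2" by (rule FA.card_A_ge)
    define Bad where "Bad = bad_coeffs M m"
    have BadC: "Bad \<subseteq> coeffs" by (auto simp: Bad_def bad_coeffs_def)
    define \<kappa> where "\<kappa> c = card (cliques t (host c))" for c
    define N where "N = (?q ^ b choose t)"
    have "t \<le> ?q ^ 1" using q by (simp add: q0_def)
    also have "?q ^ 1 \<le> ?q ^ b" using ab q2 by (intro power_increasing) auto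
    finally have N: "N > 0" by (simp add: N_def)
    have \<kappa>: "\<kappa> c \<le> N" for c
    proof -
      have "\<kappa> c \<le> card {T. T \<subseteq> VS \<and> card T = t}"
        unfolding \<kappa>_def using finite_VS by (intro card_mono) (auto simp: cliques_def host_def)
      then show ?thesis using n_subsets[OF finite_VS] by (simp add: N_def card_VS)
    qed
    have K1: "K * (M * M) \<le> \<Lambda>" by (simp add: \<Lambda>_def)
    have "K \<le> K * (M * M)" using M by simp
    also have "\<dots> \<le> a * \<Lambda>" using K1 ab by (metis le_trans mult_le_mono1 nat_mult_1 Suc_leI One_nat_def)
    finally have K2: "K \<le> a * \<Lambda> + 2" by simp
    have "card Bad * ?q ^ K \<le> 2 ^ M * (2 ^ (M * M) * (?q ^ (b * M) * (M * (b * \<delta> ^ 2)))) * ((\<rho> + 2) ^ (a * \<Lambda>) * ?q ^ (card Idx + 1))"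
      using card_bad_coeffs[OF K1 K2] by (simp add: Bad_def m_def \<rho>_def D(2))
    also have "\<dots> = ?q ^ (b * M + 1) * (I0 * ?q ^ card Idx)"
      by (simp add: I0_def power_add mult_ac)
    also have "card Bad * ?q ^ K = ?q ^ (b * M + 1) * (card Bad * (?q ^ (a * C) * ?q))"
      by (simp add: K_def power_add mult_ac power2_eq_square)
    finally have bad: "card Bad * (?q ^ (a * C) * ?q) \<le> I0 * ?q ^ card Idx"
      using q2 by simp
    have "\<exists>c\<in>coeffs - Bad. N \<le> 2 * ?q ^ (a * C) * \<kappa> c"
    proof (rule ccontr)
      assume neg: "\<not> ?thesis"
      have "t choose 2 \<le> \<Lambda>" by (simp add: \<Lambda>_def C_def)
      moreover have "t ^ 2 * b + t ^ 4 < card D" unfolding D(2) \<delta>_def by simp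
      ultimately have "N * ?q ^ card Idx \<le> (\<Sum>c\<in>coeffs. \<kappa> c) * ?q ^ (a * C)"
        using sum_card_cliques[OF t] by (simp add: N_def \<kappa>_def C_def)
      then have "2 * (N * ?q ^ card Idx) \<le> 2 * ((\<Sum>c\<in>coeffs. \<kappa> c) * ?q ^ (a * C))" by simp
      also have "\<dots> = (\<Sum>c\<in>coeffs. 2 * ?q ^ (a * C) * \<kappa> c)"
        by (simp add: sum_distrib_left sum_distrib_right mult_ac)
      also have "\<dots> = (\<Sum>c\<in>coeffs - Bad. 2 * ?q ^ (a * C) * \<kappa> c) + (\<Sum>c\<in>Bad. 2 * ?q ^ (a * C) * \<kappa> c)"
        using sum.subset_diff[OF BadC finite_coeffs] .
      also have "(\<Sum>c\<in>coeffs - Bad. 2 * ?q ^ (a * C) * \<kappa> c) \<le> (\<Sum>c\<in>coeffs - Bad. N)"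
        using neg by (intro sum_mono) (metis linorder_linear)
      also have "(\<Sum>c\<in>coeffs - Bad. N) \<le> card coeffs * N"
        using finite_coeffs by (simp add: card_mono)
      also have "(\<Sum>c\<in>Bad. 2 * ?q ^ (a * C) * \<kappa> c) \<le> (\<Sum>c\<in>Bad. 2 * ?q ^ (a * C) * N)"
        by (intro sum_mono mult_le_mono2 \<kappa>)
      finally have "2 * (N * ?q ^ card Idx) \<le> ?q ^ card Idx * N + card Bad * (2 * ?q ^ (a * C) * N)"
        by (simp add: card_coeffs)
      then have "N * ?q ^ card Idx \<le> N * (2 * (card Bad * ?q ^ (a * C)))"
        by (simp add: algebra_simps)
      then have "?q ^ card Idx \<le> 2 * (card Bad * ?q ^ (a * C))" using N by simp
      then have "?q ^ card Idx * ?q \<le> 2 * (card Bad * ?q ^ (a * C)) * ?q" by (rule mult_le_mono1)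
      also have "\<dots> = 2 * (card Bad * (?q ^ (a * C) * ?q))" by simp
      also have "\<dots> \<le> 2 * (I0 * ?q ^ card Idx)" using bad by simp
      finally have "?q ^ card Idx * ?q \<le> ?q ^ card Idx * (2 * I0)" by (simp add: mult_ac)
      then have "?q \<le> 2 * I0" using q2 by simp
      then show False using q by (simp add: q0_def)
    qed
    then obtain c where c: "c \<in> coeffs" "c \<notin> Bad" "N \<le> 2 * ?q ^ (a * C) * \<kappa> c" by blast
    show ?thesis
    proof (intro exI[of _ "host c"] conjI allI impI)
      show "simple_graph (host c)" by (rule simple_graph_host)
      show "card (verts (host c)) = ?q ^ b" by (simp add: host_def card_VS)
      show "(?q ^ b choose t) \<le> 2 * ?q ^ (a * (t choose 2)) * card (cliques t (host c))"
        using c(3) by (simp add: N_def C_def \<kappa>_def)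
      fix F :: "nat ugraph" and R :: "nat set" and \<psi> :: "nat \<Rightarrow> nat \<Rightarrow> 'a"
      assume F: "simple_graph F" "verts F \<subseteq> {..<M}" "R \<subseteq> verts F" "dense_over (of_nat b / of_nat a) F R"
      have "(m * M) ^ 2 * b + (m * M) ^ 4 < card D" unfolding D(2) \<delta>_def by simp
      then show "card (rooted_embeddings F R (host c) \<psi>) \<le> L0"
        unfolding L0_def using c(1,2) ab F
        by (intro card_rooted_embeddings_host) (auto simp: Bad_def)
    qed
  qed
  show ?thesis by (intro exI[of _ L0] exI[of _ q0] allI impI) (rule main)
qed

section \<open>Power-free graphs\<close>

lemma copies_complete_graph:
  assumes fin: "finite (verts G)"
  shows "copies (complete_graph t) G = (\<lambda>T. (T, {e. e \<subseteq> T \<and> card e = 2})) ` cliques t G"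
proof -
  have img: "(\<lambda>e. f ` e) ` {e. e \<subseteq> {..<t} \<and> card e = 2} = {e. e \<subseteq> f ` {..<t} \<and> card e = 2}"
    if inj: "inj_on f {..<t}" for f :: "nat \<Rightarrow> 'a"
  proof (intro equalityI subsetI)
    fix e assume "e \<in> (\<lambda>e. f ` e) ` {e. e \<subseteq> {..<t} \<and> card e = 2}"
    then obtain e' where e': "e = f ` e'" "e' \<subseteq> {..<t}" "card e' = 2" by (elim imageE CollectE conjE)
    have "card e = 2" unfolding e'(1) card_image[OF inj_on_subset[OF inj e'(2)]] by (rule e'(3))
    moreover have "e \<subseteq> f ` {..<t}" unfolding e'(1) by (rule image_mono[OF e'(2)])
    ultimately show "e \<in> {e. e \<subseteq> f ` {..<t} \<and> card e = 2}" by simp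
  next
    fix e assume e: "e \<in> {e. e \<subseteq> f ` {..<t} \<and> card e = 2}"
    then have "e \<subseteq> f ` {..<t}" "card e = 2" by simp_all
    then obtain e' where e': "e' \<subseteq> {..<t}" "e = f ` e'" by (elim subset_imageE)
    have "card e' = 2" using \<open>card e = 2\<close> unfolding e'(2) card_image[OF inj_on_subset[OF inj e'(1)]] .
    then have "e' \<in> {e. e \<subseteq> {..<t} \<and> card e = 2}" using e'(1) by simp
    then show "e \<in> (\<lambda>e. f ` e) ` {e. e \<subseteq> {..<t} \<and> card e = 2}" unfolding e'(2) by (rule imageI)
  qed
  show ?thesis
  proof (intro equalityI subsetI)
    fix K assume "K \<in> copies (complete_graph t) G"
    then obtain f where f: "inj_on f {..<t}" "K = map_graph f (complete_graph t)" and sub: "subgraph K G"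
      unfolding copies_def isomorphic_def complete_graph_def by auto
    let ?T = "f ` {..<t}"
    have K: "K = (?T, {e. e \<subseteq> ?T \<and> card e = 2})"
      unfolding f(2) map_graph_def complete_graph_def by (simp add: img[OF f(1)])
    have "?T \<in> cliques t G"
      using sub card_image[OF f(1)] unfolding K cliques_def subgraph_def by auto
    then show "K \<in> (\<lambda>T. (T, {e. e \<subseteq> T \<and> card e = 2})) ` cliques t G" unfolding K by (rule imageI)
  next
    fix K assume "K \<in> (\<lambda>T. (T, {e. e \<subseteq> T \<and> card e = 2})) ` cliques t G"
    then obtain T where T: "T \<in> cliques t G" "K = (T, {e. e \<subseteq> T \<and> card e = 2})" by blast
    have "finite T" using T(1) fin finite_subset by (auto simp: cliques_def)
    then have "\<exists>f. bij_betw f {..<t} T"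
      using ex_bij_betw_nat_finite[of T] T(1) by (auto simp: cliques_def atLeast0LessThan)
    then obtain f where f: "bij_betw f {..<t} T" by blast
    then have inj: "inj_on f {..<t}" and T': "f ` {..<t} = T" by (auto simp: bij_betw_def)
    have "K = map_graph f (complete_graph t)"
      unfolding T(2) map_graph_def complete_graph_def by (simp add: img[OF inj] T')
    moreover have "subgraph K G"
      using T(1) unfolding T(2) subgraph_def cliques_def by (auto simp: card_2_iff)
    ultimately show "K \<in> copies (complete_graph t) G"
      unfolding copies_def isomorphic_def complete_graph_def using inj by auto
  qed
qed

lemma card_copies_complete_graph:
  "finite (verts G) \<Longrightarrow> card (copies (complete_graph t) G) = card (cliques t G)"
  by (subst copies_complete_graph, assumption, rule card_image) (auto simp: inj_on_def)

text \<open>The bound on the vertices makes the family finite; \<open>M\<close> will be chosen so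
  that all trees of the upper bound fit.\<close>

definition balanced_family :: "nat \<Rightarrow> rat \<Rightarrow> (nat ugraph \<times> nat set) set" where
  "balanced_family M d = {(F, R). rooted_graph F R \<and> balanced F R \<and> d \<le> rooted_density F R \<and> verts F \<subseteq> {..<M}}"

definition power_free :: "nat \<Rightarrow> rat \<Rightarrow> nat \<Rightarrow> nat ugraph \<Rightarrow> bool" where
  "power_free M d L G \<longleftrightarrow> (\<forall>(F, R)\<in>balanced_family M d. free_of (rooted_power F R L) G)"

lemma finite_balanced_family: "finite (balanced_family M d)"
proof (rule finite_subset)
  show "balanced_family M d \<subseteq> (Pow {..<M} \<times> Pow (Pow {..<M})) \<times> Pow {..<M}"
    unfolding balanced_family_def rooted_graph_def simple_graph_def by fastforce
qed simp

lemma edges_subset_verts: "simple_graph F \<Longrightarrow> e \<in> edges F \<Longrightarrow> e \<subseteq> verts F"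
  by (simp add: simple_graph_def)

lemma finite_edges: "simple_graph F \<Longrightarrow> finite (edges F)"
  by (rule finite_subset[of _ "Pow (verts F)"]) (auto simp: simple_graph_def)

lemma dense_over_balanced:
  assumes "balanced F R" "d \<le> rooted_density F R"  "finite (verts F)"
  shows "dense_over d F R"
  unfolding dense_over_def
proof (intro allI impI)
  fix S assume S: "S \<subseteq> verts F - R"
  show "d * of_nat (card S) \<le> of_nat (card {e \<in> edges F. e \<inter> S \<noteq> {}})"
  proof (cases "S = {}")
    case False
    have "finite S" using S assms(3) finite_subset by blast
    then have pos: "(0::rat) < of_nat (card S)" using False by (simp add: card_gt_0_iff)
    have "d \<le> set_density F S" using assms(1,2) S False unfolding balanced_def by (meson order_trans)
    then show ?thesis using pos by (simp add: set_density_def pos_le_divide_eq)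
  qed simp
qed

lemma map_graph_eqD:
  assumes F: "simple_graph F" and \<pi>: "inj_on \<pi> W" and im: "f ` verts F \<subseteq> W" "g ` verts F \<subseteq> W"
    and eq: "map_graph (\<lambda>x. \<pi> (f x)) F = map_graph (\<lambda>x. \<pi> (g x)) F"
  shows "map_graph f F = map_graph g F"
proof -
  have *: "(\<lambda>x. \<pi> (h x)) ` V = \<pi> ` h ` V" for h and V :: "'a set" by (simp add: image_image)
  have "\<pi> ` f ` verts F = \<pi> ` g ` verts F" using eq by (simp add: map_graph_def *)
  then have 1: "f ` verts F = g ` verts F" using inj_on_image_eq_iff[OF \<pi> im] by simp
  have im2: "\<And>e. e \<in> edges F \<Longrightarrow> f ` e \<subseteq> W" "\<And>e. e \<in> edges F \<Longrightarrow> g ` e \<subseteq> W"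
    using im edges_subset_verts[OF F] by blast+
  have e: "(\<lambda>e. \<pi> ` f ` e) ` edges F = (\<lambda>e. \<pi> ` g ` e) ` edges F"
    using eq by (simp add: map_graph_def *)
  have "(\<lambda>e. f ` e) ` edges F = (\<lambda>e. g ` e) ` edges F"
  proof (intro equalityI subsetI)
    fix x assume "x \<in> (\<lambda>e. f ` e) ` edges F"
    then obtain e1 where e1: "e1 \<in> edges F" "x = f ` e1" by blast
    then have "\<pi> ` f ` e1 \<in> (\<lambda>e. \<pi> ` g ` e) ` edges F" using e by blast
    then obtain e2 where e2: "e2 \<in> edges F" "\<pi> ` f ` e1 = \<pi> ` g ` e2" by blast
    then have "f ` e1 = g ` e2" using inj_on_image_eq_iff[OF \<pi> im2(1)[OF e1(1)] im2(2)[OF e2(1)]] by simp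
    then show "x \<in> (\<lambda>e. g ` e) ` edges F" using e1 e2 by blast
  next
    fix x assume "x \<in> (\<lambda>e. g ` e) ` edges F"
    then obtain e1 where e1: "e1 \<in> edges F" "x = g ` e1" by blast
    then have "\<pi> ` g ` e1 \<in> (\<lambda>e. \<pi> ` f ` e) ` edges F" using e by blast
    then obtain e2 where e2: "e2 \<in> edges F" "\<pi> ` g ` e1 = \<pi> ` f ` e2" by blast
    then have "g ` e1 = f ` e2" using inj_on_image_eq_iff[OF \<pi> im2(2)[OF e1(1)] im2(1)[OF e2(1)]] by simp
    then show "x \<in> (\<lambda>e. f ` e) ` edges F" using e1 e2 by blast
  qed
  then show ?thesis using 1 by (simp add: map_graph_def)
qed

lemma finite_embeddings:
  assumes "finite (verts F)" "finite (verts G)"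
  shows "finite (embeddings F G)"
proof (rule finite_subset)
  show "embeddings F G \<subseteq> PiE (verts F) (\<lambda>_. verts G)"
    unfolding embeddings_def by (auto simp: PiE_def)
qed (use assms in \<open>simp add: finite_PiE\<close>)

lemma finite_rooted_embeddings:
  assumes "finite (verts F)" "finite (verts G)"
  shows "finite (rooted_embeddings F R G \<psi>)"
  by (rule finite_subset[OF _ finite_embeddings[OF assms]]) (auto simp: rooted_embeddings_def)

text \<open>Distinct copies in the union give distinct embeddings that agree on the roots.\<close>

lemma rooted_power_in_graph:
  fixes F :: "'a ugraph" and G :: "'b ugraph"
  assumes F: "simple_graph F" "R \<subseteq> verts F" and G: "finite (verts G)"
    and P: "P \<in> rooted_power F R L" "copies P G \<noteq> {}"
  shows "\<exists>\<psi>. L \<le> card (rooted_embeddings F R G \<psi>)"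
proof -
  obtain C where C: "P = (\<Union>K\<in>C. verts K, \<Union>K\<in>C. edges K)" "C \<subseteq> rooted_copies F R" "finite C" "card C = L"
    using P(1) unfolding rooted_power_def by blast
  obtain g where g: "inj_on g (verts P)" "subgraph (map_graph g P) G"
    using P(2) unfolding copies_def isomorphic_def by auto
  have "\<forall>K\<in>C. \<exists>f. K = map_graph f F \<and> inj_on f (verts F) \<and> (\<forall>r\<in>R. f r = r)"
    using C(2) unfolding rooted_copies_def by blast
  then obtain f where f: "\<And>K. K \<in> C \<Longrightarrow> K = map_graph (f K) F" "\<And>K. K \<in> C \<Longrightarrow> inj_on (f K) (verts F)"
    "\<And>K r. K \<in> C \<Longrightarrow> r \<in> R \<Longrightarrow> f K r = r" by metis
  define \<phi> where "\<phi> K = (\<lambda>x\<in>verts F. g (f K x))" for K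
  have sub: "f K ` verts F \<subseteq> verts P" if "K \<in> C" for K
  proof -
    have "verts K \<subseteq> verts P" using C(1) that by auto
    moreover have "verts K = f K ` verts F" using f(1)[OF that] by (metis map_graph_def fst_conv)
    ultimately show ?thesis by simp
  qed
  have esub: "f K ` e \<in> edges P" if "K \<in> C" "e \<in> edges F" for K e
  proof -
    have "f K ` e \<in> edges K" using f(1)[OF that(1)] that(2) by (metis map_graph_def snd_conv imageI)
    then show ?thesis using C(1) that(1) by auto
  qed
  have "\<phi> K \<in> rooted_embeddings F R G g" if K: "K \<in> C" for K
    unfolding rooted_embeddings_def embeddings_def
  proof (intro CollectI conjI ballI)
    show "\<phi> K \<in> extensional (verts F)" by (simp add: \<phi>_def)
    show "\<phi> K ` verts F \<subseteq> verts G"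
      using g(2) sub[OF K] by (force simp: \<phi>_def subgraph_def map_graph_def)
    show "inj_on (\<phi> K) (verts F)"
    proof (rule inj_onI)
      fix x y assume xy: "x \<in> verts F" "y \<in> verts F" "\<phi> K x = \<phi> K y"
      then have "g (f K x) = g (f K y)" by (simp add: \<phi>_def)
      then have "f K x = f K y" using inj_onD[OF g(1)] sub[OF K] xy by blast
      then show "x = y" using inj_onD[OF f(2)[OF K]] xy by blast
    qed
    show "\<phi> K ` e \<in> edges G" if e: "e \<in> edges F" for e
    proof -
      have "\<phi> K ` e = g ` f K ` e"
        using edges_subset_verts[OF F(1) e] by (force simp: \<phi>_def image_image)
      moreover have "g ` f K ` e \<in> edges (map_graph g P)"
        using esub[OF K e] by (simp add: map_graph_def)
      ultimately show ?thesis using g(2) by (auto simp: subgraph_def)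
    qed
    show "\<phi> K r = g r" if "r \<in> R" for r using f(3)[OF K that] F(2) that by (auto simp: \<phi>_def)
  qed
  then have im: "\<phi> ` C \<subseteq> rooted_embeddings F R G g" by blast
  have "inj_on \<phi> C"
  proof (rule inj_onI)
    fix K K' assume K: "K \<in> C" "K' \<in> C" "\<phi> K = \<phi> K'"
    have "f K x = f K' x" if x: "x \<in> verts F" for x
    proof -
      have "g (f K x) = g (f K' x)" using fun_cong[OF K(3), of x] x by (simp add: \<phi>_def)
      then show ?thesis using inj_onD[OF g(1)] sub[OF K(1)] sub[OF K(2)] x by blast
    qed
    then have "map_graph (f K) F = map_graph (f K') F"
    proof -
      assume eq: "\<And>x. x \<in> verts F \<Longrightarrow> f K x = f K' x"
      have "f K ` verts F = f K' ` verts F" by (rule image_cong[OF refl eq])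
      moreover have "(\<lambda>e. f K ` e) ` edges F = (\<lambda>e. f K' ` e) ` edges F"
        using eq edges_subset_verts[OF F(1)] by (intro image_cong refl) auto
      ultimately show ?thesis by (simp add: map_graph_def)
    qed
    then show "K = K'" using f(1) K(1,2) by metis
  qed
  then have "L = card (\<phi> ` C)" using C(4) by (simp add: card_image)
  also have "\<dots> \<le> card (rooted_embeddings F R G g)"
    using F(1) G by (intro card_mono im finite_rooted_embeddings) (auto simp: simple_graph_def)
  finally show ?thesis by blast
qed

text \<open>Such an embedding maps into the vertices of \<open>K\<close>, of which there are at most
  \<open>card (verts F)\<close>. This is the loss in passing from embeddings to copies.\<close>

lemma card_embeddings_same_image:
  assumes "finite (verts F)"
  shows "card {\<phi> \<in> rooted_embeddings F R G \<psi>. map_graph \<phi> F = K} \<le> card (verts F) ^ card (verts F)"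
    and "finite {\<phi> \<in> rooted_embeddings F R G \<psi>. map_graph \<phi> F = K}"
proof -
  let ?S = "{\<phi> \<in> rooted_embeddings F R G \<psi>. map_graph \<phi> F = K}"
  have "finite ?S \<and> card ?S \<le> card (verts F) ^ card (verts F)"
  proof (cases "?S = {}")
    case False
    then obtain \<phi>0 where \<phi>0: "\<phi>0 \<in> ?S" by blast
    have K: "verts K = \<phi>0 ` verts F" using \<phi>0 by (auto simp: map_graph_def)
    have sub: "?S \<subseteq> PiE (verts F) (\<lambda>_. verts K)"
      by (auto simp: rooted_embeddings_def embeddings_def map_graph_def PiE_def)
    have fK: "finite (verts K)" using K assms by simp
    have fin: "finite (PiE (verts F) (\<lambda>_. verts K))" using fK assms by (simp add: finite_PiE)
    have "card ?S \<le> card (PiE (verts F) (\<lambda>_. verts K))" by (rule card_mono[OF fin sub])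
    also have "\<dots> = card (verts K) ^ card (verts F)" using assms by (simp add: card_PiE)
    also have "\<dots> \<le> card (verts F) ^ card (verts F)"
      using card_image_le[OF assms, of \<phi>0] K by (intro power_mono) auto
    finally show ?thesis using finite_subset[OF sub fin] by blast
  next
    case True
    show ?thesis unfolding True by simp
  qed
  then show "card ?S \<le> card (verts F) ^ card (verts F)" "finite ?S" by blast+
qed

text \<open>A converse of \<open>rooted_power_in_graph\<close>: many embeddings with common roots
  have \<open>L\<close> different images. Members of the power contain the original roots as
  vertices, so the images are first renamed to put every root back in its place.\<close>

lemma free_of_rooted_power_bound:
  fixes F :: "nat ugraph" and G :: "nat ugraph"
  assumes F: "simple_graph F" "R \<subseteq> verts F" and G: "finite (verts G)"
    and free: "free_of (rooted_power F R L) G" and L: "L \<ge> 1"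
  shows "card (rooted_embeddings F R G \<psi>) \<le> L * card (verts F) ^ card (verts F)"
proof (rule ccontr)
  assume neg: "\<not> ?thesis"
  define \<Phi> where "\<Phi> = rooted_embeddings F R G \<psi>"
  have finF: "finite (verts F)" using F(1) by (simp add: simple_graph_def)
  have fin\<Phi>: "finite \<Phi>" unfolding \<Phi>_def by (rule finite_rooted_embeddings[OF finF G])
  have "L \<le> card ((\<lambda>\<phi>. map_graph \<phi> F) ` \<Phi>)"
  proof (rule ccontr)
    assume lt: "\<not> ?thesis"
    have "card \<Phi> \<le> card ((\<lambda>\<phi>. map_graph \<phi> F) ` \<Phi>) * card (verts F) ^ card (verts F)"
    proof (rule card_le_card_fibres(2)[where f = "\<lambda>\<phi>. map_graph \<phi> F"])
      fix K
      show "finite {\<phi> \<in> \<Phi>. map_graph \<phi> F = K} \<and> card {\<phi> \<in> \<Phi>. map_graph \<phi> F = K} \<le> card (verts F) ^ card (verts F)"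
        unfolding \<Phi>_def using card_embeddings_same_image[OF finF] by (intro conjI)
    qed (simp_all add: fin\<Phi>)
    also have "\<dots> \<le> L * card (verts F) ^ card (verts F)" using lt by (intro mult_le_mono1) simp
    finally show False using neg by (simp add: \<Phi>_def)
  qed
  then obtain \<K> where \<K>: "\<K> \<subseteq> (\<lambda>\<phi>. map_graph \<phi> F) ` \<Phi>" "card \<K> = L" by (metis obtain_subset_with_card_n)
  then have fin\<K>: "finite \<K>" using fin\<Phi> finite_subset by blast
  have "\<forall>K\<in>\<K>. \<exists>\<phi>\<in>\<Phi>. K = map_graph \<phi> F" using \<K>(1) by blast
  then obtain \<phi> where \<phi>: "\<And>K. K \<in> \<K> \<Longrightarrow> \<phi> K \<in> \<Phi>" "\<And>K. K \<in> \<K> \<Longrightarrow> K = map_graph (\<phi> K) F" by metis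
  have emb: "\<phi> K ` verts F \<subseteq> verts G" "inj_on (\<phi> K) (verts F)" "\<And>e. e \<in> edges F \<Longrightarrow> \<phi> K ` e \<in> edges G"
    "\<And>r. r \<in> R \<Longrightarrow> \<phi> K r = \<psi> r" if "K \<in> \<K>" for K
    using \<phi>(1)[OF that] by (simp_all add: \<Phi>_def rooted_embeddings_def embeddings_def)
  obtain K0 where K0: "K0 \<in> \<K>" using \<K>(2) L by (metis card.empty equals0I not_one_le_zero)
  have inj\<psi>: "inj_on \<psi> R"
  proof (rule inj_onI)
    fix x y assume xy: "x \<in> R" "y \<in> R" "\<psi> x = \<psi> y"
    then have "\<phi> K0 x = \<phi> K0 y" using emb(4)[OF K0] by simp
    then show "x = y" using inj_onD[OF emb(2)[OF K0]] xy F(2) by blast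
  qed
  have finR: "finite R" using F(2) finF finite_subset by blast
  \<comment> \<open>All roots lie below \<open>s\<close>; adding \<open>s\<close> to the other
    vertices keeps them clear of the roots.\<close>
  define s where "s = Suc (Max (insert 0 R))"
  have s: "r < s" if "r \<in> R" for r using finR that by (simp add: s_def less_Suc_eq_le)
  define \<pi> where "\<pi> x = (if x \<in> \<psi> ` R then inv_into R \<psi> x else x + s)" for x
  have \<pi>\<psi>: "\<pi> (\<psi> r) = r" if "r \<in> R" for r
    using that inv_into_f_f[OF inj\<psi> that] by (simp add: \<pi>_def)
  have inj\<pi>: "inj \<pi>"
  proof (rule injI)
    fix x y assume e: "\<pi> x = \<pi> y"
    have lt: "\<pi> z < s" if "z \<in> \<psi> ` R" for z using that \<pi>\<psi> s by auto
    have ge: "\<not> \<pi> z < s" if "z \<notin> \<psi> ` R" for z using that by (simp add: \<pi>_def)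
    show "x = y"
    proof (cases "x \<in> \<psi> ` R")
      case True
      then have "y \<in> \<psi> ` R" using e lt ge by metis
      then show ?thesis using True e \<pi>\<psi> by auto
    next
      case False
      then have "y \<notin> \<psi> ` R" using e lt ge by metis
      then show ?thesis using False e by (simp add: \<pi>_def)
    qed
  qed
  define h where "h K = map_graph (\<lambda>x. \<pi> (\<phi> K x)) F" for K
  have injh: "inj_on h \<K>"
  proof (rule inj_onI)
    fix K K' assume K: "K \<in> \<K>" "K' \<in> \<K>" "h K = h K'"
    have "map_graph (\<phi> K) F = map_graph (\<phi> K') F"
      using map_graph_eqD[OF F(1) inj_on_subset[OF inj\<pi> subset_UNIV] emb(1)[OF K(1)] emb(1)[OF K(2)]] K(3)
      by (simp add: h_def)
    then show "K = K'" using \<phi>(2) K by metis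
  qed
  have "h K \<in> rooted_copies F R" if K: "K \<in> \<K>" for K
  proof -
    have "inj_on (\<lambda>x. \<pi> (\<phi> K x)) (verts F)"
      using emb(2)[OF K] inj\<pi> by (auto simp: inj_on_def)
    moreover have "\<forall>r\<in>R. \<pi> (\<phi> K r) = r" using emb(4)[OF K] \<pi>\<psi> by simp
    ultimately show ?thesis unfolding rooted_copies_def h_def by blast
  qed
  then have hsub: "h ` \<K> \<subseteq> rooted_copies F R" by blast
  define P where "P = (\<Union>K\<in>h ` \<K>. verts K, \<Union>K\<in>h ` \<K>. edges K)"
  have "P \<in> rooted_power F R L"
    unfolding rooted_power_def P_def using hsub fin\<K> card_image[OF injh] \<K>(2) by blast
  moreover have "map_graph (inv_into UNIV \<pi>) P \<in> copies P G"
  proof -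
    have invs: "inv_into UNIV \<pi> ` (\<lambda>x. \<pi> (f x)) ` e = f ` e" for f and e :: "nat set"
      using inv_f_f[OF inj\<pi>] by (simp add: image_image)
    have "inv_into UNIV \<pi> ` verts P \<subseteq> verts G"
    proof
      fix x assume "x \<in> inv_into UNIV \<pi> ` verts P"
      then obtain K where K: "K \<in> \<K>" "x \<in> inv_into UNIV \<pi> ` (\<lambda>x. \<pi> (\<phi> K x)) ` verts F"
        by (auto simp: P_def h_def map_graph_def)
      then show "x \<in> verts G" using emb(1)[OF K(1)] unfolding invs by blast
    qed
    moreover have "(\<lambda>e. inv_into UNIV \<pi> ` e) ` edges P \<subseteq> edges G"
    proof
      fix x assume "x \<in> (\<lambda>e. inv_into UNIV \<pi> ` e) ` edges P"
      then obtain K e where K: "K \<in> \<K>" "e \<in> edges F" "x = inv_into UNIV \<pi> ` (\<lambda>x. \<pi> (\<phi> K x)) ` e"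
        by (auto simp: P_def h_def map_graph_def)
      then show "x \<in> edges G" using emb(3)[OF K(1,2)] unfolding invs by simp
    qed
    moreover have "inj_on (inv_into UNIV \<pi>) (verts P)"
    proof (rule inj_onI)
      fix x y assume xy: "x \<in> verts P" "y \<in> verts P" "inv_into UNIV \<pi> x = inv_into UNIV \<pi> y"
      have "verts P \<subseteq> range \<pi>" by (auto simp: P_def h_def map_graph_def)
      then show "x = y" using xy by (metis f_inv_into_f subsetD)
    qed
    ultimately show ?thesis
      unfolding copies_def isomorphic_def subgraph_def by (auto simp: map_graph_def)
  qed
  ultimately show False using free unfolding free_of_def by blast
qed

text \<open>A set of non-roots of minimal density, with all other vertices as roots, is balanced; peel it
  off.\<close>

lemma power_free_bound:
  fixes F G :: "nat ugraph"
  assumes G: "finite (verts G)" "power_free M d L G" and L: "L \<ge> 1" and d: "d > 0"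
    and F: "simple_graph F" "verts F \<subseteq> {..<M}" "R \<subseteq> verts F" "dense_over d F R"
  shows "card (rooted_embeddings F R G \<psi>) \<le> (L * (M + 1) ^ M) ^ card (verts F - R)"
  using F
proof (induction "card (verts F - R)" arbitrary: F rule: less_induct)
  case less
  define U where "U = verts F - R"
  note F = less.prems
  define B where "B = L * (M + 1) ^ M"
  have finF: "finite (verts F)" using F(1) by (simp add: simple_graph_def)
  have finU: "finite U" using finF by (simp add: U_def)
  have finE: "finite (edges F)" by (rule finite_edges[OF F(1)])
  have cardF: "card (verts F) \<le> M" using card_mono[OF _ F(2)] by simp
  define e where "e S = card {e \<in> edges F. e \<inter> S \<noteq> {}}" for S
  show ?case
  proof (cases "U = {}")
    case True
    have "rooted_embeddings F R G \<psi> \<subseteq> {restrict \<psi> (verts F)}"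
    proof
      fix \<phi> assume \<phi>: "\<phi> \<in> rooted_embeddings F R G \<psi>"
      have "\<phi> = restrict \<psi> (verts F)"
      proof (rule extensionalityI[of _ "verts F"])
        show "\<phi> \<in> extensional (verts F)" using \<phi> by (simp add: rooted_embeddings_def embeddings_def)
        fix x assume "x \<in> verts F"
        then show "\<phi> x = restrict \<psi> (verts F) x"
          using \<phi> True by (auto simp: rooted_embeddings_def U_def)
      qed simp
      then show "\<phi> \<in> {restrict \<psi> (verts F)}" by simp
    qed
    then have "card (rooted_embeddings F R G \<psi>) \<le> card {restrict \<psi> (verts F)}" by (intro card_mono) auto
    then show ?thesis using True unfolding U_def by (simp only: card.empty) simp
  next
    case False
    let ?\<S> = "{S. S \<subseteq> U \<and> S \<noteq> {}}"
    have "finite ?\<S>" "?\<S> \<noteq> {}" using finU False by auto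
    then obtain S where S: "S \<in> ?\<S>" "\<And>T. T \<in> ?\<S> \<Longrightarrow> set_density F S \<le> set_density F T"
      using ex_is_arg_min_if_finite[of ?\<S> "set_density F"] by (auto simp: is_arg_min_linorder)
    have SU: "S \<subseteq> U" "S \<noteq> {}" using S(1) by auto
    have finS: "finite S" using SU finU finite_subset by blast
    have Spos: "(0::rat) < of_nat (card S)" using finS SU by (simp add: card_gt_0_iff)
    define m where "m = set_density F S"
    have eS: "of_nat (e S) = m * of_nat (card S)" using Spos by (simp add: m_def set_density_def e_def)
    have eT: "m * of_nat (card T) \<le> of_nat (e T)" if "T \<subseteq> U" for T
    proof (cases "T = {}")
      case False
      then have "m \<le> set_density F T" using S(2) that by (simp add: m_def)
      moreover have "(0::rat) < of_nat (card T)" using that False finU finite_subset by (simp add: card_gt_0_iff)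
      ultimately show ?thesis by (simp add: set_density_def e_def pos_le_divide_eq)
    qed (simp add: e_def)
    have dm: "d \<le> m"
    proof -
      have "d * of_nat (card S) \<le> of_nat (e S)" using F(4) SU(1) unfolding dense_over_def e_def U_def by blast
      then show ?thesis using eS Spos by simp
    qed
    let ?R1 = "verts F - S"
    have vs: "verts F - ?R1 = S" using SU(1) by (auto simp: U_def)
    have rd: "rooted_density F ?R1 = m" by (simp only: rooted_density_def vs m_def)
    have "balanced F ?R1"
      unfolding balanced_def vs rd
    proof (intro allI impI)
      fix T assume "T \<noteq> {} \<and> T \<subseteq> S"
      then show "m \<le> set_density F T" unfolding m_def using SU by (intro S(2)) auto
    qed
    then have "(F, ?R1) \<in> balanced_family M d"
      using F(1,2) dm rd by (simp add: balanced_family_def rooted_graph_def)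
    then have free: "free_of (rooted_power F ?R1 L) G" using G(2) unfolding power_free_def by blast
    have B1: "card (rooted_embeddings F ?R1 G \<psi>') \<le> B" for \<psi>'
    proof -
      have "card (rooted_embeddings F ?R1 G \<psi>') \<le> L * card (verts F) ^ card (verts F)"
        by (rule free_of_rooted_power_bound[OF F(1) _ G(1) free L]) auto
      also have "card (verts F) ^ card (verts F) \<le> (M + 1) ^ card (verts F)"
        using cardF by (intro power_mono) auto
      also have "(M + 1) ^ card (verts F) \<le> (M + 1) ^ M" using cardF by (intro power_increasing) auto
      finally show ?thesis by (simp add: B_def)
    qed
    define F' where "F' = (verts F - S, {e \<in> edges F. e \<inter> S = {}})"
    have vF': "verts F' - R = U - S" by (auto simp: F'_def U_def)
    have F'1: "simple_graph F'" using F(1) by (auto simp: F'_def simple_graph_def)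
    have F'2: "verts F' \<subseteq> {..<M}" using F(2) by (auto simp: F'_def)
    have F'3: "R \<subseteq> verts F'" using F(3) SU(1) by (auto simp: F'_def U_def)
    \<comment> \<open>By minimality of \<open>S\<close>, at least m|T \<union> S| edges meet
      \<open>T \<union> S\<close>, and exactly m|S| of them meet \<open>S\<close>; hence at least
      m|T| edges are left for \<open>T\<close>.\<close>
    have F'4: "dense_over d F' R"
      unfolding dense_over_def vF'
    proof (intro allI impI)
      fix T assume T: "T \<subseteq> U - S"
      have finT: "finite T" using T finU finite_subset by blast
      have "{e \<in> edges F. e \<inter> (T \<union> S) \<noteq> {}} = {e \<in> edges F'. e \<inter> T \<noteq> {}} \<union> {e \<in> edges F. e \<inter> S \<noteq> {}}"
        by (auto simp: F'_def)
      then have "e (T \<union> S) = card {e \<in> edges F'. e \<inter> T \<noteq> {}} + e S"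
        unfolding e_def by (simp, subst card_Un_disjoint) (use finE in \<open>auto simp: F'_def\<close>)
      moreover have "m * of_nat (card (T \<union> S)) \<le> of_nat (e (T \<union> S))" using T SU by (intro eT) auto
      moreover have "card (T \<union> S) = card T + card S" using T finT finS by (intro card_Un_disjoint) auto
      ultimately have "m * of_nat (card T) \<le> of_nat (card {e \<in> edges F'. e \<inter> T \<noteq> {}})"
        using eS by (simp add: algebra_simps)
      moreover have "d * of_nat (card T) \<le> m * of_nat (card T)" using dm by (intro mult_right_mono) auto
      ultimately show "d * of_nat (card T) \<le> of_nat (card {e \<in> edges F'. e \<inter> T \<noteq> {}})" by linarith
    qed
    have less': "card (U - S) < card U" using SU finU by (intro psubset_card_mono) auto
    have IH: "card (rooted_embeddings F' R G \<psi>) \<le> B ^ card (U - S)"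
      using less.hyps[OF _ F'1 F'2 F'3 F'4] less' unfolding vF' by (simp add: B_def U_def)
    let ?r = "\<lambda>\<phi>. restrict \<phi> (verts F')"
    \<comment> \<open>An embedding of the rest fixes the roots of the balanced piece, which then
      extends in at most \<open>B\<close> ways.\<close>
    have "card (rooted_embeddings F R G \<psi>) \<le> card (rooted_embeddings F' R G \<psi>) * B"
    proof (rule card_le_card_fibres(2)[where f = ?r])
      show "finite (rooted_embeddings F' R G \<psi>)"
        using F'1 G(1) by (intro finite_rooted_embeddings) (auto simp: simple_graph_def)
      show "?r ` rooted_embeddings F R G \<psi> \<subseteq> rooted_embeddings F' R G \<psi>"
      proof (rule image_subsetI)
        fix \<phi> assume \<phi>: "\<phi> \<in> rooted_embeddings F R G \<psi>"
        have sub: "verts F' \<subseteq> verts F" by (auto simp: F'_def)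
        show "?r \<phi> \<in> rooted_embeddings F' R G \<psi>"
          unfolding rooted_embeddings_def embeddings_def
        proof (intro CollectI conjI ballI)
          show "?r \<phi> \<in> extensional (verts F')" by simp
          show "?r \<phi> ` verts F' \<subseteq> verts G" using \<phi> sub by (auto simp: rooted_embeddings_def embeddings_def)
          have "inj_on \<phi> (verts F')" using \<phi> sub by (auto simp: rooted_embeddings_def embeddings_def intro: inj_on_subset)
          then show "inj_on (?r \<phi>) (verts F')" by (simp add: inj_on_def)
          fix r assume "r \<in> R"
          then show "?r \<phi> r = \<psi> r" using \<phi> F'3 by (auto simp: rooted_embeddings_def)
        next
          fix e assume e: "e \<in> edges F'"
          have "?r \<phi> ` e = \<phi> ` e" using edges_subset_verts[OF F'1 e] by (intro image_cong) auto
          then show "?r \<phi> ` e \<in> edges G" using \<phi> e by (simp add: rooted_embeddings_def embeddings_def F'_def)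
        qed
      qed
      fix \<psi>' assume "\<psi>' \<in> rooted_embeddings F' R G \<psi>"
      have sub: "{\<phi> \<in> rooted_embeddings F R G \<psi>. ?r \<phi> = \<psi>'} \<subseteq> rooted_embeddings F ?R1 G \<psi>'"
      proof
        fix \<phi> assume \<phi>: "\<phi> \<in> {\<phi> \<in> rooted_embeddings F R G \<psi>. ?r \<phi> = \<psi>'}"
        have "\<phi> x = \<psi>' x" if "x \<in> ?R1" for x
        proof -
          have "?r \<phi> = \<psi>'" using \<phi> by simp
          from fun_cong[OF this, of x] show ?thesis using that by (simp add: F'_def)
        qed
        then show "\<phi> \<in> rooted_embeddings F ?R1 G \<psi>'" using \<phi> by (simp add: rooted_embeddings_def)
      qed
      have fin: "finite (rooted_embeddings F ?R1 G \<psi>')" by (rule finite_rooted_embeddings[OF finF G(1)])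
      show "finite {\<phi> \<in> rooted_embeddings F R G \<psi>. ?r \<phi> = \<psi>'} \<and>
          card {\<phi> \<in> rooted_embeddings F R G \<psi>. ?r \<phi> = \<psi>'} \<le> B"
        using finite_subset[OF sub fin] card_mono[OF fin sub] B1[of \<psi>'] by linarith
    qed
    also have "\<dots> \<le> B ^ card (U - S) * B" by (rule mult_le_mono1[OF IH])
    also have "\<dots> = B ^ Suc (card (U - S))" by simp
    also have "\<dots> \<le> B ^ card U" using less' L by (intro power_increasing) (auto simp: B_def)
    finally show ?thesis by (simp add: B_def U_def)
  qed
qed

section \<open>Lower bound\<close>

lemma finite_ex_num_set:
  "finite {card (copies H G) | G :: nat ugraph. simple_graph G \<and> verts G = {..<n} \<and> free_of \<F> G}"
proof (rule finite_subset)
  show "{card (copies H G) | G :: nat ugraph. simple_graph G \<and> verts G = {..<n} \<and> free_of \<F> G}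
      \<subseteq> (\<lambda>E. card (copies H ({..<n}, E))) ` Pow (Pow {..<n})"
  proof
    fix x assume "x \<in> {card (copies H G) | G :: nat ugraph. simple_graph G \<and> verts G = {..<n} \<and> free_of \<F> G}"
    then obtain G :: "nat ugraph" where G: "x = card (copies H G)" "simple_graph G" "verts G = {..<n}" by blast
    have "G = ({..<n}, edges G)" using G(3) by (metis prod.collapse)
    moreover have "edges G \<in> Pow (Pow {..<n})" using edges_subset_verts[OF G(2)] G(3) by auto
    ultimately show "x \<in> (\<lambda>E. card (copies H ({..<n}, E))) ` Pow (Pow {..<n})" using G(1) by (metis imageI)
  qed
qed simp

lemma ex_num_ge:
  assumes "simple_graph G" "verts G = {..<n}" "free_of \<F> G"
  shows "card (copies H G) \<le> ex_num n H \<F>"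
  unfolding ex_num_def using assms by (intro Max_ge finite_ex_num_set) blast

text \<open>The second assumption excludes the maximum of an empty set.\<close>

lemma ex_num_le:
  fixes B :: real
  assumes "\<And>G :: nat ugraph. simple_graph G \<Longrightarrow> verts G = {..<n} \<Longrightarrow> free_of \<F> G \<Longrightarrow> real (card (copies H G)) \<le> B"
    and "\<exists>G :: nat ugraph. simple_graph G \<and> verts G = {..<n} \<and> free_of \<F> G"
  shows "real (ex_num n H \<F>) \<le> B"
proof -
  let ?S = "{card (copies H G) | G :: nat ugraph. simple_graph G \<and> verts G = {..<n} \<and> free_of \<F> G}"
  have "?S \<noteq> {}" using assms(2) by blast
  then have "ex_num n H \<F> \<in> ?S" unfolding ex_num_def by (intro Max_in finite_ex_num_set)
  then show ?thesis using assms(1) by fastforce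
qed

text \<open>Serves to pad a host graph with isolated vertices to a given order.\<close>

lemma card_cliques_image:
  assumes h: "inj_on h (verts G)" and fin: "finite V" and V: "h ` verts G \<subseteq> V"
  shows "card (cliques t G) \<le> card (cliques t (V, (\<lambda>e. h ` e) ` edges G))"
proof (rule card_inj_on_le)
  show "inj_on (\<lambda>T. h ` T) (cliques t G)"
    by (rule inj_onI) (use inj_on_image_eq_iff[OF h] in \<open>auto simp: cliques_def\<close>)
  show "(\<lambda>T. h ` T) ` cliques t G \<subseteq> cliques t (V, (\<lambda>e. h ` e) ` edges G)"
  proof (rule image_subsetI)
    fix T assume T: "T \<in> cliques t G"
    then have sub: "T \<subseteq> verts G" by (simp add: cliques_def)
    have "card (h ` T) = t" using T card_image[OF inj_on_subset[OF h sub]] by (simp add: cliques_def)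
    moreover have "{x, y} \<in> (\<lambda>e. h ` e) ` edges G" if xy: "x \<in> h ` T" "y \<in> h ` T" "x \<noteq> y" for x y
    proof -
      obtain u v where uv: "u \<in> T" "v \<in> T" "x = h u" "y = h v" using xy by blast
      then have "{u, v} \<in> edges G" using T xy(3) by (auto simp: cliques_def)
      then have "h ` {u, v} \<in> (\<lambda>e. h ` e) ` edges G" by (rule imageI)
      then show ?thesis using uv by simp
    qed
    moreover have "h ` T \<subseteq> V" using image_mono[OF sub, of h] V by (rule order_trans)
    ultimately show "h ` T \<in> cliques t (V, (\<lambda>e. h ` e) ` edges G)"
      unfolding cliques_def by simp
  qed
  show "finite (cliques t (V, (\<lambda>e. h ` e) ` edges G))"
    by (rule finite_subset[of _ "Pow V"]) (use fin in \<open>auto simp: cliques_def\<close>)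
qed

text \<open>Vertices of \<open>F\<close> outside all edges are roots; they may be mapped outside the image of \<open>h\<close>.\<close>

lemma card_rooted_embeddings_image:
  fixes F :: "nat ugraph" and G :: "'b ugraph" and h :: "'b \<Rightarrow> nat"
  assumes G: "simple_graph G" and h: "inj_on h (verts G)" and d: "d > 0"
    and F: "simple_graph F" "verts F \<subseteq> {..<M}" "R \<subseteq> verts F" "dense_over d F R"
    and bound: "\<And>F R \<psi>. simple_graph F \<Longrightarrow> verts F \<subseteq> {..<M} \<Longrightarrow> R \<subseteq> verts F \<Longrightarrow> dense_over d F R \<Longrightarrow>
       card (rooted_embeddings F R G \<psi>) \<le> L0"
  shows "card (rooted_embeddings F R (V, (\<lambda>e. h ` e) ` edges G) \<psi>) \<le> L0"
proof -
  let ?G' = "(V, (\<lambda>e. h ` e) ` edges G)"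
  define W where "W = \<Union>(edges F)"
  define F' where "F' = (W, edges F)"
  have WF: "W \<subseteq> verts F" using edges_subset_verts[OF F(1)] by (auto simp: W_def)
  have finF: "finite (verts F)" using F(1) by (simp add: simple_graph_def)
  have UW: "verts F - R \<subseteq> W"
  proof
    fix x assume x: "x \<in> verts F - R"
    then have "d * of_nat (card {x}) \<le> of_nat (card {e \<in> edges F. e \<inter> {x} \<noteq> {}})"
      using F(4) unfolding dense_over_def by blast
    then have "card {e \<in> edges F. e \<inter> {x} \<noteq> {}} \<noteq> 0" using d by auto
    then have "{e \<in> edges F. e \<inter> {x} \<noteq> {}} \<noteq> {}" by (metis card.empty)
    then show "x \<in> W" by (auto simp: W_def)
  qed
  have F'1: "simple_graph F'" using F(1) finite_subset[OF WF finF] by (auto simp: simple_graph_def F'_def W_def)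
  have F'2: "verts F' \<subseteq> {..<M}" using WF F(2) by (auto simp: F'_def)
  have F'3: "R \<inter> W \<subseteq> verts F'" by (auto simp: F'_def)
  have "verts F' - R \<inter> W = verts F - R" using UW WF by (auto simp: F'_def)
  then have F'4: "dense_over d F' (R \<inter> W)" using F(4) by (simp add: dense_over_def F'_def)
  define k where "k = inv_into (verts G) h"
  define g where "g \<phi> = (\<lambda>x\<in>W. k (\<phi> x))" for \<phi> :: "nat \<Rightarrow> nat"
  let ?S = "rooted_embeddings F R ?G' \<psi>"
  have emb: "\<phi> \<in> extensional (verts F)" "inj_on \<phi> (verts F)" "\<And>e. e \<in> edges F \<Longrightarrow> \<phi> ` e \<in> (\<lambda>e. h ` e) ` edges G"
    "\<And>r. r \<in> R \<Longrightarrow> \<phi> r = \<psi> r" if "\<phi> \<in> ?S" for \<phi>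
    using that by (simp_all add: rooted_embeddings_def embeddings_def)
  have im: "\<phi> x \<in> h ` verts G" if \<phi>: "\<phi> \<in> ?S" and x: "x \<in> W" for \<phi> x
  proof -
    obtain e where e: "e \<in> edges F" "x \<in> e" using x by (auto simp: W_def)
    obtain e' where e': "e' \<in> edges G" "\<phi> ` e = h ` e'" using emb(3)[OF \<phi> e(1)] by blast
    have "\<phi> x \<in> h ` e'" using e(2) e'(2) by blast
    then show ?thesis using edges_subset_verts[OF G e'(1)] by blast
  qed
  have hk: "h (k (\<phi> x)) = \<phi> x" "k (\<phi> x) \<in> verts G" if "\<phi> \<in> ?S" "x \<in> W" for \<phi> x
    using f_inv_into_f[OF im[OF that]] inv_into_into[OF im[OF that]] by (simp_all add: k_def)
  have "card ?S \<le> card (rooted_embeddings F' (R \<inter> W) G (\<lambda>x. k (\<psi> x)))"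
  proof (rule card_inj_on_le)
    show "inj_on g ?S"
    proof (rule inj_onI)
      fix \<phi> \<phi>' assume ph: "\<phi> \<in> ?S" "\<phi>' \<in> ?S" "g \<phi> = g \<phi>'"
      show "\<phi> = \<phi>'"
      proof (rule extensionalityI[OF emb(1)[OF ph(1)] emb(1)[OF ph(2)]])
        fix x assume x: "x \<in> verts F"
        show "\<phi> x = \<phi>' x"
        proof (cases "x \<in> R")
          case True
          then show ?thesis using emb(4)[OF ph(1)] emb(4)[OF ph(2)] by simp
        next
          case False
          then have xW: "x \<in> W" using UW x by blast
          then have "k (\<phi> x) = k (\<phi>' x)" using fun_cong[OF ph(3), of x] by (simp add: g_def)
          then show ?thesis using hk(1)[OF ph(1) xW] hk(1)[OF ph(2) xW] by metis
        qed
      qed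
    qed
    show "g ` ?S \<subseteq> rooted_embeddings F' (R \<inter> W) G (\<lambda>x. k (\<psi> x))"
    proof (rule image_subsetI)
      fix \<phi> assume \<phi>: "\<phi> \<in> ?S"
      show "g \<phi> \<in> rooted_embeddings F' (R \<inter> W) G (\<lambda>x. k (\<psi> x))"
        unfolding rooted_embeddings_def embeddings_def
      proof (intro CollectI conjI ballI)
        show "g \<phi> \<in> extensional (verts F')" by (simp add: g_def F'_def)
        show "g \<phi> ` verts F' \<subseteq> verts G" using hk(2)[OF \<phi>] by (auto simp: g_def F'_def)
        show "inj_on (g \<phi>) (verts F')"
        proof (rule inj_onI)
          fix x y assume xy: "x \<in> verts F'" "y \<in> verts F'" "g \<phi> x = g \<phi> y"
          then have W: "x \<in> W" "y \<in> W" by (simp_all add: F'_def)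
          then have "k (\<phi> x) = k (\<phi> y)" using xy(3) by (simp add: g_def)
          then have "\<phi> x = \<phi> y" using hk(1)[OF \<phi> W(1)] hk(1)[OF \<phi> W(2)] by metis
          then show "x = y" using inj_onD[OF emb(2)[OF \<phi>]] W WF by blast
        qed
        show "g \<phi> r = k (\<psi> r)" if "r \<in> R \<inter> W" for r using that emb(4)[OF \<phi>] by (simp add: g_def)
        show "g \<phi> ` e \<in> edges G" if e: "e \<in> edges F'" for e
        proof -
          have eF: "e \<in> edges F" "e \<subseteq> W" using e by (auto simp: F'_def W_def)
          obtain e' where e': "e' \<in> edges G" "\<phi> ` e = h ` e'" using emb(3)[OF \<phi> eF(1)] by blast
          have "g \<phi> ` e = k ` \<phi> ` e" unfolding image_image using eF(2) by (intro image_cong refl) (auto simp: g_def)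
          also have "\<dots> = k ` h ` e'" by (simp only: e'(2))
          also have "\<dots> = e'" unfolding k_def by (rule inv_into_image_cancel[OF h edges_subset_verts[OF G e'(1)]])
          finally show ?thesis using e'(1) by simp
        qed
      qed
    qed
    show "finite (rooted_embeddings F' (R \<inter> W) G (\<lambda>x. k (\<psi> x)))"
      using F'1 G by (intro finite_rooted_embeddings) (auto simp: simple_graph_def)
  qed
  also have "\<dots> \<le> L0" by (rule bound[OF F'1 F'2 F'3 F'4])
  finally show ?thesis .
qed

lemma rat_quotient_nat:
  fixes d :: rat
  assumes "d > 0"
  shows "\<exists>a b :: nat. a > 0 \<and> b > 0 \<and> d = of_nat b / of_nat a"
proof -
  obtain p q :: int where pq: "quotient_of d = (p, q)" by (metis prod.exhaust_sel)
  have q: "q > 0" and d: "d = of_int p / of_int q"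
    using quotient_of_denom_pos[OF pq] quotient_of_div[OF pq] by auto
  have p: "p > 0" using assms d q by (simp add: zero_less_divide_iff)
  have "d = of_nat (nat p) / of_nat (nat q)" using d p q by simp
  then show ?thesis using p q by (intro exI[of _ "nat q"] exI[of _ "nat p"]) auto
qed

text \<open>By \<open>d > t / 2\<close> the number of pairs is at most \<open>d * (t - 1)\<close>. A
  nonnegative exponent makes the power of \<open>n\<close> monotone, as the rounding of
  \<open>n\<close> requires.\<close>

lemma clique_exponent_pos:
  fixes t :: nat and d :: rat
  assumes "t \<ge> 1" "d > of_nat t / 2"
  shows "real t - real (t choose 2) / real_of_rat d \<ge> 1"
proof -
  have d0: "d > 0" using assms by (meson divide_nonneg_pos le_less_trans of_nat_0_le_iff zero_less_numeral)
  have "real_of_rat (of_nat t / 2) < real_of_rat d" using assms(2) by (simp only: of_rat_less)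
  then have d: "real t / 2 < real_of_rat d" by (simp add: of_rat_divide)
  have "real (t choose 2) = real t * (real t - 1) / 2"
    using assms(1) by (simp add: choose_two real_of_nat_div of_nat_diff)
  also have "\<dots> \<le> real_of_rat d * (real t - 1)"
    using d assms(1) mult_right_mono[of "real t / 2" "real_of_rat d" "real t - 1"] by simp
  finally have "real (t choose 2) \<le> (real t - 1) * real_of_rat d" by (simp only: mult.commute)
  moreover have "real_of_rat d > 0" using d0 by simp
  ultimately have "real (t choose 2) / real_of_rat d \<le> real t - 1" by (simp only: pos_divide_le_eq)
  then show ?thesis by linarith
qed

theorem power_free_graphs_with_many_cliques:
  fixes t M :: nat and d :: rat
  assumes t: "t \<ge> 1" and d: "d > of_nat t / 2" and M: "M \<ge> 1"
  shows "\<exists>L0 n0. \<exists>c>0. \<forall>n\<ge>n0. \<exists>G :: nat ugraph. simple_graph G \<and> verts G = {..<n} \<and>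
     (\<forall>L>L0. power_free M d L G) \<and>
     c * real n powr (real t - real (t choose 2) / real_of_rat d) \<le> real (card (cliques t G))"
proof -
  have d0: "d > 0" using d by (meson divide_nonneg_pos le_less_trans of_nat_0_le_iff zero_less_numeral)
  obtain a b :: nat where ab: "a > 0" "b > 0" "d = of_nat b / of_nat a" using rat_quotient_nat[OF d0] by blast
  define r where "r = real t - real (t choose 2) / real_of_rat d"
  have r1: "r \<ge> 1" unfolding r_def by (rule clique_exponent_pos[OF t d])
  have dr: "real_of_rat d = real b / real a" by (simp add: ab(3) of_rat_divide)
  obtain L0 q0 where host: "\<And>A :: bit alg_closure set. finite_subfield A \<Longrightarrow> q0 \<le> card A \<Longrightarrow>
     (\<exists>G::(nat \<Rightarrow> bit alg_closure) ugraph. simple_graph G \<and> card (verts G) = card A ^ b \<and>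
        (card A ^ b choose t) \<le> 2 * card A ^ (a * (t choose 2)) * card (cliques t G) \<and>
        (\<forall>F R \<psi>. simple_graph F \<longrightarrow> verts F \<subseteq> {..<M} \<longrightarrow> R \<subseteq> verts F \<longrightarrow>
           dense_over (of_nat b / of_nat a) F R \<longrightarrow> card (rooted_embeddings F R G \<psi>) \<le> L0))"
    using algebraic_host_graphs[OF t M ab(1,2), where 'a = "bit alg_closure"] by (elim exE) blast
  define p0 where "p0 = q0 + t + 1"
  \<comment> \<open>The factor 2 comes from averaging, \<open>t ^ t\<close> from the binomial
    coefficient, and \<open>(2 ^ b) powr r\<close> from rounding \<open>n\<close> down to some
    \<open>q ^ b\<close>.\<close>
  define c where "c = 1 / (2 * real t ^ t * (2 ^ b) powr r)"
  have c: "c > 0" using t by (simp add: c_def)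
  have main: "\<exists>G :: nat ugraph. simple_graph G \<and> verts G = {..<n} \<and> (\<forall>L>L0. power_free M d L G) \<and>
     c * real n powr r \<le> real (card (cliques t G))" if n: "n \<ge> 2 ^ (p0 * b)" for n
  proof -
    \<comment> \<open>The exponents \<open>m\<close> for which the host over the field of order
      \<open>2 ^ m\<close> fits into \<open>n\<close> vertices. For the largest one, q =
      \<open>2 ^ m\<close> satisfies \<open>n < 2 ^ b * q ^ b\<close>.\<close>
    define S where "S = {m. 2 ^ (m * b) \<le> n}"
    have Sb: "m \<le> n" if "m \<in> S" for m
    proof -
      have "m < 2 ^ m" by (rule less_exp)
      also have "(2::nat) ^ m \<le> 2 ^ (m * b)" using ab(2) by (intro power_increasing) auto
      also have "\<dots> \<le> n" using that by (simp add: S_def)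
      finally show ?thesis by simp
    qed
    then have finS: "finite S" by (meson finite_nat_set_iff_bounded_le)
    have p0S: "p0 \<in> S" using n by (simp add: S_def)
    define m where "m = Max S"
    have mS: "m \<in> S" unfolding m_def using finS p0S by (intro Max_in) auto
    have mp0: "m \<ge> p0" unfolding m_def using finS p0S by simp
    have "Suc m \<notin> S" using Max_ge[OF finS, of "Suc m"] by (auto simp: m_def[symmetric])
    then have nlt: "n < 2 ^ (Suc m * b)" by (simp add: S_def)
    define A where "A = pow2_field m"
    define q where "q = card A"
    have m1: "m \<ge> 1" using mp0 by (simp add: p0_def)
    have q: "q = 2 ^ m" unfolding q_def A_def by (rule card_pow2_field[OF m1])
    have "m < 2 ^ m" by (rule less_exp)
    then have qp0: "q \<ge> p0" using mp0 q by linarith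
    obtain G0 :: "(nat \<Rightarrow> bit alg_closure) ugraph" where G0: "simple_graph G0" "card (verts G0) = q ^ b"
        "(q ^ b choose t) \<le> 2 * q ^ (a * (t choose 2)) * card (cliques t G0)"
        "\<And>F R \<psi>. simple_graph F \<Longrightarrow> verts F \<subseteq> {..<M} \<Longrightarrow> R \<subseteq> verts F \<Longrightarrow>
           dense_over d F R \<Longrightarrow> card (rooted_embeddings F R G0 \<psi>) \<le> L0"
    proof -
      have "finite_subfield A" unfolding A_def by (rule finite_subfield_pow2_field[OF m1])
      moreover have "q0 \<le> card A" using qp0 by (simp add: q_def p0_def)
      ultimately show ?thesis using host[of A] that unfolding q_def ab(3) by blast
    qed
    have qbn: "q ^ b \<le> n" using mS by (simp add: S_def q power_mult)
    have finV: "finite (verts G0)" using G0(1) by (simp add: simple_graph_def)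
    obtain h where h: "bij_betw h (verts G0) {0..<q ^ b}"
      using ex_bij_betw_finite_nat[OF finV] G0(2) by auto
    have inj: "inj_on h (verts G0)" and him: "h ` verts G0 = {0..<q ^ b}" using h by (auto simp: bij_betw_def)
    have hsub: "h ` verts G0 \<subseteq> {..<n}" using him qbn by auto
    define G where "G = ({..<n}, (\<lambda>e. h ` e) ` edges G0)"
    have sG: "simple_graph G"
      unfolding simple_graph_def
    proof (intro conjI ballI)
      show "finite (verts G)" by (simp add: G_def)
      fix e assume "e \<in> edges G"
      then obtain e' where e': "e' \<in> edges G0" "e = h ` e'" by (auto simp: G_def)
      have sub: "e' \<subseteq> verts G0" by (rule edges_subset_verts[OF G0(1) e'(1)])
      show "e \<subseteq> verts G" using image_mono[OF sub, of h] hsub by (simp add: G_def e'(2))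
      have "card e' = 2" using G0(1) e'(1) by (simp add: simple_graph_def)
      then show "card e = 2" unfolding e'(2) card_image[OF inj_on_subset[OF inj sub]] .
    qed
    have vG: "verts G = {..<n}" by (simp add: G_def)
    have free: "power_free M d L G" if L: "L > L0" for L
      unfolding power_free_def
    proof (intro ballI, clarify)
      fix F R assume FR: "(F, R) \<in> balanced_family M d"
      then have F: "simple_graph F" "R \<subseteq> verts F" "verts F \<subseteq> {..<M}" "balanced F R" "d \<le> rooted_density F R"
        by (auto simp: balanced_family_def rooted_graph_def)
      have dn: "dense_over d F R"
        using F by (intro dense_over_balanced) (auto simp: simple_graph_def)
      show "free_of (rooted_power F R L) G"
        unfolding free_of_def
      proof (intro ballI, rule ccontr)
        fix P assume P: "P \<in> rooted_power F R L" "copies P G \<noteq> {}"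
        obtain \<psi> where "L \<le> card (rooted_embeddings F R G \<psi>)"
          using rooted_power_in_graph[OF F(1,2) _ P] vG by auto
        also have "\<dots> \<le> L0"
          unfolding G_def by (rule card_rooted_embeddings_image[OF G0(1) inj d0 F(1,3,2) dn G0(4)])
        finally show False using L by simp
      qed
    qed
    have q0': "q > 0" by (simp add: q)
    have "t \<le> q" using qp0 by (simp add: p0_def)
    also have "q \<le> q ^ b" using ab(2) q0' by (simp add: self_le_power)
    finally have tq: "t \<le> q ^ b" .
    have "(real (q ^ b) / real t) ^ t \<le> real (q ^ b choose t)" by (rule binomial_ge_n_over_k_pow_k[OF tq])
    also have "\<dots> \<le> real (2 * q ^ (a * (t choose 2)) * card (cliques t G0))" using G0(3) by (simp only: of_nat_le_iff)
    also have "\<dots> \<le> real (2 * q ^ (a * (t choose 2)) * card (cliques t G))"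
      using card_cliques_image[OF inj _ hsub] by (simp add: G_def mult_left_mono)
    finally have cl: "(real (q ^ b) / real t) ^ t \<le> 2 * real q ^ (a * (t choose 2)) * real (card (cliques t G))" by simp
    have q0r: "real q > 0" using q0' by simp
    \<comment> \<open>Since d = b/a, the exponent \<open>b * r\<close> equals bt - a(t choose 2),
      which is the order of the clique count of the host.\<close>
    have qr: "real (q ^ b) powr r * real q ^ (a * (t choose 2)) = real (q ^ b) ^ t"
    proof -
      have "real (q ^ b) powr r = real q powr (real b * r)"
        using q0' by (simp add: powr_powr powr_realpow[symmetric])
      also have "real b * r = real (b * t) - real (a * (t choose 2))"
        unfolding r_def dr using ab(1,2) by (simp add: field_simps)
      also have "real q powr (real (b * t) - real (a * (t choose 2))) = real q ^ (b * t) / real q ^ (a * (t choose 2))"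
        unfolding powr_diff powr_realpow[OF q0r] ..
      finally have e: "real (q ^ b) powr r = real q ^ (b * t) / real q ^ (a * (t choose 2))" .
      have "real (q ^ b) ^ t = real q ^ (b * t)" by (simp add: power_mult)
      then show ?thesis unfolding e using q0r by simp
    qed
    have "real n powr r \<le> (2 ^ b * real (q ^ b)) powr r"
    proof (rule powr_mono2)
      have "n \<le> 2 ^ b * q ^ b" using nlt by (simp add: q power_add power_mult)
      then have "real n \<le> real (2 ^ b * q ^ b)" by (simp only: of_nat_le_iff)
      then show "real n \<le> 2 ^ b * real (q ^ b)" by simp
    qed (use r1 in auto)
    also have "\<dots> = (2 ^ b) powr r * real (q ^ b) powr r" by (simp add: powr_mult)
    finally have "c * real n powr r \<le> c * ((2 ^ b) powr r * real (q ^ b) powr r)" using c by simp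
    also have "\<dots> = real (q ^ b) powr r / (2 * real t ^ t)" by (simp add: c_def)
    also have "\<dots> \<le> real (card (cliques t G))"
    proof -
      have "real (q ^ b) powr r * real q ^ (a * (t choose 2)) / real t ^ t
          \<le> 2 * real q ^ (a * (t choose 2)) * real (card (cliques t G))"
        using cl unfolding qr by (simp add: power_divide)
      then have "real q ^ (a * (t choose 2)) * (real (q ^ b) powr r / real t ^ t)
          \<le> real q ^ (a * (t choose 2)) * (2 * real (card (cliques t G)))" by (simp add: mult_ac)
      then have "real (q ^ b) powr r / real t ^ t \<le> 2 * real (card (cliques t G))"
        by (rule mult_left_le_imp_le) (use q0r in simp)
      then show ?thesis by simp
    qed
    finally show ?thesis using sG vG free by blast
  qed
  show ?thesis unfolding r_def[symmetric] using c main by blast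
qed

section \<open>Trees of cliques in hypergraphs\<close>

definition hdeg :: "'a set set \<Rightarrow> 'a set \<Rightarrow> nat" where
  "hdeg H Q = card {P \<in> H. Q \<subseteq> P}"

text \<open>Whenever some \<open>Q\<close> violates its bound, delete all edges on \<open>Q\<close>.
  This costs less than \<open>\<alpha> Q\<close> and happens at most once for each \<open>Q\<close>,
  which afterwards lies in no edge.\<close>

lemma clean_hypergraph:
  fixes \<alpha> :: "'a set \<Rightarrow> real"
  assumes "finite \<Q>" "finite H0" "(\<Sum>Q\<in>\<Q>. \<alpha> Q) + \<beta> \<le> real (card H0)" "\<And>Q. Q \<in> \<Q> \<Longrightarrow> \<alpha> Q \<ge> 0"
  shows "\<exists>H\<subseteq>H0. \<beta> \<le> real (card H) \<and> (\<forall>Q\<in>\<Q>. \<forall>P\<in>H. Q \<subseteq> P \<longrightarrow> \<alpha> Q \<le> real (hdeg H Q))"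
  using assms
proof (induction "card \<Q>" arbitrary: \<Q> H0)
  case 0
  then show ?case by (intro exI[of _ H0]) simp
next
  case (Suc k)
  show ?case
  proof (cases "\<forall>Q\<in>\<Q>. \<forall>P\<in>H0. Q \<subseteq> P \<longrightarrow> \<alpha> Q \<le> real (hdeg H0 Q)")
    case True
    have "sum \<alpha> \<Q> \<ge> 0" using Suc.prems(4) by (rule sum_nonneg)
    then show ?thesis using True Suc.prems(3) by (intro exI[of _ H0]) simp
  next
    case False
    then obtain Q where Q: "Q \<in> \<Q>" "real (hdeg H0 Q) < \<alpha> Q" by force
    define H1 where "H1 = H0 - {P \<in> H0. Q \<subseteq> P}"
    have "card H1 = card H0 - hdeg H0 Q" unfolding H1_def hdeg_def using Suc.prems(2) by (intro card_Diff_subset) auto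
    moreover have "hdeg H0 Q \<le> card H0" unfolding hdeg_def using Suc.prems(2) by (intro card_mono) auto
    ultimately have H1: "real (card H1) = real (card H0) - real (hdeg H0 Q)" by simp
    have "sum \<alpha> \<Q> = \<alpha> Q + sum \<alpha> (\<Q> - {Q})" using Suc.prems(1) Q(1) by (rule sum.remove)
    then have "sum \<alpha> (\<Q> - {Q}) + \<beta> \<le> real (card H1)" using Suc.prems(3) Q(2) H1 by linarith
    moreover have "k = card (\<Q> - {Q})" using Suc.hyps(2) Q(1) by simp
    ultimately obtain H where H: "H \<subseteq> H1" "\<beta> \<le> real (card H)"
      "\<forall>Q'\<in>\<Q> - {Q}. \<forall>P\<in>H. Q' \<subseteq> P \<longrightarrow> \<alpha> Q' \<le> real (hdeg H Q')"
      using Suc.hyps(1)[of "\<Q> - {Q}" H1] Suc.prems by (auto simp: H1_def)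
    have "\<alpha> Q' \<le> real (hdeg H Q')" if "Q' \<in> \<Q>" "P \<in> H" "Q' \<subseteq> P" for Q' P
    proof (cases "Q' = Q")
      case True
      then show ?thesis using that H(1) by (auto simp: H1_def)
    next
      case False
      then have "Q' \<in> \<Q> - {Q}" using that(1) by simp
      then show ?thesis using H(3) that(2,3) by blast
    qed
    moreover have "H \<subseteq> H0" using H(1) by (auto simp: H1_def)
    ultimately show ?thesis using H(2) by blast
  qed
qed

text \<open>Edges on \<open>Q\<close> that meet \<open>Y\<close> are few: such an edge \<open>P\<close> contains a \<open>p\<close>-set \<open>Q'\<close> with
  \<open>Q \<subseteq> Q'\<close> missing a point of \<open>P \<inter> Y\<close>; \<open>Q'\<close> lies in many edges, but together with that point
  in few.\<close>

lemma hdeg_avoiding: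
  assumes H: "finite H" "\<And>P. P \<in> H \<Longrightarrow> finite P \<and> card P = t" and p: "p < t"
    and pdeg: "\<And>P Q. P \<in> H \<Longrightarrow> Q \<subseteq> P \<Longrightarrow> card Q = p \<Longrightarrow> \<kappa> \<le> hdeg H Q"
    and p1deg: "\<And>Q. card Q = p + 1 \<Longrightarrow> hdeg H Q \<le> B"
    and Q: "card Q \<le> p" "finite Q" and Y: "finite Y" "Y \<inter> Q = {}" "card Y \<le> m"
    and \<kappa>: "2 * (2 ^ t * (m * B)) \<le> \<kappa>" "\<kappa> > 0"
  shows "hdeg H Q \<le> 2 * card {P \<in> H. Q \<subseteq> P \<and> P \<inter> Y = {}}"
proof -
  define Bad where "Bad = {P \<in> H. Q \<subseteq> P \<and> P \<inter> Y \<noteq> {}}"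
  have finBad: "finite Bad" using H(1) by (simp add: Bad_def)
  have "\<forall>P\<in>Bad. \<exists>Q' y. Q \<subseteq> Q' \<and> Q' \<subseteq> P \<and> card Q' = p \<and> y \<in> P \<inter> Y \<and> y \<notin> Q'"
  proof
    fix P assume P: "P \<in> Bad"
    then obtain y where y: "y \<in> P \<inter> Y" by (auto simp: Bad_def)
    have PH: "finite P" "card P = t" using P H(2) by (auto simp: Bad_def)
    have sub: "Q \<subseteq> P - {y}" using P y Y(2) by (auto simp: Bad_def)
    have "p - card Q \<le> card (P - {y} - Q)"
      using PH y sub p Q by (simp add: card_Diff_subset)
    then obtain Z where Z: "Z \<subseteq> P - {y} - Q" "card Z = p - card Q" "finite Z" by (rule obtain_subset_with_card_n)
    have "card (Q \<union> Z) = p" using Z Q by (subst card_Un_disjoint) auto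
    then show "\<exists>Q' y. Q \<subseteq> Q' \<and> Q' \<subseteq> P \<and> card Q' = p \<and> y \<in> P \<inter> Y \<and> y \<notin> Q'"
      using Z(1) sub y by (intro exI[of _ "Q \<union> Z"] exI[of _ y]) auto
  qed
  then obtain q y where q: "\<And>P. P \<in> Bad \<Longrightarrow> Q \<subseteq> q P" "\<And>P. P \<in> Bad \<Longrightarrow> q P \<subseteq> P" "\<And>P. P \<in> Bad \<Longrightarrow> card (q P) = p"
     "\<And>P. P \<in> Bad \<Longrightarrow> y P \<in> P \<inter> Y" "\<And>P. P \<in> Bad \<Longrightarrow> y P \<notin> q P" by metis
  define N where "N = {P \<in> H. Q \<subseteq> P}"
  have finN: "finite N" using H(1) by (simp add: N_def)
  \<comment> \<open>Count pairs of a bad \<open>P\<close> and an edge \<open>P'\<close> on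
    \<open>Q\<close> with \<open>q P \<subseteq> P'\<close>. Each \<open>P\<close> is in at least
    \<open>\<kappa>\<close> of them; for given \<open>P'\<close> there are at most
    \<open>2 ^ t\<close> choices of \<open>q P\<close>, \<open>m\<close> of \<open>y P\<close>, and
    then \<open>B\<close> of \<open>P\<close>.\<close>
  have "card Bad * \<kappa> \<le> (\<Sum>P\<in>Bad. card {P'\<in>N. q P \<subseteq> P'})"
  proof -
    have "\<kappa> \<le> card {P'\<in>N. q P \<subseteq> P'}" if P: "P \<in> Bad" for P
    proof -
      have "{P'\<in>N. q P \<subseteq> P'} = {P'\<in>H. q P \<subseteq> P'}" using q(1)[OF P] by (auto simp: N_def)
      then show ?thesis using pdeg[of P "q P"] q[OF P] P by (simp add: Bad_def hdeg_def)
    qed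
    then show ?thesis using sum_mono[of Bad "\<lambda>_. \<kappa>" "\<lambda>P. card {P'\<in>N. q P \<subseteq> P'}"] by simp
  qed
  also have "\<dots> = (\<Sum>P'\<in>N. card {P\<in>Bad. q P \<subseteq> P'})"
    by (rule sum_multicount_gen[OF finBad finN]) simp
  also have "\<dots> \<le> (\<Sum>P'\<in>N. 2 ^ t * (m * B))"
  proof (rule sum_mono)
    fix P' assume "P' \<in> N"
    then have P': "finite P'" "card P' = t" using H(2) by (auto simp: N_def)
    let ?I = "{Q' \<in> Pow P'. card Q' = p} \<times> Y"
    let ?C = "\<lambda>i. if snd i \<in> fst i then {} else {P\<in>H. insert (snd i) (fst i) \<subseteq> P}"
    have "{P\<in>Bad. q P \<subseteq> P'} \<subseteq> (\<Union>i\<in>?I. ?C i)"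
    proof
      fix P assume P: "P \<in> {P\<in>Bad. q P \<subseteq> P'}"
      then have PB: "P \<in> Bad" "q P \<subseteq> P'" by simp_all
      have "(q P, y P) \<in> ?I" using PB q(3,4)[OF PB(1)] by simp
      moreover have "P \<in> ?C (q P, y P)" using q[OF PB(1)] PB(1) by (simp add: Bad_def)
      ultimately show "P \<in> (\<Union>i\<in>?I. ?C i)" by (rule UN_I)
    qed
    moreover have finI: "finite ?I" using P' Y(1) by simp
    ultimately have "card {P\<in>Bad. q P \<subseteq> P'} \<le> card (\<Union>i\<in>?I. ?C i)"
      using H(1) by (intro card_mono) auto
    also have "\<dots> \<le> (\<Sum>i\<in>?I. card (?C i))" by (rule card_UN_le[OF finI])
    also have "\<dots> \<le> (\<Sum>i\<in>?I. B)"
    proof (rule sum_mono)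
      fix i assume i: "i \<in> ?I"
      show "card (?C i) \<le> B"
      proof (cases "snd i \<in> fst i")
        case False
        have "finite (fst i)" "card (fst i) = p" using i P'(1) finite_subset by auto
        then have "card (insert (snd i) (fst i)) = p + 1" using False by simp
        then show ?thesis using p1deg[of "insert (snd i) (fst i)"] False by (simp add: hdeg_def)
      qed simp
    qed
    also have "\<dots> = card ?I * B" by simp
    also have "\<dots> \<le> (2 ^ t * m) * B"
    proof (rule mult_le_mono1)
      have "card {Q' \<in> Pow P'. card Q' = p} \<le> card (Pow P')" using P' by (intro card_mono) auto
      then have "card {Q' \<in> Pow P'. card Q' = p} \<le> 2 ^ t" using P' by (simp add: card_Pow)
      then show "card ?I \<le> 2 ^ t * m" using Y(3) by (simp only: card_cartesian_product mult_le_mono)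
    qed
    finally show "card {P\<in>Bad. q P \<subseteq> P'} \<le> 2 ^ t * (m * B)" by simp
  qed
  also have "\<dots> = card N * (2 ^ t * (m * B))" by simp
  finally have "2 * (card Bad * \<kappa>) \<le> card N * (2 * (2 ^ t * (m * B)))" by simp
  also have "\<dots> \<le> card N * \<kappa>" using \<kappa>(1) by (rule mult_le_mono2)
  finally have "(2 * card Bad) * \<kappa> \<le> card N * \<kappa>" by simp
  then have "2 * card Bad \<le> card N" using \<kappa>(2) by simp
  moreover have "card N = card Bad + card {P \<in> H. Q \<subseteq> P \<and> P \<inter> Y = {}}"
  proof -
    have "N = Bad \<union> {P \<in> H. Q \<subseteq> P \<and> P \<inter> Y = {}}" by (auto simp: N_def Bad_def)
    then show ?thesis using finBad H(1) by (simp, subst card_Un_disjoint) (auto simp: Bad_def)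
  qed
  ultimately show ?thesis by (simp add: hdeg_def N_def)
qed

section \<open>Embedding clique trees\<close>

text \<open>New vertices avoid all earlier ones, so a new clique meets the earlier tree exactly in
  \<open>Q\<close>. Single vertices and \<open>p\<close>-sets are the sets whose degrees the
  cleaning controls.\<close>

inductive clique_tree :: "nat \<Rightarrow> nat \<Rightarrow> nat set set \<Rightarrow> bool" for t p where
  base: "finite T \<Longrightarrow> card T = t \<Longrightarrow> clique_tree t p {T}"
| step: "clique_tree t p \<C> \<Longrightarrow> T1 \<in> \<C> \<Longrightarrow> Q \<subseteq> T1 \<Longrightarrow> card Q = 1 \<or> card Q = p \<Longrightarrow> finite N \<Longrightarrow>
    N \<inter> \<Union>\<C> = {} \<Longrightarrow> card N + card Q = t \<Longrightarrow> clique_tree t p (insert (Q \<union> N) \<C>)"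

definition pairs :: "'a set \<Rightarrow> 'a set set" where
  "pairs T = {e. e \<subseteq> T \<and> card e = 2}"

definition tree_graph :: "nat set set \<Rightarrow> nat ugraph" where
  "tree_graph \<C> = (\<Union>\<C>, \<Union>(pairs ` \<C>))"

lemma card_pairs: "finite T \<Longrightarrow> card (pairs T) = card T choose 2"
  unfolding pairs_def by (rule n_subsets)

lemma finite_pairs: "finite T \<Longrightarrow> finite (pairs T)"
  unfolding pairs_def by simp

lemma clique_tree_finite:
  assumes "clique_tree t p \<C>"
  shows "finite \<C>" "\<And>T. T \<in> \<C> \<Longrightarrow> finite T \<and> card T = t"
  using assms
proof (induction rule: clique_tree.induct)
  case (step \<C> T1 Q N)
  {
    case 1 show ?case using step by simp
  next
    case (2 T)
    show ?case
    proof (cases "T \<in> \<C>")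
      case False
      then have T: "T = Q \<union> N" using 2 by simp
      have finQ: "finite Q" using step by (meson finite_subset)
      have "Q \<inter> N = {}" using step by auto
      then show ?thesis using T finQ step by (simp add: card_Un_disjoint)
    qed (use step in simp)
  }
qed auto

lemma simple_graph_tree_graph:
  assumes "clique_tree t p \<C>"
  shows "simple_graph (tree_graph \<C>)"
  using clique_tree_finite[OF assms] by (auto simp: simple_graph_def tree_graph_def pairs_def)

definition tree_embeddings :: "nat set set \<Rightarrow> 'b set set \<Rightarrow> (nat \<Rightarrow> 'b) set" where
  "tree_embeddings \<C> H = {\<phi> \<in> extensional (\<Union>\<C>). inj_on \<phi> (\<Union>\<C>) \<and> (\<forall>T\<in>\<C>. \<phi> ` T \<in> H)}"

lemma finite_tree_embeddings:
  assumes "clique_tree t p \<C>" "finite H" "\<And>P. P \<in> H \<Longrightarrow> finite P"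
  shows "finite (tree_embeddings \<C> H)"
proof (rule finite_subset)
  show "tree_embeddings \<C> H \<subseteq> PiE (\<Union>\<C>) (\<lambda>_. \<Union>H)"
  proof
    fix \<phi> assume \<phi>: "\<phi> \<in> tree_embeddings \<C> H"
    have "\<phi> x \<in> \<Union>H" if "x \<in> \<Union>\<C>" for x using that \<phi> by (auto simp: tree_embeddings_def)
    then show "\<phi> \<in> PiE (\<Union>\<C>) (\<lambda>_. \<Union>H)" using \<phi> by (auto simp: tree_embeddings_def PiE_def)
  qed
  show "finite (PiE (\<Union>\<C>) (\<lambda>_. \<Union>H))"
    using clique_tree_finite[OF assms(1)] assms(2,3) by (intro finite_PiE) auto
qed

text \<open>Embed clique by clique: by \<open>hdeg_avoiding\<close>, at least half of the cliques on
  the image of \<open>Q\<close> avoid the rest of the image, which leaves \<open>w (card Q)\<close>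
  extensions. The bound \<open>f\<close> stays abstract, as only its growth in one step
  matters.\<close>

lemma card_tree_embeddings:
  fixes H :: "'b set set" and w :: "nat \<Rightarrow> real" and \<C> :: "nat set set"
  assumes H: "finite H" "\<And>P. P \<in> H \<Longrightarrow> finite P \<and> card P = t" and p: "1 \<le> p" "p < t"
    and pdeg: "\<And>P Q. P \<in> H \<Longrightarrow> Q \<subseteq> P \<Longrightarrow> card Q = p \<Longrightarrow> \<kappa> \<le> hdeg H Q"
    and p1deg: "\<And>Q. card Q = p + 1 \<Longrightarrow> hdeg H Q \<le> B"
    and \<kappa>: "2 * (2 ^ t * (m * B)) \<le> \<kappa>" "\<kappa> > 0"
    and w: "w 1 \<ge> 0" "w p \<ge> 0"
    and deg: "\<And>P Q. P \<in> H \<Longrightarrow> Q \<subseteq> P \<Longrightarrow> card Q = 1 \<or> card Q = p \<Longrightarrow> 2 * w (card Q) \<le> real (hdeg H Q)"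
    and tree: "clique_tree t p \<C>" and m: "card (\<Union>\<C>) \<le> m"
    and f: "\<And>T. finite T \<Longrightarrow> card T = t \<Longrightarrow> f {T} \<le> real (card H)"
      "\<And>\<C> Q N. clique_tree t p \<C> \<Longrightarrow> clique_tree t p (insert (Q \<union> N) \<C>) \<Longrightarrow> Q \<subseteq> \<Union>\<C> \<Longrightarrow> \<exists>T1\<in>\<C>. Q \<subseteq> T1 \<Longrightarrow>
         N \<inter> \<Union>\<C> = {} \<Longrightarrow> card Q = 1 \<or> card Q = p \<Longrightarrow> card N + card Q = t \<Longrightarrow> finite N \<Longrightarrow>
         f (insert (Q \<union> N) \<C>) \<le> f \<C> * w (card Q)"
  shows "f \<C> \<le> real (card (tree_embeddings \<C> H))"
  using tree m
proof (induction rule: clique_tree.induct)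
  case (base T)
  have "\<forall>P\<in>H. \<exists>g. bij_betw g T P"
    using base H(2) by (metis finite_same_card_bij)
  then obtain g where g: "\<And>P. P \<in> H \<Longrightarrow> bij_betw (g P) T P" by metis
  have "card H \<le> card (tree_embeddings {T} H)"
  proof (rule card_inj_on_le)
    show "inj_on (\<lambda>P. restrict (g P) T) H"
    proof (rule inj_onI)
      fix P P' assume P: "P \<in> H" "P' \<in> H" "restrict (g P) T = restrict (g P') T"
      have "restrict (g P) T ` T = P" "restrict (g P') T ` T = P'"
        using g P(1,2) by (simp_all add: bij_betw_def)
      then show "P = P'" using P(3) by simp
    qed
    show "(\<lambda>P. restrict (g P) T) ` H \<subseteq> tree_embeddings {T} H"
    proof (rule image_subsetI)
      fix P assume P: "P \<in> H"
      then have "inj_on (g P) T" "g P ` T = P" using g by (auto simp: bij_betw_def)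
      then show "restrict (g P) T \<in> tree_embeddings {T} H"
        using P by (simp add: tree_embeddings_def inj_on_restrict_eq)
    qed
    show "finite (tree_embeddings {T} H)"
      using clique_tree.base[OF base(1,2), of p] H by (intro finite_tree_embeddings) auto
  qed
  then show ?case using f(1)[OF base(1,2)] by linarith
next
  case (step \<C> T1 Q N)
  define V where "V = \<Union>\<C>"
  have T1: "finite T1" "card T1 = t" using clique_tree_finite[OF step(1)] step(2) by auto
  have QV: "Q \<subseteq> V" using step(2,3) by (auto simp: V_def)
  have finV: "finite V" using clique_tree_finite[OF step(1)] by (auto simp: V_def)
  have finQ: "finite Q" using QV finV finite_subset by blast
  have new: "clique_tree t p (insert (Q \<union> N) \<C>)" by (rule clique_tree.step[OF step(1-7)])
  have U': "\<Union>(insert (Q \<union> N) \<C>) = V \<union> N" using QV by (auto simp: V_def)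
  have cV: "card V \<le> m"
    using step(9) card_mono[of "V \<union> N" V] finV step(5) unfolding U' by simp
  have NV: "N \<inter> V = {}" using step(6) by (simp add: V_def)
  have IH: "f \<C> \<le> real (card (tree_embeddings \<C> H))" using step(8) cV by (simp add: V_def)
  let ?E = "tree_embeddings \<C> H" and ?E' = "tree_embeddings (insert (Q \<union> N) \<C>) H"
  have finE: "finite ?E" and finE': "finite ?E'"
    using H by (auto intro!: finite_tree_embeddings[OF step(1)] finite_tree_embeddings[OF new])
  define Ext where "Ext \<phi> = {P \<in> H. \<phi> ` Q \<subseteq> P \<and> P \<inter> (\<phi> ` V - \<phi> ` Q) = {}}" for \<phi> :: "nat \<Rightarrow> 'b"
  have ext: "w (card Q) \<le> real (card (Ext \<phi>))" if \<phi>: "\<phi> \<in> ?E" for \<phi>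
  proof -
    have inj: "inj_on \<phi> V" and T1H: "\<phi> ` T1 \<in> H" using \<phi> step(2) by (auto simp: tree_embeddings_def V_def)
    have cQ: "card (\<phi> ` Q) = card Q" by (rule card_image[OF inj_on_subset[OF inj QV]])
    have "hdeg H (\<phi> ` Q) \<le> 2 * card {P \<in> H. \<phi> ` Q \<subseteq> P \<and> P \<inter> (\<phi> ` V - \<phi> ` Q) = {}}"
    proof (rule hdeg_avoiding[OF H p(2) pdeg p1deg _ _ _ _ _ \<kappa>])
      show "card (\<phi> ` Q) \<le> p" using cQ step(4) p(1) by auto
      show "card (\<phi> ` V - \<phi> ` Q) \<le> m"
        using cV card_image_le[OF finV, of \<phi>] card_mono[of "\<phi> ` V" "\<phi> ` V - \<phi> ` Q"] finV by fastforce
    qed (use finQ finV in auto)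
    moreover have "2 * w (card (\<phi> ` Q)) \<le> real (hdeg H (\<phi> ` Q))"
      using deg[OF T1H, of "\<phi> ` Q"] step(3,4) cQ by (simp add: image_mono)
    ultimately show ?thesis using cQ by (simp add: Ext_def)
  qed
  have "\<forall>\<phi>\<in>?E. \<forall>P\<in>Ext \<phi>. \<exists>g. bij_betw g N (P - \<phi> ` Q)"
  proof (intro ballI)
    fix \<phi> P assume \<phi>: "\<phi> \<in> ?E" and P: "P \<in> Ext \<phi>"
    have inj: "inj_on \<phi> V" using \<phi> by (simp add: tree_embeddings_def V_def)
    have "card (P - \<phi> ` Q) = card P - card (\<phi> ` Q)"
      using P finQ by (intro card_Diff_subset) (auto simp: Ext_def)
    also have "\<dots> = card N"
      using P H(2) step(7) card_image[OF inj_on_subset[OF inj QV]] by (auto simp: Ext_def)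
    finally show "\<exists>g. bij_betw g N (P - \<phi> ` Q)"
      using step(5) P H(2) by (intro finite_same_card_bij) (auto simp: Ext_def)
  qed
  then obtain g where g: "\<And>\<phi> P. \<phi> \<in> ?E \<Longrightarrow> P \<in> Ext \<phi> \<Longrightarrow> bij_betw (g \<phi> P) N (P - \<phi> ` Q)" by metis
  define h where "h = (\<lambda>(\<phi>, P). \<lambda>x\<in>V \<union> N. if x \<in> V then \<phi> x else g \<phi> P x)"
  let ?S = "Sigma ?E Ext"
  have hV: "h (\<phi>, P) x = \<phi> x" if "x \<in> V" for \<phi> P x using that by (simp add: h_def)
  have hN: "h (\<phi>, P) x = g \<phi> P x" if "x \<in> N" for \<phi> P x using that NV by (auto simp: h_def)
  have himg: "h (\<phi>, P) ` (Q \<union> N) = P" if S: "(\<phi>, P) \<in> ?S" for \<phi> P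
  proof -
    have "h (\<phi>, P) ` Q = \<phi> ` Q" using hV QV by (intro image_cong) auto
    moreover have "h (\<phi>, P) ` N = g \<phi> P ` N" using hN by (intro image_cong) auto
    moreover have "g \<phi> P ` N = P - \<phi> ` Q" using g[of \<phi> P] S by (auto simp: bij_betw_def)
    moreover have "\<phi> ` Q \<subseteq> P" using S by (auto simp: Ext_def)
    ultimately show ?thesis by (auto simp: image_Un)
  qed
  have "card ?S \<le> card ?E'"
  proof (rule card_inj_on_le[OF _ _ finE'])
    show "inj_on h ?S"
    proof (rule inj_onI)
      fix s s' assume s: "s \<in> ?S" "s' \<in> ?S" "h s = h s'"
      obtain \<phi> P where sp: "s = (\<phi>, P)" by (metis prod.exhaust_sel)
      obtain \<phi>' P' where sp': "s' = (\<phi>', P')" by (metis prod.exhaust_sel)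
      have "P = P'" using himg[of \<phi> P] himg[of \<phi>' P'] s by (simp add: sp sp')
      moreover have "\<phi> = \<phi>'"
      proof (rule extensionalityI[of _ V])
        show "\<phi> \<in> extensional V" "\<phi>' \<in> extensional V"
          using s(1,2) by (simp_all add: sp sp' tree_embeddings_def V_def)
        fix x assume "x \<in> V"
        then show "\<phi> x = \<phi>' x" using hV[of x \<phi> P] hV[of x \<phi>' P'] s(3) by (simp add: sp sp')
      qed
      ultimately show "s = s'" by (simp add: sp sp')
    qed
    show "h ` ?S \<subseteq> ?E'"
    proof (rule image_subsetI)
      fix s assume s: "s \<in> ?S"
      obtain \<phi> P where sp: "s = (\<phi>, P)" by (metis prod.exhaust_sel)
      have \<phi>: "\<phi> \<in> ?E" and P: "P \<in> Ext \<phi>" using s by (auto simp: sp)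
      have inj: "inj_on \<phi> V" using \<phi> by (simp add: tree_embeddings_def V_def)
      have gb: "inj_on (g \<phi> P) N" "g \<phi> P ` N = P - \<phi> ` Q" using g[OF \<phi> P] by (auto simp: bij_betw_def)
      show "h s \<in> ?E'"
        unfolding tree_embeddings_def U'
      proof (intro CollectI conjI ballI)
        show "h s \<in> extensional (V \<union> N)" by (simp add: sp h_def)
        have "inj_on (h s) V" using inj hV by (simp add: sp inj_on_def)
        moreover have "inj_on (h s) N" using gb(1) hN by (simp add: sp inj_on_def)
        moreover have "h s ` V \<inter> h s ` N = {}"
        proof -
          have "h s ` V = \<phi> ` V" "h s ` N = P - \<phi> ` Q"
            using hV hN gb(2) by (auto simp: sp intro!: image_cong[THEN trans])
          then show ?thesis using P by (auto simp: Ext_def)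
        qed
        ultimately show "inj_on (h s) (V \<union> N)"
          using NV by (auto simp: inj_on_Un)
        fix T assume T: "T \<in> insert (Q \<union> N) \<C>"
        show "h s ` T \<in> H"
        proof (cases "T = Q \<union> N")
          case True
          then show ?thesis using himg[of \<phi> P] s P by (simp add: sp Ext_def)
        next
          case False
          then have TC: "T \<in> \<C>" using T by simp
          then have "h s ` T = \<phi> ` T" using hV by (intro image_cong) (auto simp: sp V_def)
          then show ?thesis using \<phi> TC by (simp add: tree_embeddings_def)
        qed
      qed
    qed
  qed
  moreover have "card ?S = (\<Sum>\<phi>\<in>?E. card (Ext \<phi>))"
    using H(1) by (intro card_SigmaI[OF finE]) (simp add: Ext_def)
  ultimately have "(\<Sum>\<phi>\<in>?E. card (Ext \<phi>)) \<le> card ?E'" by simp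
  then have "real (\<Sum>\<phi>\<in>?E. card (Ext \<phi>)) \<le> real (card ?E')" by (simp only: of_nat_le_iff)
  moreover have "real (card ?E) * w (card Q) \<le> real (\<Sum>\<phi>\<in>?E. card (Ext \<phi>))"
    using sum_mono[of ?E "\<lambda>_. w (card Q)" "\<lambda>\<phi>. real (card (Ext \<phi>))"] ext by simp
  moreover have "f \<C> * w (card Q) \<le> real (card ?E) * w (card Q)"
    using IH step(4) w by (intro mult_right_mono) auto
  moreover have "f (insert (Q \<union> N) \<C>) \<le> f \<C> * w (card Q)"
  proof (rule f(2)[OF step(1) new])
    show "Q \<subseteq> \<Union>\<C>" using QV by (simp add: V_def)
    show "\<exists>T1\<in>\<C>. Q \<subseteq> T1" using step(2,3) by blast
  qed (use step(4-7) in auto)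
  ultimately show ?case by linarith
qed

section \<open>A tree of cliques of exact density\<close>

lemma of_nat_choose_two: "(of_nat (n choose 2) :: 'a::field_char_0) = of_nat n * (of_nat n - 1) / 2"
proof (induction n)
  case (Suc n)
  have "Suc n choose 2 = n + (n choose 2)" by (simp add: numeral_2_eq_2)
  then have "(of_nat (Suc n choose 2) :: 'a) = of_nat n + of_nat n * (of_nat n - 1) / 2" using Suc by simp
  also have "\<dots> = (2 * of_nat n + of_nat n * (of_nat n - 1)) / 2" by (simp add: add_divide_distrib)
  also have "2 * of_nat n + of_nat n * (of_nat n - 1) = (of_nat (Suc n) * (of_nat (Suc n) - 1) :: 'a)"
    by (simp add: algebra_simps)
  finally show ?case .
qed simp

text \<open>A load certifies densities: a vertex set of load \<open>x\<close> meets at least \<open>x\<close> edges. If all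
  loads are \<open>0\<close> or \<open>d\<close>, the vertices of load \<open>0\<close> can serve as roots.\<close>

definition load_ok :: "nat set set \<Rightarrow> (nat \<Rightarrow> rat) \<Rightarrow> bool" where
  "load_ok \<C> lw \<longleftrightarrow> (\<forall>S\<subseteq>\<Union>\<C>. sum lw S \<le> of_nat (card {e \<in> \<Union>(pairs ` \<C>). e \<inter> S \<noteq> {}})) \<and>
     of_nat (card (\<Union>(pairs ` \<C>))) = sum lw (\<Union>\<C>)"

text \<open>Loads add up because an earlier edge inside the new clique must lie in \<open>Q\<close>.
  So the new edges are disjoint from the old ones, and edges meeting a set can be counted
  separately.\<close>

lemma load_ok_attach:
  assumes tree: "clique_tree t p \<C>" and ok: "load_ok \<C> lw" and Q: "T1 \<in> \<C>" "Q \<subseteq> T1"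
    and N: "finite N" "N \<inter> \<Union>\<C> = {}"
    and \<delta>: "\<And>S. S \<subseteq> Q \<union> N \<Longrightarrow> sum \<delta> S \<le> of_nat (card {e \<in> pairs (Q \<union> N) - pairs Q. e \<inter> S \<noteq> {}})"
      "of_nat (card (pairs (Q \<union> N) - pairs Q)) = sum \<delta> (Q \<union> N)"
    and lw': "\<And>y. y \<in> \<Union>\<C> - Q \<Longrightarrow> lw' y = lw y" "\<And>y. y \<in> Q \<Longrightarrow> lw' y = lw y + \<delta> y" "\<And>y. y \<in> N \<Longrightarrow> lw' y = \<delta> y"
  shows "load_ok (insert (Q \<union> N) \<C>) lw'"
proof -
  define V where "V = \<Union>\<C>"
  define E where "E = \<Union>(pairs ` \<C>)"
  define D where "D = pairs (Q \<union> N) - pairs Q"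
  have finV: "finite V" using clique_tree_finite[OF tree] by (auto simp: V_def)
  have QV: "Q \<subseteq> V" using Q by (auto simp: V_def)
  have finQ: "finite Q" using QV finV finite_subset by blast
  have NV: "N \<inter> V = {}" using N(2) by (simp add: V_def)
  have EV: "e \<subseteq> V" if "e \<in> E" for e using that by (auto simp: E_def V_def pairs_def)
  have QE: "pairs Q \<subseteq> E" using Q by (auto simp: E_def pairs_def)
  have E': "\<Union>(pairs ` insert (Q \<union> N) \<C>) = E \<union> D" using QE by (auto simp: E_def D_def)
  have ED: "E \<inter> D = {}"
  proof (rule ccontr)
    assume "E \<inter> D \<noteq> {}"
    then obtain e where e: "e \<in> E" "e \<in> D" by blast
    have "e \<subseteq> Q \<union> N" "card e = 2" "e \<notin> pairs Q" using e(2) by (auto simp: D_def pairs_def)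
    moreover have "e \<subseteq> V" by (rule EV[OF e(1)])
    ultimately have "e \<subseteq> Q" using NV by blast
    then show False using \<open>card e = 2\<close> \<open>e \<notin> pairs Q\<close> by (simp add: pairs_def)
  qed
  have V': "\<Union>(insert (Q \<union> N) \<C>) = V \<union> N" using QV by (auto simp: V_def)
  have finE: "finite E" using clique_tree_finite[OF tree] by (auto simp: E_def finite_pairs)
  have finD: "finite D" using finQ N(1) by (simp add: D_def finite_pairs)
  have sum': "sum lw' S = sum lw (S \<inter> V) + sum \<delta> (S \<inter> (Q \<union> N))" if S: "S \<subseteq> V \<union> N" for S
  proof -
    have finS: "finite S" using S finV N(1) by (meson finite_UnI finite_subset)
    have "S = (S \<inter> (V - Q)) \<union> (S \<inter> Q) \<union> (S \<inter> N)" using S QV by blast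
    then have "sum lw' S = sum lw' ((S \<inter> (V - Q)) \<union> (S \<inter> Q) \<union> (S \<inter> N))" by (rule arg_cong)
    also have "\<dots> = sum lw' (S \<inter> (V - Q)) + sum lw' (S \<inter> Q) + sum lw' (S \<inter> N)"
      using finS NV QV by (subst sum.union_disjoint; (subst sum.union_disjoint)?) auto
    also have "\<dots> = sum lw (S \<inter> (V - Q)) + (sum lw (S \<inter> Q) + sum \<delta> (S \<inter> Q)) + sum \<delta> (S \<inter> N)"
      using lw' by (simp add: sum.distrib V_def)
    also have "\<dots> = (sum lw (S \<inter> (V - Q)) + sum lw (S \<inter> Q)) + (sum \<delta> (S \<inter> Q) + sum \<delta> (S \<inter> N))" by simp
    also have "sum lw (S \<inter> (V - Q)) + sum lw (S \<inter> Q) = sum lw (S \<inter> V)"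
      using finS QV by (subst sum.union_disjoint[symmetric]) (auto intro!: sum.cong)
    also have "sum \<delta> (S \<inter> Q) + sum \<delta> (S \<inter> N) = sum \<delta> (S \<inter> (Q \<union> N))"
      using finS QV NV by (subst sum.union_disjoint[symmetric]) (auto intro!: sum.cong)
    finally show ?thesis .
  qed
  show ?thesis
    unfolding load_ok_def V' E'
  proof (intro conjI allI impI)
    fix S assume S: "S \<subseteq> V \<union> N"
    have eq: "{e \<in> E \<union> D. e \<inter> S \<noteq> {}} = {e \<in> E. e \<inter> (S \<inter> V) \<noteq> {}} \<union> {e \<in> D. e \<inter> (S \<inter> (Q \<union> N)) \<noteq> {}}"
    proof -
      have 1: "e \<inter> S \<noteq> {} \<longleftrightarrow> e \<inter> (S \<inter> V) \<noteq> {}" if "e \<in> E" for e using EV[OF that] by blast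
      have 2: "e \<inter> S \<noteq> {} \<longleftrightarrow> e \<inter> (S \<inter> (Q \<union> N)) \<noteq> {}" if "e \<in> D" for e
        using that by (auto simp: D_def pairs_def)
      show ?thesis
      proof (rule Set.set_eqI)
        fix e
        show "e \<in> {e \<in> E \<union> D. e \<inter> S \<noteq> {}} \<longleftrightarrow>
          e \<in> {e \<in> E. e \<inter> (S \<inter> V) \<noteq> {}} \<union> {e \<in> D. e \<inter> (S \<inter> (Q \<union> N)) \<noteq> {}}"
          using 1[of e] 2[of e] unfolding Un_iff mem_Collect_eq by argo
      qed
    qed
    have "card {e \<in> E \<union> D. e \<inter> S \<noteq> {}} = card {e \<in> E. e \<inter> (S \<inter> V) \<noteq> {}} + card {e \<in> D. e \<inter> (S \<inter> (Q \<union> N)) \<noteq> {}}"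
      unfolding eq using finE finD ED by (intro card_Un_disjoint) auto
    moreover have "sum lw (S \<inter> V) \<le> of_nat (card {e \<in> E. e \<inter> (S \<inter> V) \<noteq> {}})"
      using ok unfolding load_ok_def E_def V_def by blast
    moreover have "sum \<delta> (S \<inter> (Q \<union> N)) \<le> of_nat (card {e \<in> D. e \<inter> (S \<inter> (Q \<union> N)) \<noteq> {}})"
      unfolding D_def by (rule \<delta>(1)) blast
    ultimately show "sum lw' S \<le> of_nat (card {e \<in> E \<union> D. e \<inter> S \<noteq> {}})" using sum'[OF S] by simp
  next
    have "card (E \<union> D) = card E + card D" using finE finD ED by (rule card_Un_disjoint)
    moreover have "of_nat (card E) = sum lw V" using ok by (simp add: load_ok_def E_def V_def)
    moreover have "(V \<union> N) \<inter> V = V" "(V \<union> N) \<inter> (Q \<union> N) = Q \<union> N" using QV by auto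
    ultimately show "of_nat (card (E \<union> D)) = sum lw' (V \<union> N)"
      using sum'[OF order_refl] \<delta>(2) by (simp add: D_def)
  qed
qed

text \<open>Counted by complement: the pairs missing \<open>S\<close> are those inside
  \<open>T - S\<close> but not inside \<open>Q - S\<close>.\<close>

lemma card_pairs_touching:
  assumes "finite T" "Q \<subseteq> T" "S \<subseteq> T"
  shows "rat_of_nat (card {e \<in> pairs T - pairs Q. e \<inter> S \<noteq> {}}) =
    (of_nat (card T choose 2) - of_nat (card Q choose 2)) - (of_nat (card (T - S) choose 2) - of_nat (card (Q - S) choose 2))"
proof -
  have "finite Q" using assms(1,2) by (rule rev_finite_subset)
  then have fin: "finite Q" "finite (T - S)" "finite (Q - S)" using assms(1) by auto
  have eq: "{e \<in> pairs T - pairs Q. e \<inter> S \<noteq> {}} = (pairs T - pairs Q) - (pairs (T - S) - pairs (Q - S))"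
    by (auto simp: pairs_def)
  have sub1: "pairs Q \<subseteq> pairs T" and sub2: "pairs (Q - S) \<subseteq> pairs (T - S)"
    and sub3: "pairs (T - S) - pairs (Q - S) \<subseteq> pairs T - pairs Q"
    using assms(2) by (auto simp: pairs_def)
  have 1: "rat_of_nat (card (A - B)) = of_nat (card A) - of_nat (card B)" if "finite A" "B \<subseteq> A" for A B :: "'a set set"
    using that by (simp add: card_Diff_subset finite_subset card_mono of_nat_diff)
  show ?thesis
    unfolding eq using assms(1) fin
    by (simp add: 1 sub1 sub2 sub3 finite_pairs card_pairs)
qed

section \<open>Loads on cliques glued along a core\<close>

locale exact_gadget =
  fixes t p :: nat and d :: rat
  assumes p: "1 \<le> p" "p < t" and d1: "2 * d > of_nat t + of_nat p - 1"
    and d2: "p + 1 = t \<or> 2 * d \<le> of_nat t + of_nat p"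
begin

text \<open>\<open>g\<close> is what remains of the edges of a new clique glued along a core \<open>Q\<close> of \<open>p\<close> vertices
  when each of its \<open>bt = t - p - 1\<close> ordinary new vertices takes load \<open>d\<close>; it is shared by the tip
  and \<open>Q\<close>. \<open>\<Delta>\<close> is what \<open>Q\<close> needs in addition to the edges inside it.\<close>

definition bt :: rat where "bt = of_nat (t - p - 1)"
definition pr :: rat where "pr = of_nat p"
definition g :: rat where "g = (bt + 1) * bt / 2 + (bt + 1) * pr - d * bt"
definition \<Delta> :: rat where "\<Delta> = d * pr - pr * (pr - 1) / 2"

lemma t_eq: "of_nat t = pr + bt + 1"
  using p by (simp add: pr_def bt_def of_nat_diff)

lemma basic: "pr \<ge> 1" "bt \<ge> 0" "2 * d > 2 * pr + bt" "bt = 0 \<or> 2 * d \<le> 2 * pr + bt + 1"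
proof -
  show "pr \<ge> 1" using p by (simp add: pr_def)
  show "bt \<ge> 0" by (simp add: bt_def)
  show "2 * d > 2 * pr + bt" using d1 unfolding t_eq pr_def[symmetric] by simp
  show "bt = 0 \<or> 2 * d \<le> 2 * pr + bt + 1"
  proof (cases "p + 1 = t")
    case True
    then show ?thesis by (auto simp: bt_def)
  next
    case False
    then show ?thesis using d2 unfolding t_eq pr_def[symmetric] by simp
  qed
qed

lemma pr0: "pr \<noteq> 0"
  using basic by linarith

lemma d_pos: "d > 0"
  using basic by linarith

text \<open>Each bound counts edges. \<open>g < d\<close>: with \<open>p\<close> roots, a clique has
  fewer than \<open>d\<close> edges per new vertex. \<open>g \<ge> pr\<close>: with the tip as a
  further root, the ordinary vertices can be served without the \<open>p\<close> edges from the tip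
  to \<open>Q\<close>. \<open>g \<le> \<Delta>\<close>: a whole clique has at most
  \<open>d * (t - 1)\<close> edges.\<close>

lemma g_bounds: "g \<ge> pr" "g < d" "g \<le> \<Delta>"
proof -
  have "bt * (2 * d) \<le> bt * (2 * pr + bt + 1)"
    using basic by (auto intro: mult_left_mono)
  then show "g \<ge> pr" unfolding g_def by (simp add: algebra_simps add_divide_distrib diff_divide_distrib)
  have pos: "(bt + 1) * (2 * d - (2 * pr + bt)) > 0" using basic by (intro mult_pos_pos) linarith+
  then show "g < d" unfolding g_def by (simp add: algebra_simps add_divide_distrib diff_divide_distrib)
  have "(pr + bt) * (2 * d - (pr + bt + 1)) \<ge> 0" using basic by (intro mult_nonneg_nonneg) linarith+
  then show "g \<le> \<Delta>" unfolding g_def \<Delta>_def by (simp add: algebra_simps add_divide_distrib diff_divide_distrib)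
qed

text \<open>For a set missing the tip, with \<open>i\<close> ordinary new vertices and
  \<open>k\<close> core vertices; \<open>c\<close> new vertices lie outside it. After
  \<open>\<tau>\<close> is dropped both sides are affine in \<open>k\<close>, so
  \<open>k = 0\<close> and \<open>k = pr\<close> suffice.\<close>

lemma block_arith_0:
  fixes i k \<tau> :: rat
  assumes i: "0 \<le> i" "i \<le> bt" and k: "0 \<le> k" "k \<le> pr" and \<tau>: "0 \<le> \<tau>" "\<tau> \<le> g"
  defines "c \<equiv> bt + 1 - i"
  shows "d * i + (g - \<tau>) / pr * k \<le> ((bt + 1) * bt / 2 + (bt + 1) * pr) - (c * (c - 1) / 2 + c * (pr - k))"
proof -
  define R where "R = ((bt + 1) * bt / 2 + (bt + 1) * pr) - (c * (c - 1) / 2 + c * pr)"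
  define l where "l = k / pr"
  have l: "0 \<le> l" "l \<le> 1" and kl: "k = l * pr" using k basic by (auto simp: l_def)
  have A0: "d * i \<le> R"
  proof (cases "bt = 0")
    case True
    then have "i = 0" using i by simp
    then show ?thesis by (simp add: R_def c_def True)
  next
    case False
    then have "2 * d \<le> 2 * pr + bt + 1" using basic(4) by simp
    then have "2 * d \<le> 2 * pr + (2 * bt - i + 1)" using i by linarith
    from mult_left_mono[OF this i(1)] have "i * (2 * d) \<le> i * (2 * pr + (2 * bt - i + 1))" .
    moreover have "2 * R = i * (2 * pr + (2 * bt - i + 1))" by (simp add: R_def c_def algebra_simps add_divide_distrib diff_divide_distrib)
    ultimately show ?thesis by (simp add: mult.left_commute mult.commute)
  qed
  have A1: "d * i + g \<le> R + c * pr"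
  proof -
    have "(bt - i) * (2 * d - (bt + 1 - i)) \<ge> 0" using i basic by (intro mult_nonneg_nonneg) linarith+
    moreover have "2 * (R + c * pr - d * i - g) = (bt - i) * (2 * d - (bt + 1 - i))"
      by (simp add: R_def c_def g_def algebra_simps add_divide_distrib diff_divide_distrib)
    ultimately have "0 \<le> 2 * (R + c * pr - d * i - g)" by (simp only:)
    then show ?thesis by simp
  qed
  have "d * i + (g - \<tau>) * l \<le> d * i + g * l" using \<tau> l by (simp add: mult_right_mono)
  also have "\<dots> = (1 - l) * (d * i) + l * (d * i + g)" by (simp add: algebra_simps)
  also have "\<dots> \<le> (1 - l) * R + l * (R + c * pr)"
    using l by (intro add_mono mult_left_mono[OF A0] mult_left_mono[OF A1]) auto
  also have "\<dots> = R + c * k" by (simp add: kl algebra_simps)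
  finally have "d * i + (g - \<tau>) * l \<le> R + c * k" .
  moreover have "(g - \<tau>) / pr * k = (g - \<tau>) * l" by (simp add: l_def)
  ultimately show ?thesis unfolding R_def by (simp add: algebra_simps)
qed

text \<open>For a set containing the tip. Tip and core carry at most \<open>g\<close> together, and
  the edges counted for \<open>k = 0\<close> already suffice; core vertices only add edges.\<close>

lemma block_arith_1:
  fixes i k \<tau> :: rat
  assumes i: "0 \<le> i" "i \<le> bt" and k: "0 \<le> k" "k \<le> pr" and \<tau>: "0 \<le> \<tau>" "\<tau> \<le> g"
  defines "c \<equiv> bt - i"
  shows "d * i + \<tau> + (g - \<tau>) / pr * k \<le> ((bt + 1) * bt / 2 + (bt + 1) * pr) - (c * (c - 1) / 2 + c * (pr - k))"
proof -
  define l where "l = k / pr"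
  have l: "0 \<le> l" "l \<le> 1" using k basic by (auto simp: l_def)
  have "(g - \<tau>) * l \<le> g - \<tau>" using l \<tau> by (simp add: mult_left_le)
  then have "d * i + \<tau> + (g - \<tau>) / pr * k \<le> d * i + g" by (simp add: l_def)
  also have "\<dots> \<le> ((bt + 1) * bt / 2 + (bt + 1) * pr) - (c * (c - 1) / 2 + c * pr)"
  proof -
    have "(bt - i) * (2 * d - 2 * pr - (bt - i - 1)) \<ge> 0" using i basic by (intro mult_nonneg_nonneg) linarith+
    moreover have "2 * (((bt + 1) * bt / 2 + (bt + 1) * pr) - (c * (c - 1) / 2 + c * pr) - (d * i + g)) =
        (bt - i) * (2 * d - 2 * pr - (bt - i - 1))"
      by (simp add: c_def g_def algebra_simps add_divide_distrib diff_divide_distrib)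
    ultimately have "0 \<le> 2 * (((bt + 1) * bt / 2 + (bt + 1) * pr) - (c * (c - 1) / 2 + c * pr) - (d * i + g))"
      by (simp only:)
    then have "0 \<le> ((bt + 1) * bt / 2 + (bt + 1) * pr) - (c * (c - 1) / 2 + c * pr) - (d * i + g)"
      unfolding zero_le_mult_iff by simp
    then show ?thesis unfolding diff_ge_0_iff_ge .
  qed
  also have "\<dots> \<le> ((bt + 1) * bt / 2 + (bt + 1) * pr) - (c * (c - 1) / 2 + c * (pr - k))"
    using k i by (simp add: c_def mult_left_mono)
  finally show ?thesis .
qed

text \<open>The loads on a clique \<open>Q \<union> N \<union> {z}\<close> glued along \<open>Q\<close>: each vertex of \<open>N\<close> receives \<open>d\<close>, the tip
  \<open>z\<close> receives \<open>\<tau>\<close>, and the rest is spread over \<open>Q\<close>.\<close>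

definition \<delta> :: "nat set \<Rightarrow> nat \<Rightarrow> rat \<Rightarrow> nat \<Rightarrow> rat" where
  "\<delta> Q z \<tau> y = (if y \<in> Q then (g - \<tau>) / pr else if y = z then \<tau> else d)"

text \<open>For a core whose inner edges are new as well: these \<open>pr * (pr - 1) / 2\<close>
  edges are shared equally by its vertices.\<close>

definition \<delta>' :: "nat set \<Rightarrow> nat \<Rightarrow> rat \<Rightarrow> nat \<Rightarrow> rat" where
  "\<delta>' Q z \<tau> y = \<delta> Q z \<tau> y + (if y \<in> Q then (pr - 1) / 2 else 0)"

context
  fixes Q N :: "nat set" and z :: nat and \<tau> :: rat
  assumes Q: "finite Q" "card Q = p" and N: "finite N" "card N = t - p - 1"
    and disj: "Q \<inter> N = {}" "z \<notin> Q" "z \<notin> N" and \<tau>: "0 \<le> \<tau>" "\<tau> \<le> g"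
begin

lemma card_T: "card (Q \<union> insert z N) = t"
  using Q N disj p by (subst card_Un_disjoint) auto

lemma sum_\<delta>:
  assumes "S \<subseteq> Q \<union> insert z N"
  shows "sum (\<delta> Q z \<tau>) S = (g - \<tau>) / pr * of_nat (card (S \<inter> Q)) + (if z \<in> S then \<tau> else 0) + d * of_nat (card (S \<inter> N))"
proof -
  have finS: "finite S" using assms Q(1) N(1) by (meson finite.insertI finite_UnI finite_subset)
  have "S = (S \<inter> Q) \<union> (S \<inter> {z}) \<union> (S \<inter> N)" using assms by blast
  then have "sum (\<delta> Q z \<tau>) S = sum (\<delta> Q z \<tau>) ((S \<inter> Q) \<union> (S \<inter> {z}) \<union> (S \<inter> N))" by (rule arg_cong)
  also have "\<dots> = sum (\<delta> Q z \<tau>) (S \<inter> Q) + sum (\<delta> Q z \<tau>) (S \<inter> {z}) + sum (\<delta> Q z \<tau>) (S \<inter> N)"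
    using finS disj by (subst sum.union_disjoint; (subst sum.union_disjoint)?) auto
  also have "sum (\<delta> Q z \<tau>) (S \<inter> Q) = (\<Sum>y\<in>S \<inter> Q. (g - \<tau>) / pr)" by (intro sum.cong) (auto simp: \<delta>_def)
  also have "sum (\<delta> Q z \<tau>) (S \<inter> N) = (\<Sum>y\<in>S \<inter> N. d)" using disj by (intro sum.cong) (auto simp: \<delta>_def)
  also have "sum (\<delta> Q z \<tau>) (S \<inter> {z}) = (if z \<in> S then \<tau> else 0)" using disj by (auto simp: \<delta>_def)
  finally show ?thesis by simp
qed

lemma block_ineq:
  assumes S: "S \<subseteq> Q \<union> insert z N"
  shows "sum (\<delta> Q z \<tau>) S \<le> of_nat (card {e \<in> pairs (Q \<union> insert z N) - pairs Q. e \<inter> S \<noteq> {}})"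
proof -
  define i where "i = rat_of_nat (card (S \<inter> N))"
  define k where "k = rat_of_nat (card (S \<inter> Q))"
  define s :: rat where "s = (if z \<in> S then 1 else 0)"
  let ?T = "Q \<union> insert z N"
  have cN: "rat_of_nat (card N) = bt" by (simp add: N bt_def)
  have cQ: "rat_of_nat (card Q) = pr" by (simp add: Q pr_def)
  have 1: "rat_of_nat (card (A - S)) = of_nat (card A) - of_nat (card (S \<inter> A))" if "finite A" for A
  proof -
    have "card (A - S) = card A - card (S \<inter> A)" using that by (subst card_Diff_subset_Int) (auto simp: Int_commute)
    moreover have "card (S \<inter> A) \<le> card A" using that by (intro card_mono) auto
    ultimately show ?thesis by (simp add: of_nat_diff)
  qed
  have i: "0 \<le> i" "i \<le> bt" unfolding i_def cN[symmetric] using N(1) by (simp_all add: card_mono)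
  have k: "0 \<le> k" "k \<le> pr" unfolding k_def cQ[symmetric] using Q(1) by (simp_all add: card_mono)
  have QS: "rat_of_nat (card (Q - S)) = pr - k" using 1[OF Q(1)] cQ by (simp add: k_def)
  have NS: "rat_of_nat (card (N - S)) = bt - i" using 1[OF N(1)] cN by (simp add: i_def)
  have "?T - S = (Q - S) \<union> (N - S) \<union> ({z} - S)" by auto
  then have "card (?T - S) = card (Q - S) + card (N - S) + card ({z} - S)"
    using Q(1) N(1) disj by (simp, subst card_Un_disjoint; (subst card_Un_disjoint)?) auto
  moreover have "rat_of_nat (card ({z} - S)) = 1 - s"
  proof -
    have "{z} - S = (if z \<in> S then {} else {z})" by auto
    then show ?thesis by (simp add: s_def)
  qed
  ultimately have TS: "rat_of_nat (card (?T - S)) = (pr - k) + (bt - i) + (1 - s)" using QS NS by simp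
  have T: "rat_of_nat (card ?T) = pr + bt + 1" unfolding card_T by (rule t_eq)
  have "rat_of_nat (card {e \<in> pairs ?T - pairs Q. e \<inter> S \<noteq> {}}) =
    (of_nat (card ?T choose 2) - of_nat (card Q choose 2)) - (of_nat (card (?T - S) choose 2) - of_nat (card (Q - S) choose 2))"
    using Q(1) N(1) S by (intro card_pairs_touching) auto
  also have "\<dots> = ((pr + bt + 1) * (pr + bt + 1 - 1) / 2 - pr * (pr - 1) / 2) -
     (((pr - k) + (bt - i) + (1 - s)) * ((pr - k) + (bt - i) + (1 - s) - 1) / 2 - (pr - k) * (pr - k - 1) / 2)"
    unfolding of_nat_choose_two T TS QS cQ ..
  finally have E: "rat_of_nat (card {e \<in> pairs ?T - pairs Q. e \<inter> S \<noteq> {}}) = \<dots>" .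
  show ?thesis
  proof (cases "z \<in> S")
    case True
    then have s: "s = 1" by (simp add: s_def)
    have "sum (\<delta> Q z \<tau>) S = d * i + \<tau> + (g - \<tau>) / pr * k" using True by (simp add: sum_\<delta>[OF S] i_def k_def)
    also have "\<dots> \<le> ((bt + 1) * bt / 2 + (bt + 1) * pr) - ((bt - i) * ((bt - i) - 1) / 2 + (bt - i) * (pr - k))"
      by (rule block_arith_1[OF i k \<tau>])
    also have "\<dots> = rat_of_nat (card {e \<in> pairs ?T - pairs Q. e \<inter> S \<noteq> {}})"
      unfolding E s by (simp add: algebra_simps add_divide_distrib diff_divide_distrib)
    finally show ?thesis .
  next
    case False
    then have s: "s = 0" by (simp add: s_def)
    have "sum (\<delta> Q z \<tau>) S = d * i + (g - \<tau>) / pr * k" using False by (simp add: sum_\<delta>[OF S] i_def k_def)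
    also have "\<dots> \<le> ((bt + 1) * bt / 2 + (bt + 1) * pr) - ((bt + 1 - i) * ((bt + 1 - i) - 1) / 2 + (bt + 1 - i) * (pr - k))"
      by (rule block_arith_0[OF i k \<tau>])
    also have "\<dots> = rat_of_nat (card {e \<in> pairs ?T - pairs Q. e \<inter> S \<noteq> {}})"
      unfolding E s by (simp add: algebra_simps add_divide_distrib diff_divide_distrib)
    finally show ?thesis .
  qed
qed

lemma block_total: "of_nat (card (pairs (Q \<union> insert z N) - pairs Q)) = sum (\<delta> Q z \<tau>) (Q \<union> insert z N)"
proof -
  let ?T = "Q \<union> insert z N"
  have fin: "finite ?T" using Q N by simp
  have "pairs Q \<subseteq> pairs ?T" by (auto simp: pairs_def)
  then have "rat_of_nat (card (pairs ?T - pairs Q)) = of_nat (card ?T choose 2) - of_nat (card Q choose 2)"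
    using fin Q(1) by (simp add: card_Diff_subset finite_pairs card_mono of_nat_diff card_pairs[symmetric])
  also have "\<dots> = (pr + bt + 1) * (pr + bt + 1 - 1) / 2 - pr * (pr - 1) / 2"
    unfolding of_nat_choose_two card_T t_eq Q(2) pr_def[symmetric] ..
  also have "\<dots> = (g - \<tau>) / pr * pr + \<tau> + d * bt"
    using pr0 by (simp add: g_def algebra_simps add_divide_distrib diff_divide_distrib)
  also have "\<dots> = sum (\<delta> Q z \<tau>) ?T"
  proof -
    have "?T \<inter> Q = Q" "?T \<inter> N = N" by auto
    then show ?thesis unfolding sum_\<delta>[OF order_refl] using Q(2) N(2) by (simp add: pr_def bt_def)
  qed
  finally show ?thesis .
qed

lemma sum_\<delta>':
  assumes "S \<subseteq> Q \<union> insert z N"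
  shows "sum (\<delta>' Q z \<tau>) S = sum (\<delta> Q z \<tau>) S + (pr - 1) / 2 * of_nat (card (S \<inter> Q))"
proof -
  have finS: "finite S" using assms Q(1) N(1) by (meson finite.insertI finite_UnI finite_subset)
  have "(\<Sum>y\<in>S. if y \<in> Q then (pr - 1) / 2 else 0) = (\<Sum>y\<in>S \<inter> Q. (pr - 1) / 2)"
    by (rule sum.inter_restrict[OF finS, symmetric])
  then show ?thesis by (simp add: \<delta>'_def sum.distrib)
qed

text \<open>Beyond \<open>block_ineq\<close>: inside the core, \<open>k\<close> vertices of degree
  \<open>pr - 1\<close> meet at least \<open>k * (pr - 1) / 2\<close> edges.\<close>

lemma full_block_ineq:
  assumes S: "S \<subseteq> Q \<union> insert z N"
  shows "sum (\<delta>' Q z \<tau>) S \<le> of_nat (card {e \<in> pairs (Q \<union> insert z N). e \<inter> S \<noteq> {}})"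
proof -
  let ?T = "Q \<union> insert z N"
  define k where "k = rat_of_nat (card (S \<inter> Q))"
  have fin: "finite ?T" using Q N by simp
  have k: "0 \<le> k" "k \<le> pr" using card_mono[OF Q(1), of "S \<inter> Q"] Q(2) by (simp_all add: k_def pr_def)
  have "{e \<in> pairs ?T. e \<inter> S \<noteq> {}} = {e \<in> pairs ?T - pairs Q. e \<inter> S \<noteq> {}} \<union> {e \<in> pairs Q - pairs {}. e \<inter> (S \<inter> Q) \<noteq> {}}"
    by (auto simp: pairs_def)
  then have "card {e \<in> pairs ?T. e \<inter> S \<noteq> {}} = card {e \<in> pairs ?T - pairs Q. e \<inter> S \<noteq> {}} + card {e \<in> pairs Q - pairs {}. e \<inter> (S \<inter> Q) \<noteq> {}}"
    using fin Q(1) by (simp, subst card_Un_disjoint) (auto simp: finite_pairs)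
  moreover have "(pr - 1) / 2 * k \<le> of_nat (card {e \<in> pairs Q - pairs {}. e \<inter> (S \<inter> Q) \<noteq> {}})"
  proof -
    have "card (Q - S \<inter> Q) = card Q - card (S \<inter> Q)" using Q(1) by (intro card_Diff_subset) auto
    moreover have "card (S \<inter> Q) \<le> card Q" using Q(1) by (intro card_mono) auto
    ultimately have c: "rat_of_nat (card (Q - S \<inter> Q)) = pr - k" by (simp add: of_nat_diff k_def pr_def Q(2))
    have "rat_of_nat (card {e \<in> pairs Q - pairs {}. e \<inter> (S \<inter> Q) \<noteq> {}}) = pr * (pr - 1) / 2 - (pr - k) * (pr - k - 1) / 2"
      using card_pairs_touching[OF Q(1), of "{}" "S \<inter> Q"] unfolding of_nat_choose_two c Q(2) pr_def[symmetric] by simp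
    moreover have "k * (pr - k) \<ge> 0" using k by simp
    ultimately show ?thesis by (simp add: algebra_simps add_divide_distrib diff_divide_distrib)
  qed
  ultimately show ?thesis using block_ineq[OF S] sum_\<delta>'[OF S] by (simp add: k_def)
qed

lemma full_block_total: "of_nat (card (pairs (Q \<union> insert z N))) = sum (\<delta>' Q z \<tau>) (Q \<union> insert z N)"
proof -
  let ?T = "Q \<union> insert z N"
  have fin: "finite ?T" using Q N by simp
  have "pairs ?T = (pairs ?T - pairs Q) \<union> pairs Q" by (auto simp: pairs_def)
  moreover have "card ((pairs ?T - pairs Q) \<union> pairs Q) = card (pairs ?T - pairs Q) + card (pairs Q)"
    using fin Q(1) by (intro card_Un_disjoint) (auto simp: finite_pairs)
  ultimately have "card (pairs ?T) = card (pairs ?T - pairs Q) + card (pairs Q)" by simp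
  moreover have "rat_of_nat (card (pairs Q)) = (pr - 1) / 2 * pr"
    using Q by (simp add: card_pairs of_nat_choose_two pr_def)
  moreover have "?T \<inter> Q = Q" by auto
  ultimately show ?thesis using block_total sum_\<delta>'[OF order_refl] Q(2) by (simp add: pr_def)
qed

end

text \<open>\<open>State x\<close>: some tree has a load with all values in \<open>{0, d}\<close>, except for one vertex of load
  \<open>x\<close>. In \<open>Mid x c\<close> there is also an unfinished core \<open>Q\<close>, all of whose vertices have load \<open>c\<close>.\<close>

definition State :: "rat \<Rightarrow> bool" where
  "State x \<longleftrightarrow> (\<exists>\<C> lw z. clique_tree t p \<C> \<and> load_ok \<C> lw \<and> z \<in> \<Union>\<C> \<and> lw z = x \<and>
     (\<forall>y\<in>\<Union>\<C> - {z}. lw y = 0 \<or> lw y = d))"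

definition Mid :: "rat \<Rightarrow> rat \<Rightarrow> bool" where
  "Mid x c \<longleftrightarrow> (\<exists>\<C> lw z Q T. clique_tree t p \<C> \<and> load_ok \<C> lw \<and> z \<in> \<Union>\<C> \<and> z \<notin> Q \<and> T \<in> \<C> \<and> Q \<subseteq> T \<and> card Q = p \<and>
     lw z = x \<and> (\<forall>y\<in>Q. lw y = c) \<and> (\<forall>y\<in>\<Union>\<C> - Q - {z}. lw y = 0 \<or> lw y = d))"

lemma Mid_State: "Mid x d \<Longrightarrow> State x"
  unfolding Mid_def State_def by blast

lemma fresh: "finite (V :: nat set) \<Longrightarrow> \<exists>N. finite N \<and> N \<inter> V = {} \<and> card N = n"
proof -
  assume "finite V"
  then have "infinite (- V)" by (simp add: Compl_eq_Diff_UNIV Diff_infinite_finite)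
  then obtain N where "finite N" "card N = n" "N \<subseteq> - V" using infinite_arbitrarily_large by blast
  then show ?thesis by (intro exI[of _ N]) auto
qed

lemma split_fresh:
  assumes "finite (V :: nat set)"
  shows "\<exists>Q N. finite Q \<and> card Q = p \<and> finite N \<and> card N = t - p - 1 \<and> Q \<inter> N = {} \<and> (Q \<union> N) \<inter> V = {}"
proof -
  obtain Q where Q: "finite Q" "Q \<inter> V = {}" "card Q = p" using fresh[OF assms] by blast
  obtain N where N: "finite N" "N \<inter> (V \<union> Q) = {}" "card N = t - p - 1" using fresh[of "V \<union> Q"] assms Q by blast
  show ?thesis using Q N by (intro exI[of _ Q] exI[of _ N]) auto
qed

lemma Mid_base:
  assumes \<tau>: "0 \<le> \<tau>" "\<tau> \<le> g"
  shows "Mid \<tau> ((g - \<tau>) / pr + (pr - 1) / 2)"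
proof -
  obtain Q N where QN: "finite Q" "card Q = p" "finite N" "card N = t - p - 1" "Q \<inter> N = {}" "(Q \<union> N) \<inter> {0::nat} = {}"
    using split_fresh[of "{0}"] by blast
  have z: "0 \<notin> Q" "0 \<notin> N" using QN(6) by auto
  let ?T = "Q \<union> insert 0 N"
  note ctx = QN(1-5) z \<tau>
  have "clique_tree t p {?T}" using card_T[OF ctx] QN by (intro clique_tree.base) auto
  moreover have "load_ok {?T} (\<delta>' Q 0 \<tau>)"
    unfolding load_ok_def using full_block_ineq[OF ctx] full_block_total[OF ctx] by simp
  ultimately show ?thesis
    unfolding Mid_def using QN z
    by (intro exI[of _ "{?T}"] exI[of _ "\<delta>' Q 0 \<tau>"] exI[of _ 0] exI[of _ Q] exI[of _ ?T])
      (auto simp: \<delta>'_def \<delta>_def)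
qed

text \<open>A clique is glued along the exceptional vertex alone, which becomes its tip and takes
  \<open>\<tau>\<close> more; the core is new and therefore unfinished.\<close>

lemma State_Mid:
  assumes "State x" and \<tau>: "0 \<le> \<tau>" "\<tau> \<le> g"
  shows "Mid (x + \<tau>) ((g - \<tau>) / pr + (pr - 1) / 2)"
proof -
  obtain \<C> lw z where C: "clique_tree t p \<C>" "load_ok \<C> lw" "z \<in> \<Union>\<C>" "lw z = x" "\<forall>y\<in>\<Union>\<C> - {z}. lw y = 0 \<or> lw y = d"
    using assms(1) unfolding State_def by blast
  have finV: "finite (\<Union>\<C>)" using clique_tree_finite[OF C(1)] by auto
  obtain Q N where QN: "finite Q" "card Q = p" "finite N" "card N = t - p - 1" "Q \<inter> N = {}" "(Q \<union> N) \<inter> \<Union>\<C> = {}"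
    using split_fresh[OF finV] by blast
  have z: "z \<notin> Q" "z \<notin> N" using QN(6) C(3) by auto
  obtain T1 where T1: "T1 \<in> \<C>" "z \<in> T1" using C(3) by blast
  let ?T = "Q \<union> insert z N"
  have T: "{z} \<union> (Q \<union> N) = ?T" by auto
  note ctx = QN(1-5) z \<tau>
  have cT: "card (Q \<union> N) + card {z} = t" using QN(1-5) p by (simp add: card_Un_disjoint)
  have tree: "clique_tree t p (insert ?T \<C>)"
    using clique_tree.step[OF C(1) T1(1), of "{z}" "Q \<union> N"] T1(2) QN cT unfolding T by simp
  define lw' where "lw' y = (if y \<in> Q \<union> N then \<delta>' Q z \<tau> y else if y = z then lw y + \<delta>' Q z \<tau> y else lw y)" for y
  have P0: "pairs {z} = {}"
  proof -
    have "card e \<noteq> 2" if "e \<subseteq> {z}" for e using card_mono[OF _ that] by simp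
    then show ?thesis by (auto simp: pairs_def)
  qed
  have "load_ok (insert ({z} \<union> (Q \<union> N)) \<C>) lw'"
  proof (rule load_ok_attach[OF C(1,2) T1(1), where \<delta> = "\<delta>' Q z \<tau>"])
    show "{z} \<subseteq> T1" using T1 by simp
    show "finite (Q \<union> N)" using QN by simp
    show "(Q \<union> N) \<inter> \<Union>\<C> = {}" by (rule QN(6))
    show "sum (\<delta>' Q z \<tau>) S \<le> of_nat (card {e \<in> pairs ({z} \<union> (Q \<union> N)) - pairs {z}. e \<inter> S \<noteq> {}})"
      if "S \<subseteq> {z} \<union> (Q \<union> N)" for S
      using full_block_ineq[OF ctx that[unfolded T]] unfolding T P0 by simp
    show "of_nat (card (pairs ({z} \<union> (Q \<union> N)) - pairs {z})) = sum (\<delta>' Q z \<tau>) ({z} \<union> (Q \<union> N))"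
      using full_block_total[OF ctx] unfolding T P0 by simp
  qed (use z QN(6) in \<open>auto simp: lw'_def\<close>)
  then have "load_ok (insert ?T \<C>) lw'" unfolding T .
  moreover have "lw' z = x + \<tau>" using z C(4) by (simp add: lw'_def \<delta>'_def \<delta>_def)
  moreover have "\<forall>y\<in>Q. lw' y = (g - \<tau>) / pr + (pr - 1) / 2" by (simp add: lw'_def \<delta>'_def \<delta>_def)
  moreover have "\<forall>y\<in>\<Union>(insert ?T \<C>) - Q - {z}. lw' y = 0 \<or> lw' y = d"
  proof
    fix y assume y: "y \<in> \<Union>(insert ?T \<C>) - Q - {z}"
    show "lw' y = 0 \<or> lw' y = d"
    proof (cases "y \<in> N")
      case True
      then show ?thesis using y by (simp add: lw'_def \<delta>'_def \<delta>_def)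
    next
      case False
      then have "lw' y = lw y" "y \<in> \<Union>\<C> - {z}" using y by (auto simp: lw'_def)
      then show ?thesis using C(5) by simp
    qed
  qed
  ultimately show ?thesis
    unfolding Mid_def using tree QN(2) z
    by (intro exI[of _ "insert ?T \<C>"] exI[of _ lw'] exI[of _ z] exI[of _ Q] exI[of _ ?T]) auto
qed

text \<open>A further clique is glued along the unfinished core. Either its tip takes nothing and
  becomes a root, or the old exceptional vertex is complete and the new tip succeeds it.\<close>

lemma Mid_attach:
  assumes "Mid x c" and \<tau>: "0 \<le> \<tau>" "\<tau> \<le> g"
  shows "(\<tau> = 0 \<longrightarrow> Mid x (c + g / pr)) \<and> (x = d \<longrightarrow> Mid \<tau> (c + (g - \<tau>) / pr))"
proof -
  obtain \<C> lw z Q T1 where C: "clique_tree t p \<C>" "load_ok \<C> lw" "z \<in> \<Union>\<C>" "z \<notin> Q" "T1 \<in> \<C>" "Q \<subseteq> T1" "card Q = p"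
    "lw z = x" "\<forall>y\<in>Q. lw y = c" "\<forall>y\<in>\<Union>\<C> - Q - {z}. lw y = 0 \<or> lw y = d"
    using assms(1) unfolding Mid_def by blast
  have finV: "finite (\<Union>\<C>)" using clique_tree_finite[OF C(1)] by auto
  have QV: "Q \<subseteq> \<Union>\<C>" using C(5,6) by blast
  have finQ: "finite Q" using QV finV finite_subset by blast
  obtain N where N: "finite N" "N \<inter> \<Union>\<C> = {}" "card N = t - p - 1" using fresh[OF finV] by blast
  obtain z' where z': "z' \<notin> \<Union>\<C> \<union> N" using finV N(1) by (metis ex_new_if_finite finite_UnI infinite_UNIV_nat)
  have dj: "Q \<inter> N = {}" "z' \<notin> Q" "z' \<notin> N" using QV N(2) z' by auto
  note ctx = finQ C(7) N(1,3) dj \<tau>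
  let ?T = "Q \<union> insert z' N"
  have zN: "z \<noteq> z'" "z \<notin> N" using C(3) z' N(2) by auto
  have tree: "clique_tree t p (insert ?T \<C>)"
    using C(7) N z' p dj by (intro clique_tree.step[OF C(1,5,6)]) auto
  define lw' where "lw' y = (if y \<in> insert z' N then \<delta> Q z' \<tau> y else if y \<in> Q then lw y + \<delta> Q z' \<tau> y else lw y)" for y
  have "load_ok (insert ?T \<C>) lw'"
  proof (rule load_ok_attach[OF C(1,2,5,6), where \<delta> = "\<delta> Q z' \<tau>"])
    show "insert z' N \<inter> \<Union>\<C> = {}" using N(2) z' by auto
    show "sum (\<delta> Q z' \<tau>) S \<le> of_nat (card {e \<in> pairs ?T - pairs Q. e \<inter> S \<noteq> {}})" if "S \<subseteq> ?T" for S
      by (rule block_ineq[OF ctx that])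
    show "of_nat (card (pairs ?T - pairs Q)) = sum (\<delta> Q z' \<tau>) ?T" by (rule block_total[OF ctx])
  qed (use N z' dj in \<open>auto simp: lw'_def\<close>)
  note ok = this
  have lz: "lw' z = x" using C(4,8) zN by (simp add: lw'_def)
  have lz': "lw' z' = \<tau>" using dj by (simp add: lw'_def \<delta>_def)
  have lQ: "lw' y = c + (g - \<tau>) / pr" if "y \<in> Q" for y
  proof -
    have "y \<notin> insert z' N" using that dj by auto
    then show ?thesis using that C(9) by (simp add: lw'_def \<delta>_def)
  qed
  have rest: "lw' y = 0 \<or> lw' y = d" if y: "y \<in> \<Union>(insert ?T \<C>)" "y \<notin> Q" "y \<noteq> z" "y \<noteq> z'" for y
  proof (cases "y \<in> N")
    case True
    then show ?thesis using y by (simp add: lw'_def \<delta>_def)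
  next
    case False
    then have "y \<in> \<Union>\<C> - Q - {z}" using y by auto
    then show ?thesis using C(10) False y by (simp add: lw'_def)
  qed
  have "Mid x (c + g / pr)" if "\<tau> = 0"
    unfolding Mid_def
  proof (rule exI[of _ "insert ?T \<C>"], rule exI[of _ lw'], rule exI[of _ z], rule exI[of _ Q], rule exI[of _ T1], intro conjI ballI)
    show "clique_tree t p (insert ?T \<C>)" by (rule tree)
    show "load_ok (insert ?T \<C>) lw'" by (rule ok)
    show "z \<in> \<Union>(insert ?T \<C>)" using C(3) by simp
    show "T1 \<in> insert ?T \<C>" using C(5) by simp
    show "z \<notin> Q" "Q \<subseteq> T1" "card Q = p" using C dj by simp_all
    show "lw' z = x" using lz by simp
    show "lw' y = c + g / pr" if "y \<in> Q" for y using lQ[OF that] \<open>\<tau> = 0\<close> by simp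
  next
    fix y assume "y \<in> \<Union>(insert ?T \<C>) - Q - {z}"
    then show "lw' y = 0 \<or> lw' y = d" using rest[of y] lz' \<open>\<tau> = 0\<close> by (cases "y = z'") auto
  qed
  moreover have "Mid \<tau> (c + (g - \<tau>) / pr)" if "x = d"
    unfolding Mid_def
  proof (rule exI[of _ "insert ?T \<C>"], rule exI[of _ lw'], rule exI[of _ z'], rule exI[of _ Q], rule exI[of _ T1], intro conjI ballI)
    show "clique_tree t p (insert ?T \<C>)" by (rule tree)
    show "load_ok (insert ?T \<C>) lw'" by (rule ok)
    show "z' \<in> \<Union>(insert ?T \<C>)" by simp
    show "T1 \<in> insert ?T \<C>" using C(5) by simp
    show "z' \<notin> Q" "Q \<subseteq> T1" "card Q = p" using C dj by simp_all
    show "lw' z' = \<tau>" using lz' by simp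
    show "lw' y = c + (g - \<tau>) / pr" if "y \<in> Q" for y using lQ[OF that] .
  next
    fix y assume "y \<in> \<Union>(insert ?T \<C>) - Q - {z'}"
    then show "lw' y = 0 \<or> lw' y = d" using rest[of y] lz \<open>x = d\<close> by (cases "y = z") auto
  qed
  ultimately show ?thesis by simp
qed

lemma Mid_roots:
  assumes "Mid x c"
  shows "Mid x (c + of_nat n * g / pr)"
proof (induction n)
  case (Suc n)
  have "Mid x (c + of_nat n * g / pr + g / pr)"
    using Mid_attach[OF Suc, of 0] g_bounds basic by simp
  then show ?case by (simp add: add_divide_distrib distrib_right add_ac)
qed (use assms in simp)

text \<open>Completing a core takes \<open>\<Delta>\<close>, while each clique on it supplies \<open>g\<close>; the surplus \<open>l0\<close> goes
  to the exceptional vertex. When the load of this vertex reaches \<open>d\<close>, a new vertex takes the rest.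
  So the exceptional load is translated by \<open>l0\<close> modulo \<open>d\<close>, and since \<open>l0 / d\<close> is rational,
  it returns to \<open>d\<close>.\<close>

lemma exists_State_d: "State d"
proof (rule ccontr)
  assume nd: "\<not> State d"
  have g0: "g > 0" using g_bounds basic by linarith
  \<comment> \<open>\<open>M + 1\<close> is the least number of cliques on a core whose supply
    strictly exceeds \<open>\<Delta>\<close>; so the surplus \<open>l0\<close> is positive even if
    \<open>\<Delta>\<close> is a multiple of \<open>g\<close>.\<close>
  define M where "M = nat \<lfloor>\<Delta> / g\<rfloor>"
  have "\<Delta> / g \<ge> 1" using g_bounds g0 by simp
  then have fl: "\<lfloor>\<Delta> / g\<rfloor> \<ge> 1" by simp
  then have M1: "M \<ge> 1" unfolding M_def by linarith
  have ofM: "of_nat M = rat_of_int \<lfloor>\<Delta> / g\<rfloor>" using fl by (simp add: M_def)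
  have "of_nat M \<le> \<Delta> / g" "\<Delta> / g < of_nat M + 1" unfolding ofM by linarith+
  then have Mg: "of_nat M * g \<le> \<Delta>" "\<Delta> < (of_nat M + 1) * g"
    using g0 by (simp_all add: pos_le_divide_eq pos_divide_less_eq)
  define l0 where "l0 = (of_nat M + 1) * g - \<Delta>"
  have l0: "0 < l0" "l0 \<le> g" using Mg by (auto simp: l0_def algebra_simps)
  have \<Delta>eq: "\<Delta> / pr + (pr - 1) / 2 = d"
    using pr0 by (simp add: \<Delta>_def diff_divide_distrib)
  have full: "(g - l0) / pr + (pr - 1) / 2 + of_nat M * g / pr = d"
  proof -
    have "(g - l0) + of_nat M * g = \<Delta>" by (simp add: l0_def algebra_simps)
    then have "(g - l0) / pr + of_nat M * g / pr = \<Delta> / pr" by (simp only: add_divide_distrib[symmetric])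
    then show ?thesis using \<Delta>eq by linarith
  qed
  have init: "State l0"
    using Mid_State[of l0] Mid_roots[OF Mid_base[of l0], of M] l0 full by simp
  have add: "State (x + l0)" if "State x" for x
    using Mid_State[of "x + l0"] Mid_roots[OF State_Mid[OF that, of l0], of M] l0 full by simp
  \<comment> \<open>Of the \<open>M + 1\<close> cliques on the new core, the first fills the
    exceptional vertex up to \<open>d\<close>, the second gives the rest of \<open>l0\<close> to its
    own tip, and \<open>M - 1\<close> more complete the core.\<close>
  have close: "State (x + l0 - d)" if x: "State x" "x \<le> d" "d < x + l0" for x
  proof -
    have "Mid (x + (d - x)) ((g - (d - x)) / pr + (pr - 1) / 2)"
      using x l0 by (intro State_Mid[OF x(1)]) auto
    then have 1: "Mid d ((g - (d - x)) / pr + (pr - 1) / 2)" by simp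
    have "Mid (x + l0 - d) ((g - (d - x)) / pr + (pr - 1) / 2 + (g - (x + l0 - d)) / pr)"
      using Mid_attach[OF 1, of "x + l0 - d"] x l0 by simp
    from Mid_roots[OF this, of "M - 1"]
    have "Mid (x + l0 - d) ((g - (d - x)) / pr + (pr - 1) / 2 + (g - (x + l0 - d)) / pr + of_nat (M - 1) * g / pr)" .
    also have "(g - (d - x)) / pr + (pr - 1) / 2 + (g - (x + l0 - d)) / pr + of_nat (M - 1) * g / pr =
        (g - l0) / pr + (pr - 1) / 2 + of_nat M * g / pr"
    proof -
      have "(g - (d - x)) + (g - (x + l0 - d)) + of_nat (M - 1) * g = (g - l0) + of_nat M * g"
        using M1 by (simp add: of_nat_diff algebra_simps)
      then have "(g - (d - x)) / pr + (g - (x + l0 - d)) / pr + of_nat (M - 1) * g / pr = (g - l0) / pr + of_nat M * g / pr"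
        by (simp only: add_divide_distrib[symmetric])
      then show ?thesis by linarith
    qed
    finally show ?thesis using Mid_State full by simp
  qed
  \<comment> \<open>Residues modulo \<open>d\<close> are taken with 0 excluded and \<open>d\<close>
    included, so that a multiple of \<open>d\<close> shows up as the load \<open>d\<close>.\<close>
  have "\<exists>j::nat. 0 < of_nat (Suc i) * l0 - of_nat j * d \<and> of_nat (Suc i) * l0 - of_nat j * d \<le> d \<and>
      State (of_nat (Suc i) * l0 - of_nat j * d)" for i
  proof (induction i)
    case 0
    show ?case using init l0 g_bounds by (intro exI[of _ 0]) auto
  next
    case (Suc i)
    then obtain j :: nat where j: "0 < of_nat (Suc i) * l0 - of_nat j * d" "of_nat (Suc i) * l0 - of_nat j * d \<le> d"
      "State (of_nat (Suc i) * l0 - of_nat j * d)" by blast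
    define x where "x = of_nat (Suc i) * l0 - of_nat j * d"
    have x: "0 < x" "x \<le> d" "State x" using j by (simp_all add: x_def)
    have xS: "of_nat (Suc (Suc i)) * l0 - of_nat j * d = x + l0" by (simp add: x_def algebra_simps)
    have xS': "of_nat (Suc (Suc i)) * l0 - of_nat (Suc j) * d = x + l0 - d" by (simp add: x_def algebra_simps)
    show ?case
    proof (cases "x + l0 \<le> d")
      case True
      then show ?thesis using add[OF x(3)] x l0 xS by (intro exI[of _ j]) simp
    next
      case False
      then show ?thesis using close[OF x(3,2)] x l0 g_bounds xS' by (intro exI[of _ "Suc j"]) simp
    qed
  qed
  note orbit = this
  have "l0 / d > 0" using l0 d_pos by simp
  then obtain v u :: nat where uv: "v > 0" "u > 0" "l0 / d = of_nat u / of_nat v" using rat_quotient_nat by blast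
  then have vl: "of_nat v * l0 = of_nat u * d" using d_pos by (simp add: field_simps)
  obtain i where i: "v = Suc i" using uv(1) gr0_conv_Suc by blast
  obtain j :: nat where j: "0 < of_nat v * l0 - of_nat j * d" "of_nat v * l0 - of_nat j * d \<le> d"
    "State (of_nat v * l0 - of_nat j * d)" using orbit[of i] i by blast
  have e: "of_nat v * l0 - of_nat j * d = (of_nat u - of_nat j) * d" by (simp add: vl left_diff_distrib)
  have "rat_of_nat j < of_nat u" using j(1) d_pos unfolding e by (simp add: zero_less_mult_iff)
  then have "j < u" by simp
  moreover have "rat_of_nat u - of_nat j \<le> 1" using j(2) d_pos unfolding e by simp
  then have "rat_of_nat u \<le> of_nat (Suc j)" by simp
  then have "u \<le> Suc j" by (simp only: of_nat_le_iff)
  ultimately have "u = Suc j" by simp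
  then have "of_nat v * l0 - of_nat j * d = d" unfolding e by simp
  then show False using j(3) nd by simp
qed

lemma exact_tree:
  "\<exists>\<C> R. clique_tree t p \<C> \<and> R \<subseteq> \<Union>\<C> \<and> dense_over d (tree_graph \<C>) R \<and>
     of_nat (card (edges (tree_graph \<C>))) = d * of_nat (card (\<Union>\<C> - R))"
proof -
  obtain \<C> lw z where C: "clique_tree t p \<C>" "load_ok \<C> lw" "z \<in> \<Union>\<C>" "lw z = d" "\<forall>y\<in>\<Union>\<C> - {z}. lw y = 0 \<or> lw y = d"
    using exists_State_d unfolding State_def by blast
  define R where "R = {y \<in> \<Union>\<C>. lw y = 0}"
  have ld: "lw y = d" if "y \<in> \<Union>\<C> - R" for y using that C(4,5) by (auto simp: R_def)
  have finV: "finite (\<Union>\<C>)" using clique_tree_finite[OF C(1)] by auto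
  have sumS: "sum lw S = d * of_nat (card S)" if "S \<subseteq> \<Union>\<C> - R" for S
  proof -
    have "sum lw S = (\<Sum>y\<in>S. d)"
    proof (rule sum.cong)
      show "lw y = d" if "y \<in> S" for y using ld that \<open>S \<subseteq> \<Union>\<C> - R\<close> by blast
    qed simp
    then show ?thesis by simp
  qed
  have "dense_over d (tree_graph \<C>) R"
    unfolding dense_over_def tree_graph_def
  proof (intro allI impI)
    fix S assume "S \<subseteq> fst (\<Union>\<C>, \<Union>(pairs ` \<C>)) - R"
    then have S: "S \<subseteq> \<Union>\<C> - R" by simp
    have "sum lw S \<le> of_nat (card {e \<in> \<Union>(pairs ` \<C>). e \<inter> S \<noteq> {}})"
      using C(2) S unfolding load_ok_def by blast
    then show "d * of_nat (card S) \<le> of_nat (card {e \<in> snd (\<Union>\<C>, \<Union>(pairs ` \<C>)). e \<inter> S \<noteq> {}})"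
      using sumS[OF S] by simp
  qed
  moreover have "of_nat (card (edges (tree_graph \<C>))) = d * of_nat (card (\<Union>\<C> - R))"
  proof -
    have "sum lw (\<Union>\<C>) = sum lw (\<Union>\<C> - R)"
      using finV by (intro sum.mono_neutral_right) (auto simp: R_def)
    then show ?thesis using C(2) sumS[OF order_refl] by (simp add: load_ok_def tree_graph_def)
  qed
  moreover have "R \<subseteq> \<Union>\<C>" by (auto simp: R_def)
  ultimately show ?thesis using C(1) by blast
qed

end

section \<open>Upper bound\<close>

text \<open>The exponent of the expected number of \<open>s\<close>-cliques in a random graph of
  edge density \<open>n powr (- 1 / d)\<close>.\<close>

definition rexp :: "rat \<Rightarrow> nat \<Rightarrow> real" where
  "rexp d s = real s - real (s choose 2) / real_of_rat d"

lemma rexp_1: "rexp d 1 = 1"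
  by (simp add: rexp_def)

lemma exact_gadget_exists:
  assumes s: "s \<ge> 2" and d: "d > of_nat s / 2"
  shows "\<exists>p. exact_gadget s p d"
proof -
  define A where "A = {q. 1 \<le> q \<and> q < s \<and> rat_of_nat s + of_nat q - 1 < 2 * d}"
  have fin: "finite A" by (rule finite_subset[of _ "{..<s}"]) (auto simp: A_def)
  \<comment> \<open>Here \<open>d > s / 2\<close> makes \<open>p = 1\<close> admissible.\<close>
  have "1 \<in> A" using s d by (simp add: A_def field_simps)
  then have "Max A \<in> A" using fin by (intro Max_in) auto
  then have p: "1 \<le> Max A" "Max A < s" "rat_of_nat s + of_nat (Max A) - 1 < 2 * d" by (simp_all add: A_def)
  have "Max A + 1 = s \<or> 2 * d \<le> of_nat s + of_nat (Max A)"
  proof (rule disjCI, rule ccontr)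
    assume n: "\<not> 2 * d \<le> of_nat s + of_nat (Max A)" "Max A + 1 \<noteq> s"
    then have "Suc (Max A) \<in> A" using p by (simp add: A_def)
    then have "Suc (Max A) \<le> Max A" using fin by (intro Max_ge)
    then show False by simp
  qed
  then have "exact_gadget s (Max A) d" using p by unfold_locales auto
  then show ?thesis ..
qed

lemma clique_subset_edge:
  assumes "T \<in> cliques t G" "e \<subseteq> T" "card e = 2"
  shows "e \<in> edges G"
proof -
  obtain u v where "e = {u, v}" "u \<noteq> v" using assms(3) by (auto simp: card_2_iff)
  then show ?thesis using assms(1,2) by (simp add: cliques_def)
qed

lemma finite_cliques: "finite (verts G) \<Longrightarrow> finite (cliques t G)"
  by (rule finite_subset[of _ "Pow (verts G)"]) (auto simp: cliques_def)

lemma subset_clique: "T \<in> cliques t G \<Longrightarrow> Q \<subseteq> T \<Longrightarrow> card Q = q \<Longrightarrow> Q \<in> cliques q G"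
  by (auto simp: cliques_def)

lemma card_embeddings_le:
  assumes F: "finite (verts F)" "R \<subseteq> verts F" and G: "finite (verts G)"
    and B: "\<And>\<psi>. card (rooted_embeddings F R G \<psi>) \<le> B"
  shows "card (embeddings F G) \<le> card (verts G) ^ card R * B"
proof -
  let ?I = "PiE R (\<lambda>_. verts G)"
  have finR: "finite R" using F finite_subset by blast
  have finI: "finite ?I" using finR G by (intro finite_PiE) auto
  have "embeddings F G \<subseteq> (\<Union>\<psi>\<in>?I. rooted_embeddings F R G \<psi>)"
  proof
    fix \<phi> assume \<phi>: "\<phi> \<in> embeddings F G"
    then have "\<phi> ` verts F \<subseteq> verts G" by (simp add: embeddings_def)
    then have "restrict \<phi> R \<in> ?I" using F(2) by auto
    moreover have "\<phi> \<in> rooted_embeddings F R G (restrict \<phi> R)" using \<phi> by (simp add: rooted_embeddings_def)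
    ultimately show "\<phi> \<in> (\<Union>\<psi>\<in>?I. rooted_embeddings F R G \<psi>)" by blast
  qed
  then have "card (embeddings F G) \<le> card (\<Union>\<psi>\<in>?I. rooted_embeddings F R G \<psi>)"
    using finI finite_rooted_embeddings[OF F(1) G] by (intro card_mono) auto
  also have "\<dots> \<le> (\<Sum>\<psi>\<in>?I. card (rooted_embeddings F R G \<psi>))" by (rule card_UN_le[OF finI])
  also have "\<dots> \<le> (\<Sum>\<psi>\<in>?I. B)" by (intro sum_mono B)
  also have "\<dots> = card (verts G) ^ card R * B" using finR by (simp add: card_PiE)
  finally show ?thesis .
qed

lemma tree_embeddings_subset:
  assumes tree: "clique_tree t p \<C>" and H: "H \<subseteq> cliques t G"
  shows "tree_embeddings \<C> H \<subseteq> embeddings (tree_graph \<C>) G"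
proof
  fix \<phi> assume \<phi>: "\<phi> \<in> tree_embeddings \<C> H"
  have img: "\<phi> ` T \<in> cliques t G" if "T \<in> \<C>" for T using that \<phi> H by (auto simp: tree_embeddings_def)
  have inj: "inj_on \<phi> (\<Union>\<C>)" using \<phi> by (simp add: tree_embeddings_def)
  have "\<phi> x \<in> verts G" if x: "x \<in> \<Union>\<C>" for x
  proof -
    obtain T where "T \<in> \<C>" "x \<in> T" using x by blast
    then show ?thesis using img[of T] by (auto simp: cliques_def)
  qed
  moreover have "\<phi> ` e \<in> edges G" if e: "e \<in> \<Union>(pairs ` \<C>)" for e
  proof -
    obtain T where T: "T \<in> \<C>" "e \<subseteq> T" "card e = 2" using e by (auto simp: pairs_def)
    have "inj_on \<phi> e" by (rule inj_on_subset[OF inj]) (use T in blast)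
    then have "card (\<phi> ` e) = 2" using T(3) by (simp add: card_image)
    then show ?thesis using clique_subset_edge[OF img[OF T(1)]] T(2) by (simp add: image_mono)
  qed
  ultimately show "\<phi> \<in> embeddings (tree_graph \<C>) G"
    using \<phi> inj by (auto simp: embeddings_def tree_graph_def tree_embeddings_def)
qed

lemma tree_graph_step_edges:
  assumes tree: "clique_tree t p \<C>" and Q: "Q \<subseteq> \<Union>\<C>" and N: "finite N" "N \<inter> \<Union>\<C> = {}"
  shows "card (edges (tree_graph (insert (Q \<union> N) \<C>))) + (card Q choose 2) \<ge>
    card (edges (tree_graph \<C>)) + ((card Q + card N) choose 2)"
proof -
  define E where "E = \<Union>(pairs ` \<C>)"
  have fin: "finite (\<Union>\<C>)" using clique_tree_finite[OF tree] by auto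
  have finQ: "finite Q" using Q fin by (rule finite_subset)
  have finE: "finite E" using clique_tree_finite[OF tree] by (auto simp: E_def finite_pairs)
  have QN: "Q \<inter> N = {}" using Q N(2) by blast
  let ?D = "pairs (Q \<union> N) - pairs Q"
  have sub: "pairs Q \<subseteq> pairs (Q \<union> N)" by (auto simp: pairs_def)
  have finD: "finite (pairs (Q \<union> N))" using finQ N(1) by (simp add: finite_pairs)
  have "card ?D = card (pairs (Q \<union> N)) - card (pairs Q)"
    using finite_pairs[OF finQ] sub by (rule card_Diff_subset)
  moreover have "card (pairs Q) \<le> card (pairs (Q \<union> N))" using finD sub by (rule card_mono)
  ultimately have D: "card ?D + (card Q choose 2) = ((card Q + card N) choose 2)"
    using finQ N(1) QN by (simp add: card_pairs card_Un_disjoint)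
  have "E \<inter> ?D = {}"
  proof (rule ccontr)
    assume "E \<inter> ?D \<noteq> {}"
    then obtain e where e: "e \<in> E" "e \<in> ?D" by blast
    have "e \<subseteq> Q \<union> N" "card e = 2" "e \<notin> pairs Q" using e(2) by (auto simp: pairs_def)
    moreover have "e \<subseteq> \<Union>\<C>" using e(1) by (auto simp: E_def pairs_def)
    ultimately have "e \<subseteq> Q" using N(2) by blast
    then show False using \<open>card e = 2\<close> \<open>e \<notin> pairs Q\<close> by (simp add: pairs_def)
  qed
  then have "card E + card ?D = card (E \<union> ?D)" using finE finD by (simp add: card_Un_disjoint)
  also have "\<dots> \<le> card (edges (tree_graph (insert (Q \<union> N) \<C>)))"
    using finE finD by (intro card_mono) (auto simp: tree_graph_def E_def)
  finally show ?thesis using D by (simp add: E_def tree_graph_def)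
qed

context exact_gadget
begin

lemma real_d: "real_of_rat d > 0" "2 * real_of_rat d > real t + real p - 1"
proof -
  show "real_of_rat d > 0" using d_pos by simp
  have "real_of_rat (of_nat t + of_nat p - 1) < real_of_rat (2 * d)" using d1 by (simp only: of_rat_less)
  then show "2 * real_of_rat d > real t + real p - 1" by (simp add: of_rat_diff of_rat_add of_rat_mult)
qed

text \<open>Equivalent to \<open>t + p - 1 \<le> 2 * d\<close>. It makes the degree demanded of a
  \<open>p\<close>-clique at least a constant.\<close>

lemma rexp_le: "rexp d p \<le> rexp d t"
proof -
  have "(real t - real p) * (real t + real p - 1) \<le> (real t - real p) * (2 * real_of_rat d)"
    using p real_d by (intro mult_left_mono) auto
  then have "real (t choose 2) - real (p choose 2) \<le> (real t - real p) * real_of_rat d"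
    unfolding of_nat_choose_two by (simp add: algebra_simps diff_divide_distrib)
  then have "(real (t choose 2) - real (p choose 2)) / real_of_rat d \<le> real t - real p"
    using real_d(1) by (simp add: pos_divide_le_eq)
  then show ?thesis by (simp add: rexp_def diff_divide_distrib)
qed

text \<open>A set of \<open>j\<close> non-roots meets \<open>j * (2 * t - j - 1) / 2\<close> edges,
  and \<open>j \<le> t - p - 1\<close>. Maximality of \<open>p\<close> gives
  \<open>2 * d \<le> t + p\<close>, unless there are no non-roots.\<close>

lemma dense_over_complete_graph: "dense_over d (complete_graph t) {..<p + 1}"
  unfolding dense_over_def
proof (intro allI impI)
  fix S assume "S \<subseteq> verts (complete_graph t) - {..<p + 1}"
  then have S: "S \<subseteq> {p + 1..<t}" by (auto simp: complete_graph_def)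
  have finS: "finite S" using S finite_subset by blast
  have cS: "card S \<le> t - (p + 1)" using card_mono[OF _ S] by simp
  define j where "j = rat_of_nat (card S)"
  have j: "0 \<le> j" "j \<le> of_nat t - of_nat p - 1"
  proof -
    have "card S + p + 1 \<le> t" using cS p by simp
    then have "rat_of_nat (card S + p + 1) \<le> of_nat t" by (simp only: of_nat_le_iff)
    then show "j \<le> of_nat t - of_nat p - 1" by (simp add: j_def)
  qed (simp add: j_def)
  have "card ({..<t} - S) = t - card S" using S by (subst card_Diff_subset[OF finS]) auto
  then have c: "rat_of_nat (card ({..<t} - S)) = of_nat t - j" using cS p by (simp add: j_def of_nat_diff)
  have p0: "pairs ({} :: nat set) = {}" by (auto simp: pairs_def)
  have "rat_of_nat (card {e \<in> edges (complete_graph t). e \<inter> S \<noteq> {}}) = rat_of_nat (card {e \<in> pairs {..<t} - pairs {}. e \<inter> S \<noteq> {}})"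
    unfolding p0 by (simp add: complete_graph_def pairs_def)
  also have "\<dots> = of_nat t * (of_nat t - 1) / 2 - (of_nat t - j) * (of_nat t - j - 1) / 2"
    using S by (subst card_pairs_touching) (auto simp: of_nat_choose_two c)
  also have "\<dots> = j * (2 * of_nat t - j - 1) / 2"
    by (simp add: algebra_simps diff_divide_distrib add_divide_distrib)
  finally have E: "rat_of_nat (card {e \<in> edges (complete_graph t). e \<inter> S \<noteq> {}}) = j * (2 * of_nat t - j - 1) / 2" .
  have "j * (2 * d) \<le> j * (2 * of_nat t - j - 1)"
  proof (cases "p + 1 = t")
    case True
    then have "j = 0" using j by auto
    then show ?thesis by simp
  next
    case False
    then have "2 * d \<le> 2 * of_nat t - j - 1" using d2 j by linarith
    then show ?thesis using j(1) by (rule mult_left_mono)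
  qed
  then show "d * of_nat (card S) \<le> of_nat (card {e \<in> edges (complete_graph t). e \<inter> S \<noteq> {}})"
    unfolding E j_def[symmetric] by (simp add: mult.commute mult.left_commute)
qed

text \<open>Cliques on a fixed \<open>(p + 1)\<close>-set give rooted embeddings of a complete graph
  that is dense over these roots.\<close>

lemma hdeg_cliques_le:
  fixes G :: "nat ugraph"
  assumes G: "simple_graph G" "power_free M d L G" and L: "L \<ge> 1" and M: "t \<le> M" and Q: "card Q = p + 1"
  shows "hdeg (cliques t G) Q \<le> (L * (M + 1) ^ M) ^ M"
proof -
  have finG: "finite (verts G)" using G(1) by (simp add: simple_graph_def)
  have finQ: "finite Q" using Q by (metis Suc_eq_plus1 card.infinite nat.distinct(1))
  define N where "N = {P \<in> cliques t G. Q \<subseteq> P}"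
  have NP: "finite P" "card P = t" "Q \<subseteq> P" "P \<in> cliques t G" if "P \<in> N" for P
    using that finG finite_subset by (auto simp: N_def cliques_def)
  obtain \<psi> where \<psi>: "bij_betw \<psi> {..<p + 1} Q" using finQ Q by (metis card_lessThan finite_lessThan finite_same_card_bij)
  have "\<forall>P\<in>N. \<exists>g. bij_betw g {p + 1..<t} (P - Q)"
  proof
    fix P assume P: "P \<in> N"
    have "card (P - Q) = t - (p + 1)" using NP[OF P] finQ Q by (simp add: card_Diff_subset)
    then show "\<exists>g. bij_betw g {p + 1..<t} (P - Q)" using NP[OF P] by (intro finite_same_card_bij) auto
  qed
  then obtain g where g: "\<And>P. P \<in> N \<Longrightarrow> bij_betw (g P) {p + 1..<t} (P - Q)" by metis
  define \<phi> where "\<phi> P = (\<lambda>x\<in>{..<t}. if x < p + 1 then \<psi> x else g P x)" for P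
  have split: "{..<t} = {..<p + 1} \<union> {p + 1..<t}" using p by auto
  have bij: "bij_betw (\<phi> P) {..<t} P" if P: "P \<in> N" for P
  proof -
    have "bij_betw (\<phi> P) {..<p + 1} Q"
      using \<psi> p by (subst bij_betw_cong[of _ _ \<psi>]) (auto simp: \<phi>_def)
    moreover have "bij_betw (\<phi> P) {p + 1..<t} (P - Q)"
      using g[OF P] by (subst bij_betw_cong[of _ _ "g P"]) (auto simp: \<phi>_def)
    ultimately have "bij_betw (\<phi> P) ({..<p + 1} \<union> {p + 1..<t}) (Q \<union> (P - Q))"
      by (rule bij_betw_combine) auto
    moreover have "Q \<union> (P - Q) = P" using NP(3)[OF P] by auto
    ultimately show ?thesis using split by simp
  qed
  let ?RE = "rooted_embeddings (complete_graph t) {..<p + 1} G \<psi>"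
  have "card N \<le> card ?RE"
  proof (rule card_inj_on_le)
    show "inj_on \<phi> N"
    proof (rule inj_onI)
      fix P P' assume P: "P \<in> N" "P' \<in> N" "\<phi> P = \<phi> P'"
      have "P = \<phi> P ` {..<t}" "P' = \<phi> P' ` {..<t}" using bij P(1,2) by (simp_all add: bij_betw_def)
      then show "P = P'" using P(3) by simp
    qed
    show "\<phi> ` N \<subseteq> ?RE"
    proof (rule image_subsetI)
      fix P assume P: "P \<in> N"
      have inj: "inj_on (\<phi> P) {..<t}" and img: "\<phi> P ` {..<t} = P" using bij[OF P] by (auto simp: bij_betw_def)
      have "P \<subseteq> verts G" using NP[OF P] by (simp add: cliques_def)
      moreover have "\<phi> P ` e \<in> edges G" if e: "e \<subseteq> {..<t}" "card e = 2" for e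
      proof -
        have "card (\<phi> P ` e) = 2" using card_image[OF inj_on_subset[OF inj e(1)]] e(2) by simp
        moreover have "\<phi> P ` e \<subseteq> P" using image_mono[OF e(1), of "\<phi> P"] img by simp
        ultimately show ?thesis using clique_subset_edge[OF NP(4)[OF P]] by blast
      qed
      ultimately have "\<phi> P \<in> embeddings (complete_graph t) G"
        using inj img by (auto simp: embeddings_def complete_graph_def \<phi>_def)
      then show "\<phi> P \<in> ?RE" using p by (auto simp: rooted_embeddings_def \<phi>_def)
    qed
    show "finite ?RE" using finG by (intro finite_rooted_embeddings) (auto simp: complete_graph_def)
  qed
  also have "\<dots> \<le> (L * (M + 1) ^ M) ^ card (verts (complete_graph t) - {..<p + 1})"
    using M p by (intro power_free_bound[OF finG G(2) L d_pos _ _ _ dense_over_complete_graph])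
      (auto simp: complete_graph_def simple_graph_def)
  also have "\<dots> \<le> (L * (M + 1) ^ M) ^ M"
  proof (rule power_increasing)
    have "card (verts (complete_graph t) - {..<p + 1}) \<le> card {..<t}"
      by (intro card_mono) (auto simp: complete_graph_def)
    then show "card (verts (complete_graph t) - {..<p + 1}) \<le> M" using M by simp
  qed (use L in \<open>simp add: Suc_le_eq\<close>)
  finally show ?thesis by (simp add: hdeg_def N_def)
qed

lemma cliques_bound_step:
  fixes \<C> :: "nat set set" and R :: "nat set" and M L :: nat
  assumes tree: "clique_tree t p \<C>" and R: "R \<subseteq> \<Union>\<C>" "dense_over d (tree_graph \<C>) R"
    and exact: "of_nat (card (edges (tree_graph \<C>))) = d * of_nat (card (\<Union>\<C> - R))"
    and M: "\<Union>\<C> \<subseteq> {..<M}" "t \<le> M" and L: "L \<ge> 1" and Cp: "Cp \<ge> 0"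
  shows "\<exists>C\<ge>0. \<forall>n\<ge>1. \<forall>G :: nat ugraph. simple_graph G \<longrightarrow> verts G = {..<n} \<longrightarrow> power_free M d L G \<longrightarrow>
      real (card (cliques p G)) \<le> Cp * real n powr rexp d p \<longrightarrow>
      real (card (cliques t G)) \<le> C * real n powr rexp d t"
proof -
  define B where "B = (L * (M + 1) ^ M) ^ M"
  define m where "m = card (\<Union>\<C>)"
  \<comment> \<open>Larger than \<open>B\<close> for the final contradiction, at least 2 because
    each extension loses half of the degree, and large enough for
    \<open>hdeg_avoiding\<close>.\<close>
  define K where "K = 2 + B + 2 * (2 ^ t * (m * B))"
  \<comment> \<open>\<open>K * (1 + Cp)\<close> covers the cost of cleaning at vertices and
    \<open>p\<close>-cliques; the other \<open>K\<close> is for the cliques that remain.\<close>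
  define C where "C = real K * (1 + Cp) + real K"
  have finV: "finite (\<Union>\<C>)" using clique_tree_finite[OF tree] by auto
  have main: "real (card (cliques t G)) \<le> C * real n powr rexp d t"
    if n: "n \<ge> 1" and G: "simple_graph G" "verts G = {..<n}" "power_free M d L G"
      and cp: "real (card (cliques p G)) \<le> Cp * real n powr rexp d p" for n and G :: "nat ugraph"
  proof (rule ccontr)
    assume neg: "\<not> real (card (cliques t G)) \<le> C * real n powr rexp d t"
    have finG: "finite (verts G)" using G(2) by simp
    \<comment> \<open>The expected orders of the numbers of \<open>t\<close>-cliques and
      \<open>q\<close>-cliques, divided: the typical degree of a \<open>q\<close>-clique.\<close>
    define w where "w q = real n powr (rexp d t - rexp d q)" for q
    define \<Q> where "\<Q> = (\<lambda>x. {x}) ` {..<n} \<union> cliques p G"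
    define \<alpha> where "\<alpha> Q = real K * w (card Q)" for Q :: "nat set"
    have \<alpha>0: "\<alpha> Q \<ge> 0" for Q by (simp add: \<alpha>_def w_def)
    have n0: "real n > 0" using n by simp
    have finQ: "finite \<Q>" using finite_cliques[OF finG] by (simp add: \<Q>_def)
    have "sum \<alpha> \<Q> \<le> sum \<alpha> ((\<lambda>x. {x}) ` {..<n}) + sum \<alpha> (cliques p G)"
      unfolding \<Q>_def using finite_cliques[OF finG] by (subst sum_Un) (auto intro!: sum_nonneg simp: \<alpha>_def w_def)
    also have "sum \<alpha> ((\<lambda>x. {x}) ` {..<n}) = real n * (real K * w 1)"
      by (subst sum.reindex) (auto simp: \<alpha>_def)
    also have "sum \<alpha> (cliques p G) = (\<Sum>Q\<in>cliques p G. real K * w p)"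
      by (rule sum.cong) (auto simp: \<alpha>_def cliques_def)
    also have "\<dots> = real (card (cliques p G)) * (real K * w p)" by simp
    also have "\<dots> \<le> (Cp * real n powr rexp d p) * (real K * w p)"
      using cp by (intro mult_right_mono) (auto simp: w_def)
    also have "\<dots> = real K * Cp * real n powr rexp d t"
      by (simp add: w_def powr_diff n0)
    also have "real n * (real K * w 1) = real K * real n powr rexp d t"
      using n0 by (simp add: w_def rexp_1[simplified] powr_diff)
    finally have "sum \<alpha> \<Q> + real K * real n powr rexp d t \<le> C * real n powr rexp d t"
      by (simp add: C_def algebra_simps)
    then have "sum \<alpha> \<Q> + real K * real n powr rexp d t \<le> real (card (cliques t G))" using neg by simp
    then obtain H where H: "H \<subseteq> cliques t G" "real K * real n powr rexp d t \<le> real (card H)"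
      "\<forall>Q\<in>\<Q>. \<forall>P\<in>H. Q \<subseteq> P \<longrightarrow> \<alpha> Q \<le> real (hdeg H Q)"
      using clean_hypergraph[OF finQ finite_cliques[OF finG], of \<alpha>] \<alpha>0 by meson
    have finH: "finite H" using H(1) finite_cliques[OF finG] by (rule finite_subset)
    have HP: "finite P \<and> card P = t" if "P \<in> H" for P
    proof -
      have "P \<subseteq> verts G" "card P = t" using that H(1) by (auto simp: cliques_def)
      then show ?thesis using finite_subset[OF _ finG] by simp
    qed
    have deg: "real K * w (card Q) \<le> real (hdeg H Q)"
      if Q: "P \<in> H" "Q \<subseteq> P" "card Q = 1 \<or> card Q = p" for P Q
    proof -
      have "Q \<in> \<Q>"
      proof (cases "card Q = p")
        case True
        have "P \<in> cliques t G" using Q(1) H(1) by blast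
        from subset_clique[OF this Q(2) True] show ?thesis by (simp add: \<Q>_def)
      next
        case False
        then obtain x where x: "Q = {x}" using Q(3) card_1_singletonE by blast
        have "P \<subseteq> {..<n}" using Q(1) H(1) G(2) by (auto simp: cliques_def)
        then have "x \<in> {..<n}" using x Q(2) by blast
        then show ?thesis by (simp add: \<Q>_def x)
      qed
      then show ?thesis using H(3) Q(1,2) by (auto simp: \<alpha>_def)
    qed
    \<comment> \<open>\<open>K\<close> times the expected number of embeddings into a random graph
      of edge density \<open>n powr (- 1 / d)\<close>; for the exact tree the exponent is
      \<open>card R\<close>.\<close>
    define f where "f \<C>' = real K * real n powr (real (card (\<Union>\<C>')) - real (card (edges (tree_graph \<C>'))) / real_of_rat d)"
      for \<C>'
    have "f \<C> \<le> real (card (tree_embeddings \<C> H))"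
    proof (rule card_tree_embeddings[OF finH HP p, where \<kappa> = K and B = B and w = w and m = m])
      show "K \<le> hdeg H Q" if Q: "P \<in> H" "Q \<subseteq> P" "card Q = p" for P Q
      proof -
        have "w p \<ge> 1" using n rexp_le by (simp add: w_def ge_one_powr_ge_zero)
        then have "real K * 1 \<le> real K * w p" by (intro mult_left_mono) auto
        also have "\<dots> \<le> real (hdeg H Q)" using deg[OF Q(1,2)] Q(3) by simp
        finally show ?thesis by simp
      qed
      show "hdeg H Q \<le> B" if "card Q = p + 1" for Q
      proof -
        have "hdeg H Q \<le> hdeg (cliques t G) Q"
          unfolding hdeg_def using H(1) finite_cliques[OF finG] by (intro card_mono) auto
        also have "\<dots> \<le> B" unfolding B_def by (rule hdeg_cliques_le[OF G(1,3) L M(2) that])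
        finally show ?thesis .
      qed
      show "2 * (2 ^ t * (m * B)) \<le> K" "0 < K" by (simp_all add: K_def)
      show "0 \<le> w 1" "0 \<le> w p" by (simp_all add: w_def)
      show "2 * w (card Q) \<le> real (hdeg H Q)" if Q: "P \<in> H" "Q \<subseteq> P" "card Q = 1 \<or> card Q = p" for P Q
      proof -
        have "2 * w (card Q) \<le> real K * w (card Q)" by (intro mult_right_mono) (auto simp: K_def w_def)
        then show ?thesis using deg[OF Q] by linarith
      qed
      show "clique_tree t p \<C>" by (rule tree)
      show "card (\<Union>\<C>) \<le> m" by (simp add: m_def)
      show "f {T} \<le> real (card H)" if "finite T" "card T = t" for T
        using that H(2) by (simp add: f_def tree_graph_def card_pairs rexp_def)
      show "f (insert (Q \<union> N) \<C>') \<le> f \<C>' * w (card Q)"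
        if c: "clique_tree t p \<C>'" "Q \<subseteq> \<Union>\<C>'" "N \<inter> \<Union>\<C>' = {}" "card N + card Q = t" "finite N" for \<C>' Q N
      proof -
        have finV': "finite (\<Union>\<C>')" using clique_tree_finite[OF c(1)] by auto
        have U: "\<Union>(insert (Q \<union> N) \<C>') = \<Union>\<C>' \<union> N" using c(2) by auto
        have v: "card (\<Union>(insert (Q \<union> N) \<C>')) = card (\<Union>\<C>') + card N"
          unfolding U using finV' c(5,3) by (intro card_Un_disjoint) auto
        define e where "e = real (card (edges (tree_graph \<C>')))"
        define e' where "e' = real (card (edges (tree_graph (insert (Q \<union> N) \<C>'))))"
        have "card (edges (tree_graph \<C>')) + (t choose 2) \<le>
            card (edges (tree_graph (insert (Q \<union> N) \<C>'))) + (card Q choose 2)"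
          using tree_graph_step_edges[OF c(1,2,5,3)] c(4) by (simp add: add.commute)
        then have "real (card (edges (tree_graph \<C>')) + (t choose 2)) \<le>
            real (card (edges (tree_graph (insert (Q \<union> N) \<C>'))) + (card Q choose 2))"
          by (simp only: of_nat_le_iff)
        then have "e + real (t choose 2) - real (card Q choose 2) \<le> e'" by (simp add: e_def e'_def)
        then have "(e + real (t choose 2) - real (card Q choose 2)) / real_of_rat d \<le> e' / real_of_rat d"
          using real_d(1) by (intro divide_right_mono) auto
        moreover have "real t = real (card N) + real (card Q)" using c(4) by (metis of_nat_add)
        ultimately have "real (card (\<Union>\<C>') + card N) - e' / real_of_rat d \<le>
            (real (card (\<Union>\<C>')) - e / real_of_rat d) + (rexp d t - rexp d (card Q))"
          by (simp add: rexp_def add_divide_distrib diff_divide_distrib)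
        then have "real n powr (real (card (\<Union>\<C>') + card N) - e' / real_of_rat d) \<le>
            real n powr ((real (card (\<Union>\<C>')) - e / real_of_rat d) + (rexp d t - rexp d (card Q)))"
          using n by (intro powr_mono) auto
        also have "\<dots> = real n powr (real (card (\<Union>\<C>')) - e / real_of_rat d) * w (card Q)"
          unfolding w_def by (rule powr_add)
        finally show ?thesis unfolding f_def v e_def e'_def by (simp add: mult_left_mono mult.assoc)
      qed
    qed
    also have "card (tree_embeddings \<C> H) \<le> card (embeddings (tree_graph \<C>) G)"
      using tree_embeddings_subset[OF tree H(1)] finV finG
      by (intro card_mono finite_embeddings) (auto simp: tree_graph_def)
    also have "card (embeddings (tree_graph \<C>) G) \<le> card (verts G) ^ card R * B"
    proof (rule card_embeddings_le)
      show "finite (verts (tree_graph \<C>))" "R \<subseteq> verts (tree_graph \<C>)" using finV R by (auto simp: tree_graph_def)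
      show "finite (verts G)" by (rule finG)
      show "card (rooted_embeddings (tree_graph \<C>) R G \<psi>) \<le> B" for \<psi>
      proof -
        have "card (rooted_embeddings (tree_graph \<C>) R G \<psi>) \<le> (L * (M + 1) ^ M) ^ card (verts (tree_graph \<C>) - R)"
          using simple_graph_tree_graph[OF tree] M R
          by (intro power_free_bound[OF finG G(3) L d_pos]) (auto simp: tree_graph_def)
        also have "\<dots> \<le> B"
          unfolding B_def
        proof (rule power_increasing)
          have "card (verts (tree_graph \<C>) - R) \<le> card {..<M}"
            using M by (intro card_mono) (auto simp: tree_graph_def)
          then show "card (verts (tree_graph \<C>) - R) \<le> M" by simp
        qed (use L in \<open>simp add: Suc_le_eq\<close>)
        finally show ?thesis .
      qed
    qed
    finally have "f \<C> \<le> real (n ^ card R * B)" using G(2) by simp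
    moreover have "f \<C> = real K * real n ^ card R"
    proof -
      have "real (card (edges (tree_graph \<C>))) = real_of_rat (of_nat (card (edges (tree_graph \<C>))))" by simp
      also have "\<dots> = real_of_rat d * real (card (\<Union>\<C> - R))" unfolding exact by (simp add: of_rat_mult)
      finally have "real (card (edges (tree_graph \<C>))) / real_of_rat d = real (card (\<Union>\<C> - R))"
        using real_d(1) by simp
      moreover have "real (card (\<Union>\<C>)) = real (card (\<Union>\<C> - R)) + real (card R)"
        using card_Diff_subset[OF finite_subset[OF R(1) finV] R(1)] card_mono[OF finV R(1)] by simp
      ultimately show ?thesis using n0 by (simp add: f_def powr_realpow)
    qed
    ultimately have "real K * real n ^ card R \<le> real B * real n ^ card R" by (simp add: mult.commute)
    then have "real K \<le> real B" using n0 by simp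
    then have "K \<le> B" by simp
    then show False by (simp add: K_def)
  qed
  have "C \<ge> 0" using Cp by (simp add: C_def)
  then show ?thesis using main by blast
qed

end

definition has_exact_tree :: "rat \<Rightarrow> nat \<Rightarrow> nat \<Rightarrow> bool" where
  "has_exact_tree d s M \<longleftrightarrow> (\<exists>p \<C> R. exact_gadget s p d \<and> clique_tree s p \<C> \<and> R \<subseteq> \<Union>\<C> \<and>
     dense_over d (tree_graph \<C>) R \<and> of_nat (card (edges (tree_graph \<C>))) = d * of_nat (card (\<Union>\<C> - R)) \<and> \<Union>\<C> \<subseteq> {..<M})"

lemma has_exact_tree_mono: "has_exact_tree d s M \<Longrightarrow> M \<le> M' \<Longrightarrow> has_exact_tree d s M'"
  unfolding has_exact_tree_def by (metis lessThan_subset_iff order_trans)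

lemma exists_vertex_bound:
  fixes d :: rat
  assumes d: "d > of_nat t / 2"
  shows "\<exists>M\<ge>t. \<forall>s\<in>{2..t}. has_exact_tree d s M"
proof -
  have "\<exists>M. has_exact_tree d s M" if s: "s \<in> {2..t}" for s
  proof -
    have "rat_of_nat s / 2 \<le> of_nat t / 2" using s by (simp add: divide_right_mono)
    then have "d > of_nat s / 2" using d by linarith
    then obtain p where p: "exact_gadget s p d" using exact_gadget_exists[of s d] s by auto
    obtain \<C> R where C: "clique_tree s p \<C>" "R \<subseteq> \<Union>\<C>" "dense_over d (tree_graph \<C>) R"
      "of_nat (card (edges (tree_graph \<C>))) = d * of_nat (card (\<Union>\<C> - R))"
      using exact_gadget.exact_tree[OF p] by blast
    have "finite (\<Union>\<C>)" using clique_tree_finite[OF C(1)] by auto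
    then obtain M where "\<Union>\<C> \<subseteq> {..<M}" using finite_nat_iff_bounded by blast
    then have "has_exact_tree d s M" unfolding has_exact_tree_def using p C by blast
    then show ?thesis ..
  qed
  then obtain m where m: "\<And>s. s \<in> {2..t} \<Longrightarrow> has_exact_tree d s (m s)" by metis
  define M where "M = t + (\<Sum>s\<in>{2..t}. m s)"
  have "has_exact_tree d s M" if s: "s \<in> {2..t}" for s
    using has_exact_tree_mono[OF m[OF s], of M] member_le_sum[of s "{2..t}" m] s by (auto simp: M_def)
  then show ?thesis by (intro exI[of _ M]) (simp add: M_def)
qed

text \<open>Strong induction on \<open>s\<close>, because the cleaning at \<open>p\<close>-cliques
  with \<open>p < s\<close> is paid for by the bound on their number; \<open>M\<close> and
  \<open>L\<close> stay fixed.\<close>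

lemma cliques_upper_bound:
  fixes d :: rat
  assumes d: "d > of_nat t / 2" and L: "L \<ge> 1" and M: "M \<ge> t"
    and trees: "\<forall>s\<in>{2..t}. has_exact_tree d s M"
    and s: "1 \<le> s" "s \<le> t"
  shows "\<exists>C\<ge>0. \<forall>n\<ge>1. \<forall>G :: nat ugraph. simple_graph G \<longrightarrow> verts G = {..<n} \<longrightarrow> power_free M d L G \<longrightarrow>
      real (card (cliques s G)) \<le> C * real n powr rexp d s"
  using s
proof (induction s rule: less_induct)
  case (less s)
  show ?case
  proof (cases "s = 1")
    case True
    have "real (card (cliques s G)) \<le> 1 * real n powr rexp d s" if G: "verts G = {..<n}" "n \<ge> 1" for n and G :: "nat ugraph"
    proof -
      have "cliques s G \<subseteq> (\<lambda>x. {x}) ` {..<n}"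
      proof
        fix T assume "T \<in> cliques s G"
        then have T: "T \<subseteq> {..<n}" "card T = 1" using G(1) by (simp_all add: True cliques_def)
        obtain x where "T = {x}" using T(2) by (rule card_1_singletonE)
        then show "T \<in> (\<lambda>x. {x}) ` {..<n}" using T(1) by simp
      qed
      then have "card (cliques s G) \<le> card ((\<lambda>x. {x}) ` {..<n})" by (intro card_mono) auto
      also have "\<dots> \<le> n" using card_image_le[of "{..<n}" "\<lambda>x. {x}"] by simp
      finally show ?thesis using G(2) by (simp add: True rexp_1[simplified])
    qed
    then show ?thesis by (intro exI[of _ 1]) auto
  next
    case False
    then have "s \<in> {2..t}" using less.prems by auto
    then obtain p \<C> R where T: "exact_gadget s p d" "clique_tree s p \<C>" "R \<subseteq> \<Union>\<C>"
      "dense_over d (tree_graph \<C>) R" "of_nat (card (edges (tree_graph \<C>))) = d * of_nat (card (\<Union>\<C> - R))" "\<Union>\<C> \<subseteq> {..<M}"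
      using trees unfolding has_exact_tree_def by blast
    have p: "1 \<le> p" "p < s" using exact_gadget.p[OF T(1)] by auto
    obtain Cp where Cp: "Cp \<ge> 0" "\<forall>n\<ge>1. \<forall>G :: nat ugraph. simple_graph G \<longrightarrow> verts G = {..<n} \<longrightarrow> power_free M d L G \<longrightarrow>
      real (card (cliques p G)) \<le> Cp * real n powr rexp d p" using less.IH[OF p(2,1)] p less.prems by auto
    have sM: "s \<le> M" using less.prems M by simp
    show ?thesis using exact_gadget.cliques_bound_step[OF T(1-6) sM L Cp(1)] Cp(2) by meson
  qed
qed

text \<open>A star rooted at its leaves has the centre as its only non-root, so it is balanced, and
  its density is the number of leaves.\<close>

lemma balanced_family_nonempty:
  assumes "d \<le> of_nat D" "D < M" "d > 0"
  shows "balanced_family M d \<noteq> {}"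
proof -
  define F where "F = ({..<D + 1}, (\<lambda>i. {0, i}) ` {1..D})"
  define R where "R = {1..D}"
  have nr: "verts F - R = {0}" by (auto simp: F_def R_def)
  have "rooted_graph F R" by (auto simp: rooted_graph_def simple_graph_def F_def R_def)
  moreover have "balanced F R"
    unfolding balanced_def rooted_density_def nr
  proof (intro allI impI)
    fix S :: "nat set" assume "S \<noteq> {} \<and> S \<subseteq> {0}"
    then have "S = {0}" by auto
    then show "set_density F {0} \<le> set_density F S" by simp
  qed
  moreover have "d \<le> rooted_density F R"
  proof -
    have "{e \<in> edges F. e \<inter> {0} \<noteq> {}} = (\<lambda>i. {0, i}) ` {1..D}" by (auto simp: F_def)
    moreover have "card ((\<lambda>i. {0::nat, i}) ` {1..D}) = D"
      by (subst card_image) (auto simp: inj_on_def doubleton_eq_iff)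
    ultimately show ?thesis using assms(1) by (simp add: rooted_density_def nr set_density_def)
  qed
  moreover have "verts F \<subseteq> {..<M}" using assms(2) by (auto simp: F_def)
  ultimately have "(F, R) \<in> balanced_family M d" by (simp add: balanced_family_def)
  then show ?thesis by blast
qed

theorem theorem5p1:
  fixes t :: nat and d :: rat
  assumes "t \<ge> 2" and "d > of_nat t / 2"
  shows "\<exists>(k::nat) (F :: nat \<Rightarrow> nat ugraph) (R :: nat \<Rightarrow> nat set).
      k \<ge> 1 \<and>
      (\<forall>i\<in>{1..k}. rooted_graph (F i) (R i) \<and> balanced (F i) (R i) \<and>
                   rooted_density (F i) (R i) \<ge> d) \<and>
      (\<exists>L0::nat. \<forall>L\<ge>L0.
         (\<lambda>n. real (ex_num n (complete_graph t) (\<Union>i\<in>{1..k}. rooted_power (F i) (R i) L)))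
           \<in> \<Theta>(\<lambda>n. real n powr (real t - real (t choose 2) / real_of_rat d)))"
proof -
  have d0: "d > 0" using assms(2) by (meson divide_nonneg_pos le_less_trans of_nat_0_le_iff zero_less_numeral)
  obtain D :: nat where D: "d \<le> of_nat D" by (rule that[of "nat \<lceil>d\<rceil>"]) (use d0 in linarith)
  obtain M0 where M0: "t \<le> M0" "\<forall>s\<in>{2..t}. has_exact_tree d s M0"
    using exists_vertex_bound[OF assms(2)] by blast
  \<comment> \<open>Accommodates the exact trees for all \<open>s \<le> t\<close> and a star with
    \<open>D\<close> leaves.\<close>
  define M where "M = M0 + D + 1"
  have trees: "\<forall>s\<in>{2..t}. has_exact_tree d s M"
    using M0(2) by (auto intro: has_exact_tree_mono simp: M_def)
  have tM: "t \<le> M" using M0(1) by (simp add: M_def)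
  define fam where "fam = balanced_family M d"
  have finf: "finite fam" unfolding fam_def by (rule finite_balanced_family)
  obtain h where h: "bij_betw h {1..card fam} fam" using ex_bij_betw_nat_finite_1[OF finf] by blast
  define F where "F i = fst (h i)" for i
  define R where "R i = snd (h i)" for i
  have fam: "fam = (\<lambda>i. (F i, R i)) ` {1..card fam}" using h by (simp add: bij_betw_def F_def R_def)
  have "fam \<noteq> {}" unfolding fam_def using D d0 by (intro balanced_family_nonempty) (auto simp: M_def)
  then have k: "card fam \<ge> 1" using finf by (simp add: Suc_le_eq card_gt_0_iff)
  have mem: "rooted_graph (F i) (R i) \<and> balanced (F i) (R i) \<and> rooted_density (F i) (R i) \<ge> d" if "i \<in> {1..card fam}" for i
  proof -
    have "(F i, R i) \<in> fam" using fam that by blast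
    then show ?thesis by (simp add: fam_def balanced_family_def)
  qed
  have free: "free_of (\<Union>i\<in>{1..card fam}. rooted_power (F i) (R i) L) G \<longleftrightarrow> power_free M d L G"
    for L and G :: "nat ugraph"
  proof -
    have "power_free M d L G \<longleftrightarrow> (\<forall>(F, R)\<in>(\<lambda>i. (F i, R i)) ` {1..card fam}. free_of (rooted_power F R L) G)"
      unfolding power_free_def fam_def[symmetric] by (subst fam) (rule refl)
    then show ?thesis by (auto simp: free_of_def)
  qed
  define r where "r = real t - real (t choose 2) / real_of_rat d"
  obtain L1 n0 c where low: "c > 0" "\<And>n. n \<ge> n0 \<Longrightarrow> \<exists>G :: nat ugraph. simple_graph G \<and> verts G = {..<n} \<and>
     (\<forall>L>L1. power_free M d L G) \<and> c * real n powr r \<le> real (card (cliques t G))"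
    using power_free_graphs_with_many_cliques[of t d M] assms unfolding r_def M_def by fastforce
  \<comment> \<open>\<open>L\<close> affects only the constant of the upper bound. The lower bound
    needs \<open>L\<close> to exceed the number of embeddings that the host graphs allow on common
    roots.\<close>
  have theta: "(\<lambda>n. real (ex_num n (complete_graph t) (\<Union>i\<in>{1..card fam}. rooted_power (F i) (R i) L))) \<in> \<Theta>(\<lambda>n. real n powr r)"
    if L: "L \<ge> L1 + 1" for L
  proof -
    define ex where "ex n = real (ex_num n (complete_graph t) (\<Union>i\<in>{1..card fam}. rooted_power (F i) (R i) L))" for n
    have "1 \<le> L" "1 \<le> t" using L assms(1) by simp_all
    from cliques_upper_bound[OF assms(2) this(1) tM trees this(2) order_refl]
    obtain C where C: "\<And>n. \<And>G :: nat ugraph. n \<ge> 1 \<Longrightarrow> simple_graph G \<Longrightarrow> verts G = {..<n} \<Longrightarrow> power_free M d L G \<Longrightarrow>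
      real (card (cliques t G)) \<le> C * real n powr r" unfolding rexp_def r_def by metis
    have lower: "c * real n powr r \<le> ex n" if n: "n \<ge> n0" for n
    proof -
      obtain G :: "nat ugraph" where G: "simple_graph G" "verts G = {..<n}" "\<forall>L>L1. power_free M d L G"
        "c * real n powr r \<le> real (card (cliques t G))" using low(2)[OF n] by blast
      have "power_free M d L G" using G(3) L by simp
      then have "card (copies (complete_graph t) G) \<le> ex_num n (complete_graph t) (\<Union>i\<in>{1..card fam}. rooted_power (F i) (R i) L)"
        using G(1,2) free by (intro ex_num_ge) auto
      then show ?thesis using G(2,4) by (simp add: card_copies_complete_graph ex_def)
    qed
    \<comment> \<open>From \<open>n0\<close> on the lower bound supplies a free graph, so
      \<open>ex_num\<close> is the maximum of a nonempty set.\<close>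
    have upper: "ex n \<le> C * real n powr r" if n: "n \<ge> max n0 1" for n
      unfolding ex_def
    proof (rule ex_num_le)
      show "real (card (copies (complete_graph t) G)) \<le> C * real n powr r"
        if "simple_graph G" "verts G = {..<n}" "free_of (\<Union>i\<in>{1..card fam}. rooted_power (F i) (R i) L) G" for G :: "nat ugraph"
        using that C[of n G] n free by (simp add: card_copies_complete_graph)
      have "n \<ge> n0" using n by simp
      then show "\<exists>G :: nat ugraph. simple_graph G \<and> verts G = {..<n} \<and> free_of (\<Union>i\<in>{1..card fam}. rooted_power (F i) (R i) L) G"
        using low(2)[of n] L free by (metis Suc_eq_plus1 Suc_le_lessD)
    qed
    have ex0: "ex n \<ge> 0" for n by (simp add: ex_def)
    have "ex \<in> O(\<lambda>n. real n powr r)"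
      using upper ex0 by (intro bigoI[of _ C] eventually_sequentiallyI[of "max n0 1"]) auto
    moreover have "ex \<in> \<Omega>(\<lambda>n. real n powr r)"
      using lower ex0 low(1) by (intro landau_omega.bigI[of c] eventually_sequentiallyI[of n0]) auto
    ultimately have "ex \<in> \<Theta>(\<lambda>n. real n powr r)" by (rule bigthetaI)
    then show ?thesis unfolding ex_def .
  qed
  show ?thesis
    using k mem theta unfolding r_def
    by (intro exI[of _ "card fam"] exI[of _ F] exI[of _ R] conjI ballI exI[of _ "L1 + 1"] allI impI) auto
qed

end
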